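(* Let $k$ be a number field and let $C: F(X,Y,Z)=0$, with $F\in k[X,Y,Z]$ homogeneous, be a smooth projective plane curve of degree $d\geq 5$ over $k$. Then any quadratic geometric (resp. arithmetic) progression sequence on $C$ is finite; that is, no quadratic geometric progression sequence on $C$ is infinite, and no quadratic arithmetic progression sequence on $C$ is infinite.
   Context: $k$ is a number field with fixed algebraic closure $\overline{k}$. A smooth projective plane curve $C: F(X,Y,Z)=0$ over $k$ is the zero locus in $\mathbb{P}^2$ of a homogeneous polynomial $F\in k[X,Y,Z]$ with no singularities over $\overline{k}$; its degree is $\deg F$. The set of quadratic points is $\Gamma_2(C,k)=\bigcup_{[\ell:k]=2}C(\ell)$, the union being over all quadratic extensions $\ell/k$ inside $\overline{k}$ (in particular it contains $C(k)$). A quadratic geometric progression sequence on $C$ is a sequence of points $P_i=(x_i:1:z_i)\in \Gamma_2(C,k)$, $i=1,2,\ldots$ (finite or infinite in length), with $x_i\in k$, such that there exist $t,t'\in k^*$ with $x_i=t't^i$ for all $i$. A quadratic arithmetic progression sequence on $C$ is a sequence of points $P_i=(x_i:1:z_i)\in\Gamma_2(C,k)$, $i=1,2,\ldots$, with $x_i\in k$, such that there exist $t,t'\in k^*$ with $x_i=t'+it$ for all $i$. Progressions are regarded as sets of points: such a sequence is called infinite if it is indexed by all positive integers and contains infinitely many distinct points $P_i$, and finite otherwise. *)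

theory Defs
  imports
    "HOL-Algebra.Algebraic_Closure_Type"
    "HOL-Analysis.Cartesian_Space"
    "HOL-Library.Poly_Mapping"
    "HOL-Library.Extended_Nat"
begin

section \<open>Number fields and quadratic extensions\<close>

definition number_field :: "'k::field_char_0 itself \<Rightarrow> bool" where
  "number_field _ \<longleftrightarrow>
     (\<exists>B. finite_dimensional_vector_space (\<lambda>(q::rat) (x::'k). of_rat q * x) B)"

text \<open>
  The fixed algebraic closure of \<open>'k\<close> is the library type \<open>'k alg_closure\<close>, into which
  \<open>'k\<close> is embedded by \<open>to_ac\<close>.
\<close>

lemma vector_space_alg_closure:
  "vector_space (\<lambda>(c::'k::field) (x::'k alg_closure). to_ac c * x)"
  by unfold_locales (simp_all add: algebra_simps)

text \<open>
  \<open>dim\<close> of an infinite-dimensional space is \<open>0\<close>, so dimension \<open>2\<close> entails finiteness.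
\<close>

definition quadratic_extension :: "'k::field alg_closure set \<Rightarrow> bool" where
  "quadratic_extension L \<longleftrightarrow>
     subfield L ring_of_type_algebra \<and> range to_ac \<subseteq> L \<and>
     vector_space.dim (\<lambda>(c::'k) (x::'k alg_closure). to_ac c * x) L = 2"

section \<open>Ternary polynomials\<close>

text \<open>
  A monomial is its exponent vector; the indices \<open>1, 2, 3 :: 3\<close> stand for the variables
  \<open>X, Y, Z\<close>.
\<close>

type_synonym 'k ternary = "(3 \<Rightarrow>\<^sub>0 nat) \<Rightarrow>\<^sub>0 'k"

definition eval_ac :: "'k::field ternary \<Rightarrow> 'k alg_closure ^ 3 \<Rightarrow> 'k alg_closure" where
  "eval_ac F v =
     (\<Sum>m\<in>Poly_Mapping.keys F. to_ac (Poly_Mapping.lookup F m) *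
        (\<Prod>i\<in>UNIV. (v $ i) ^ Poly_Mapping.lookup m i))"

definition homogeneous :: "nat \<Rightarrow> 'k::zero ternary \<Rightarrow> bool" where
  "homogeneous d F \<longleftrightarrow>
     (\<forall>m\<in>Poly_Mapping.keys F. (\<Sum>i\<in>UNIV. Poly_Mapping.lookup m i) = d)"

text \<open>
  The truncated exponent subtraction is harmless: a monomial not involving the \<open>i\<close>-th variable
  contributes the coefficient \<open>0\<close>.
\<close>

definition partial :: "3 \<Rightarrow> 'k::comm_ring_1 ternary \<Rightarrow> 'k ternary" where
  "partial i F =
     (\<Sum>m\<in>Poly_Mapping.keys F. Poly_Mapping.single (m - Poly_Mapping.single i 1)
        (of_nat (Poly_Mapping.lookup m i) * Poly_Mapping.lookup F m))"

section \<open>Plane curves and their points\<close>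

text \<open>
  A point of the projective plane over the algebraic closure is a class of nonzero vectors up to
  nonzero scalars; \<open>proj_point v\<close> is the class of \<open>v\<close>.
\<close>

definition proj_point :: "'a::field ^ 3 \<Rightarrow> ('a ^ 3) set" where
  "proj_point v = {c *s v | c. c \<noteq> 0}"

definition smooth_plane_curve :: "nat \<Rightarrow> 'k::field ternary \<Rightarrow> bool" where
  "smooth_plane_curve d F \<longleftrightarrow>
     F \<noteq> 0 \<and> homogeneous d F \<and>
     (\<forall>v. v \<noteq> 0 \<longrightarrow> eval_ac F v = 0 \<longrightarrow> (\<exists>i. eval_ac (partial i F) v \<noteq> 0))"

definition curve_points ::
    "'k::field ternary \<Rightarrow> 'k alg_closure set \<Rightarrow> ('k alg_closure ^ 3) set set" where
  "curve_points F L = {proj_point v | v. v \<noteq> 0 \<and> (\<forall>i. v $ i \<in> L) \<and> eval_ac F v = 0}"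

definition quadratic_points :: "'k::field ternary \<Rightarrow> ('k alg_closure ^ 3) set set" where
  "quadratic_points F = (\<Union>L\<in>{L. quadratic_extension L}. curve_points F L)"

section \<open>Progressions\<close>

text \<open>
  A sequence of points is a length \<open>N\<close> (possibly \<open>\<infinity>\<close>) together with a function \<open>P\<close>, of which
  only the values \<open>P i\<close> with \<open>1 \<le> i \<le> N\<close> are relevant.
\<close>

definition quadratic_sequence ::
    "'k::field ternary \<Rightarrow> enat \<Rightarrow> (nat \<Rightarrow> 'k) \<Rightarrow> (nat \<Rightarrow> ('k alg_closure ^ 3) set) \<Rightarrow> bool" where
  "quadratic_sequence F N x P \<longleftrightarrow>
     (\<exists>z. \<forall>i. 1 \<le> i \<and> enat i \<le> N \<longrightarrow>
        P i = proj_point (vector [to_ac (x i), 1, z i]) \<and> P i \<in> quadratic_points F)"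

definition quadratic_geometric_progression ::
    "'k::field ternary \<Rightarrow> enat \<Rightarrow> (nat \<Rightarrow> ('k alg_closure ^ 3) set) \<Rightarrow> bool" where
  "quadratic_geometric_progression F N P \<longleftrightarrow>
     (\<exists>x t t'. quadratic_sequence F N x P \<and> t \<noteq> 0 \<and> t' \<noteq> 0 \<and>
        (\<forall>i. 1 \<le> i \<and> enat i \<le> N \<longrightarrow> x i = t' * t ^ i))"

definition quadratic_arithmetic_progression ::
    "'k::field ternary \<Rightarrow> enat \<Rightarrow> (nat \<Rightarrow> ('k alg_closure ^ 3) set) \<Rightarrow> bool" where
  "quadratic_arithmetic_progression F N P \<longleftrightarrow>
     (\<exists>x t t'. quadratic_sequence F N x P \<and> t \<noteq> 0 \<and> t' \<noteq> 0 \<and>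
        (\<forall>i. 1 \<le> i \<and> enat i \<le> N \<longrightarrow> x i = t' + of_nat i * t))"

definition infinite_sequence :: "enat \<Rightarrow> (nat \<Rightarrow> 'p) \<Rightarrow> bool" where
  "infinite_sequence N P \<longleftrightarrow> N = \<infinity> \<and> infinite (P ` {i. 1 \<le> i})"

end

theory Submission
  imports Defs "Subresultants.More_Homomorphisms"
begin

text \<open>
  It suffices to treat an exponential sequence \<open>x\<^sub>j = \<alpha> + \<beta> \<tau>\<^sup>j\<close> with \<open>\<tau>\<close> not a root of unity: an
  arithmetic progression contains one (take the indices \<open>2\<^sup>j\<close>), and if the ratio of a geometric
  progression is a root of unity, then there are only finitely many \<open>x\<^sub>i\<close>, each with finitely many
  points above it. After making the equation monic in \<open>z\<close>, the trace \<open>a\<^sub>j\<close> and the norm \<open>b\<^sub>j\<close> of the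
  point above \<open>x\<^sub>j\<close> lie in \<open>k\<close> and are integral outside finitely many places. By Newton--Puiseux
  expansion in \<open>u = \<tau>\<^sup>j\<close> at \<open>0\<close> and at \<open>\<infinity>\<close> (on the indices divisible by some \<open>M\<close>), they are
  exponentially close, at each place with \<open>\<bar>\<tau>\<bar> \<noteq> 1\<close>, to values of one of finitely many Laurent
  polynomials in \<open>u\<close>. Colour \<open>j\<close> by the Laurent polynomials that occur. A suitable divided
  difference of the \<open>a\<^sub>j\<close> over indices of one colour is then small at the places with
  \<open>\<bar>\<tau>\<bar> \<noteq> 1\<close>, bounded at finitely many
  others and integral elsewhere, so it vanishes by the product formula. Hence \<open>a\<^sub>j\<close> and \<open>b\<^sub>j\<close> are
  Laurent polynomials in \<open>u\<close> of bounded degree on arbitrarily large sets of indices, and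
  \<open>F(\<psi>(u), 1, z)\<close>, where \<open>\<psi> = \<alpha> + \<beta> u\<^sup>M\<close>, has a factor of degree \<open>1\<close> or \<open>2\<close> in \<open>z\<close>. In the quadratic
  case, the traces of \<open>\<psi>' du / F\<^sub>Z\<close> and \<open>z \<psi>' du / F\<^sub>Z\<close> are regular on the \<open>u\<close>-line because
  \<open>d \<ge> 4\<close>, so they vanish, which forces \<open>F\<^sub>Z = 0\<close> along the factor and contradicts smoothness; the
  linear case is similar.
\<close>

text \<open>The coordinates \<open>z\<close> of the points lie in quadratic extensions of
  \<open>k\<close> that vary with the index, so no product formula over a fixed field applies to
  them; their traces and norms lie in \<open>k\<close>, which is why symmetric functions of a
  conjugate pair are approximated. Where \<tau> has absolute value one, nothing better than
  boundedness is available. A single other place is enough, and Kronecker's theorem provides it: the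
  weights of the divided differences do not move with \<open>j\<close>, so the product over all
  places decays geometrically. The order of the choices matters. The ramification index depends only
  on the degree in \<open>z\<close>, the exponent bound of the Laurent polynomials only on the
  equation and the sequence, and the number of indices of one colour is chosen last, beyond the
  degree of every remainder that has to vanish. Two traces suffice because the two roots of the
  factor differ: \<open>1\<close> and \<open>z\<close> separate the points above \<open>u\<close>,
  so the differential vanishes at each of them. All absolute values are defined on the whole
  algebraic closure, since the coefficients of the expansions lie there.\<close>

hide_const (open) Polynomials.degree Polynomials.lead_coeff

instance alg_closure :: (field) field_gcd ..

section \<open>Truncated Newton--Puiseux expansions\<close>

text \<open>Elements of \<open>'a poly poly\<close> are polynomials in \<open>y\<close> whose
  coefficients are polynomials in a parameter \<open>u\<close>. Polynomials in \<open>u\<close>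
  stand in for power series: only congruences modulo \<open>u^T\<close> occur, in the form
  \<open>[:monom 1 T:] dvd p - q\<close>.\<close>

definition residue_poly :: "'a::comm_ring_1 poly poly \<Rightarrow> 'a poly" where
  "residue_poly p = map_poly (\<lambda>c. poly c 0) p"

definition lift_poly :: "'a::comm_ring_1 poly \<Rightarrow> 'a poly poly" where
  "lift_poly p = map_poly (\<lambda>a. [:a:]) p"

definition power_subst :: "nat \<Rightarrow> 'a::comm_ring_1 poly poly \<Rightarrow> 'a poly poly" where
  "power_subst M p = map_poly (\<lambda>c. pcompose c (monom 1 M)) p"

interpretation residue_hom: comm_ring_hom "residue_poly :: 'a::comm_ring_1 poly poly \<Rightarrow> _"
proof -
  interpret map_poly_comm_ring_hom "\<lambda>c::'a poly. poly c 0"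
    by (rule map_poly_comm_ring_hom.intro) (rule poly_hom.comm_ring_hom_axioms)
  have eq: "residue_poly = map_poly (\<lambda>c::'a poly. poly c 0)"
    by (rule ext) (simp add: residue_poly_def)
  show "comm_ring_hom (residue_poly :: 'a poly poly \<Rightarrow> _)"
    unfolding eq by (rule comm_ring_hom_axioms)
qed

interpretation power_subst_hom: comm_ring_hom "power_subst M :: 'a::comm_ring_1 poly poly \<Rightarrow> _"
proof -
  interpret map_poly_comm_ring_hom "\<lambda>c::'a poly. pcompose c (monom 1 M)"
    by (rule map_poly_comm_ring_hom.intro) (rule pcompose_hom.comm_ring_hom_axioms)
  have eq: "power_subst M = map_poly (\<lambda>c::'a poly. pcompose c (monom 1 M))"
    by (rule ext) (simp add: power_subst_def)
  show "comm_ring_hom (power_subst M :: 'a poly poly \<Rightarrow> _)"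
    unfolding eq by (rule comm_ring_hom_axioms)
qed

lemma coeff_residue_poly [simp]: "coeff (residue_poly p) i = poly (coeff p i) 0"
  by (simp add: residue_poly_def coeff_map_poly)

lemma coeff_lift_poly [simp]: "coeff (lift_poly p) i = [:coeff p i:]"
  by (simp add: lift_poly_def coeff_map_poly)

lemma coeff_power_subst [simp]: "coeff (power_subst M p) i = pcompose (coeff p i) (monom 1 M)"
  by (simp add: power_subst_def coeff_map_poly)

lemma residue_lift_poly [simp]: "residue_poly (lift_poly p) = p"
  by (rule poly_eqI) simp

lemma degree_lift_poly [simp]: "degree (lift_poly p) = degree p"
  unfolding lift_poly_def by (rule degree_map_poly) simp

lemma residue_poly_eq_0_dvd:
  fixes q :: "'a::idom poly poly"
  assumes "residue_poly q = 0"
  shows "[:monom 1 1:] dvd q"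
proof -
  have "monom 1 1 dvd coeff q i" for i
  proof -
    have "poly (coeff q i) 0 = 0"
      using assms by (metis coeff_residue_poly coeff_0)
    then have "[:-0, 1:] dvd coeff q i"
      using poly_eq_0_iff_dvd by blast
    then show ?thesis
      by (metis minus_zero x_as_monom)
  qed
  then show ?thesis
    by (simp add: const_poly_dvd_iff)
qed

lemma residue_poly_monom [simp]: "T > 0 \<Longrightarrow> residue_poly [:monom 1 T:] = 0"
  by (rule poly_eqI) (simp add: coeff_pCons poly_monom power_0_left split: nat.splits)

lemma degree_residue_monic:
  assumes "lead_coeff p = 1"
  shows "degree (residue_poly p) = degree p" "lead_coeff (residue_poly p) = 1"
proof -
  have "coeff (residue_poly p) (degree p) = 1"
    using assms by simp
  moreover have "degree (residue_poly p) \<le> degree p"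
    unfolding residue_poly_def by (rule degree_map_poly_le)
  ultimately show "degree (residue_poly p) = degree p"
    by (metis le_antisym le_degree zero_neq_one)
  with \<open>coeff (residue_poly p) (degree p) = 1\<close> show "lead_coeff (residue_poly p) = 1"
    by simp
qed

lemma degree_less_of_coeff_0:
  assumes "degree q \<le> n" "coeff q n = 0" "n > 0"
  shows "degree q < n"
  using assms by (metis leading_coeff_0_iff degree_0 le_neq_implies_less)

lemma monic_add_lower:
  fixes g d :: "'a::comm_ring_1 poly"
  assumes "lead_coeff g = 1" "degree d < degree g"
  shows "lead_coeff (g + d) = 1" "degree (g + d) = degree g"
  using assms by (simp_all add: degree_add_eq_left coeff_eq_0)

lemma monic_diff_degree_less:
  fixes p q :: "'a::comm_ring_1 poly"
  assumes "lead_coeff p = 1" "lead_coeff q = 1" "degree p = degree q" "degree q > 0"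
  shows "degree (p - q) < degree q"
  by (rule degree_less_of_coeff_0) (use assms in \<open>auto intro: degree_diff_le\<close>)

text \<open>One power of \<open>u\<close> is gained at a time. If \<open>r0\<close> is the residue
  of the error divided by \<open>u^(T+1)\<close>, the corrections solve
  \<open>g0 * dh + h0 * dg = r0\<close>, which is possible because \<open>g0\<close> and
  \<open>h0\<close> are coprime.\<close>

lemma truncated_hensel:
  fixes p :: "'a::field_gcd poly poly"
  assumes p: "lead_coeff p = 1"
    and split: "residue_poly p = g0 * h0" and cop: "coprime g0 h0"
    and g0: "lead_coeff g0 = 1" "degree g0 > 0" and h0: "lead_coeff h0 = 1" "degree h0 > 0"
  shows "\<exists>g h. lead_coeff g = 1 \<and> lead_coeff h = 1 \<and> degree g = degree g0 \<and>
    degree h = degree h0 \<and> residue_poly g = g0 \<and> residue_poly h = h0 \<and>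
    [:monom 1 (Suc T):] dvd p - g * h"
proof (induction T)
  case 0
  have "residue_poly (p - lift_poly g0 * lift_poly h0) = 0"
    by (simp add: residue_hom.hom_minus residue_hom.hom_mult split)
  then have "[:monom 1 (Suc 0):] dvd p - lift_poly g0 * lift_poly h0"
    using residue_poly_eq_0_dvd by fastforce
  then show ?case
    using g0 h0 by (intro exI[of _ "lift_poly g0"] exI[of _ "lift_poly h0"]) auto
next
  case (Suc T)
  then obtain g h where g: "lead_coeff g = 1" "degree g = degree g0" "residue_poly g = g0"
    and h: "lead_coeff h = 1" "degree h = degree h0" "residue_poly h = h0"
    and dvd: "[:monom 1 (Suc T):] dvd p - g * h"
    by blast
  obtain r where r: "p - g * h = [:monom 1 (Suc T):] * r"
    using dvd by (elim dvdE)
  have "g0 \<noteq> 0" "h0 \<noteq> 0" "g \<noteq> 0" "h \<noteq> 0"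
    using g0 h0 g h by auto
  define n where "n = degree g0 + degree h0"
  have deg_gh: "degree (g * h) = n" and lc_gh: "lead_coeff (g * h) = 1"
    using g h \<open>g \<noteq> 0\<close> \<open>h \<noteq> 0\<close> lead_coeff_mult[of g h] by (simp_all add: n_def degree_mult_eq)
  have deg_p: "degree p = n"
    using degree_residue_monic(1)[OF p] split \<open>g0 \<noteq> 0\<close> \<open>h0 \<noteq> 0\<close>
    by (simp add: n_def degree_mult_eq)
  have "degree (p - g * h) < n"
    using monic_diff_degree_less[OF p lc_gh] deg_p deg_gh g0 by (simp add: n_def)
  then have deg_r: "degree r < n"
    unfolding r by (simp add: monom_eq_0_iff)
  define r0 where "r0 = residue_poly r"
  have deg_r0: "degree r0 < n"
    unfolding r0_def residue_poly_def using degree_map_poly_le deg_r by (rule le_less_trans)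
  define u where "u = fst (bezout_coefficients g0 h0)"
  define v where "v = snd (bezout_coefficients g0 h0)"
  have bez: "u * g0 + v * h0 = 1"
    using bezout_coefficients_fst_snd[of g0 h0] cop by (simp add: u_def v_def)
  \<comment> \<open>The Bezout solution \<open>u * r0\<close>, \<open>v * r0\<close> has
    uncontrolled degree. Reduction modulo \<open>g0\<close>, with the quotient moved into
    \<open>dh\<close>, keeps the corrections below the leading terms, so both factors stay monic;
    the bound on \<open>dh\<close> is read off from \<open>key\<close>.\<close>
  define dg where "dg = (v * r0) mod g0"
  define k where "k = (v * r0) div g0"
  define dh where "dh = u * r0 + h0 * k"
  have vk: "v * r0 = g0 * k + dg"
    by (simp add: k_def dg_def)
  have key: "g0 * dh = r0 - h0 * dg"
  proof -
    have "h0 * dg = h0 * (v * r0) - h0 * (g0 * k)"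
      using vk by (simp add: algebra_simps)
    then have "r0 - h0 * dg = (u * g0 + v * h0) * r0 - (h0 * (v * r0) - h0 * (g0 * k))"
      using bez by simp
    also have "\<dots> = g0 * dh"
      unfolding dh_def by (simp add: algebra_simps)
    finally show ?thesis ..
  qed
  have deg_dg: "degree dg < degree g0"
    unfolding dg_def using g0(2) \<open>g0 \<noteq> 0\<close>
    by (metis degree_mod_less' degree_0 mod_eq_0_iff_dvd)
  have deg_dh: "degree dh < degree h0"
  proof (cases "dh = 0")
    case False
    have "degree (h0 * dg) < n"
      using deg_dg degree_mult_le[of h0 dg] by (simp add: n_def)
    then have "degree (r0 - h0 * dg) < n"
      using deg_r0 by (metis degree_diff_less)
    then show ?thesis
      using False \<open>g0 \<noteq> 0\<close> unfolding key[symmetric] by (simp add: degree_mult_eq n_def)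
  qed (use h0 in simp)
  define Xp where "Xp = ([:monom 1 (Suc T):] :: 'a poly poly)"
  define g1 where "g1 = g + Xp * lift_poly dg"
  define h1 where "h1 = h + Xp * lift_poly dh"
  have degX: "degree (Xp * lift_poly q) = degree q" for q
    unfolding Xp_def by (simp add: monom_eq_0_iff)
  have g1: "lead_coeff g1 = 1" "degree g1 = degree g0"
    using monic_add_lower[of g "Xp * lift_poly dg"] g deg_dg degX by (auto simp: g1_def)
  have h1: "lead_coeff h1 = 1" "degree h1 = degree h0"
    using monic_add_lower[of h "Xp * lift_poly dh"] h deg_dh degX by (auto simp: h1_def)
  have resX: "residue_poly Xp = 0"
    unfolding Xp_def by simp
  have resg1: "residue_poly g1 = g0" and resh1: "residue_poly h1 = h0"
    unfolding g1_def h1_def using resX g h by (simp_all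
        add: residue_hom.hom_add residue_hom.hom_mult)
  have diff: "p - g1 * h1 = Xp * (r - g * lift_poly dh - h * lift_poly dg
      - Xp * (lift_poly dg * lift_poly dh))"
    using r unfolding g1_def h1_def Xp_def[symmetric] by (simp add: algebra_simps)
  have "residue_poly (r - g * lift_poly dh - h * lift_poly dg - Xp * (lift_poly dg * lift_poly dh))
      = 0"
    using key g h resX
    by (simp add: residue_hom.hom_minus residue_hom.hom_mult r0_def[symmetric])
  from residue_poly_eq_0_dvd[OF this]
  have "Xp * [:monom 1 1:] dvd p - g1 * h1"
    unfolding diff by (rule mult_dvd_mono[OF dvd_refl])
  moreover have "Xp * [:monom 1 1:] = [:monom 1 (Suc (Suc T)):]"
    unfolding Xp_def by (simp add: mult_monom)
  ultimately show ?case
    using g1 h1 resg1 resh1 by (intro exI[of _ g1] exI[of _ h1]) auto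
qed

section \<open>Factorization into linear factors after ramification of the parameter\<close>

definition prod_linear :: "'a::comm_ring_1 list \<Rightarrow> 'a poly" where
  "prod_linear cs = (\<Prod>c\<leftarrow>cs. [:-c, 1:])"

lemma prod_linear_simps:
  "prod_linear [] = 1" "prod_linear (c # cs) = [:-c, 1:] * prod_linear cs"
  "prod_linear (xs @ ys) = prod_linear xs * prod_linear ys"
  by (simp_all add: prod_linear_def)

text \<open>Puiseux's theorem without power series: after \<open>u\<close> is replaced by
  \<open>u^M\<close> a factorization exists to every order \<open>T\<close>. The roots
  \<open>\<phi>s\<close> for different \<open>T\<close> need not be compatible, whereas
  \<open>M\<close> does not depend on \<open>T\<close>.\<close>

definition splits_after :: "nat \<Rightarrow> 'a::comm_ring_1 poly poly \<Rightarrow> bool" where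
  "splits_after M p \<longleftrightarrow> (\<forall>T. \<exists>\<phi>s. length \<phi>s = degree p \<and>
     [:monom 1 T:] dvd power_subst M p - prod_linear \<phi>s)"

lemma pcompose_monom_monom: "pcompose (monom 1 M) (monom 1 N)
    = (monom 1 (M * N) :: 'a::comm_ring_1 poly)"
proof -
  have "pcompose (monom 1 M) (monom 1 N) = (pcompose (monom 1 1) (monom 1 N)) ^ M"
    by (metis pcompose_hom.hom_power x_pow_n)
  also have "pcompose (monom 1 1) (monom 1 N) = (monom 1 N :: 'a poly)"
    by (simp add: monom_Suc monom_0 pcompose_pCons)
  finally show ?thesis
    by (simp add: monom_power mult.commute)
qed

lemma power_subst_power_subst: "power_subst N (power_subst M p) = power_subst (M * N) p"
proof (rule poly_eqI)
  fix i
  show "coeff (power_subst N (power_subst M p)) i = coeff (power_subst (M * N) p) i"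
    by (simp add: pcompose_assoc[symmetric] pcompose_monom_monom)
qed

lemma power_subst_const: "power_subst M [:c:] = [:pcompose c (monom 1 M):]"
  by (rule poly_eqI) (simp add: coeff_pCons split: nat.splits)

lemma power_subst_linear: "power_subst M [:-c, 1:] = [:-pcompose c (monom 1 M), 1:]"
  by (rule poly_eqI) (simp add: coeff_pCons pcompose_uminus split: nat.splits)

lemma power_subst_prod_linear:
  "power_subst M (prod_linear \<phi>s) = prod_linear (map (\<lambda>c. pcompose c (monom 1 M)) \<phi>s)"
  by (induction \<phi>s) (simp_all only: list.map prod_linear_simps power_subst_linear
      power_subst_hom.hom_mult power_subst_hom.hom_one)

lemma power_subst_dvd:
  fixes q :: "'a::idom poly poly"
  assumes "[:monom 1 T:] dvd q" "N > 0"
  shows "[:monom 1 T:] dvd power_subst N q"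
proof -
  have "power_subst N [:monom 1 T:] dvd power_subst N q"
    using assms(1) by (rule power_subst_hom.hom_dvd)
  then have "[:monom 1 (T * N):] dvd power_subst N q"
    by (simp add: power_subst_const pcompose_monom_monom)
  moreover have "[:monom 1 T:] dvd ([:monom 1 (T * N):] :: 'a poly poly)"
  proof -
    have "T * N = T + (T * N - T)"
      using assms(2) by (cases N) auto
    then have "(monom 1 (T * N) :: 'a poly) = monom 1 T * monom 1 (T * N - T)"
      by (metis mult_monom mult_1)
    then have "[:monom 1 (T * N):] = [:monom 1 T:] * ([:monom 1 (T * N - T):] :: 'a poly poly)"
      by simp
    then show ?thesis
      by (metis dvd_triv_left)
  qed
  ultimately show ?thesis
    by (rule dvd_trans[rotated])
qed

lemma splits_after_mult:
  fixes p :: "'a::idom poly poly"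
  assumes "splits_after M p" "N > 0"
  shows "splits_after (M * N) p"
  unfolding splits_after_def
proof
  fix T
  obtain \<phi>s where \<phi>s: "length \<phi>s = degree p"
    "[:monom 1 T:] dvd power_subst M p - prod_linear \<phi>s"
    using assms(1) unfolding splits_after_def by blast
  have "[:monom 1 T:] dvd power_subst N (power_subst M p - prod_linear \<phi>s)"
    using \<phi>s(2) assms(2) by (rule power_subst_dvd)
  then show "\<exists>\<phi>s. length \<phi>s = degree p \<and>
    [:monom 1 T:] dvd power_subst (M * N) p - prod_linear \<phi>s"
    using \<phi>s(1) unfolding power_subst_hom.hom_minus power_subst_power_subst power_subst_prod_linear
    by (intro exI[of _ "map (\<lambda>c. pcompose c (monom 1 N)) \<phi>s"]) simp
qed

text \<open>Modulo \<open>u^T\<close> only the factors modulo \<open>u^T\<close> count, so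
  \<open>g\<close> and \<open>h\<close> may change with \<open>T\<close> and need to multiply to
  \<open>p\<close> only approximately. This is the form in which the factors of
  \<open>truncated_hensel\<close> arrive.\<close>

lemma splits_after_product:
  fixes p :: "'a::idom poly poly"
  assumes "\<And>T. \<exists>g h. splits_after M g \<and> splits_after M h \<and> degree g + degree h = degree p \<and>
     [:monom 1 (Suc T):] dvd p - g * h" and "M > 0"
  shows "splits_after M p"
  unfolding splits_after_def
proof
  fix T
  obtain g h where gh: "splits_after M g" "splits_after M h" "degree g + degree h = degree p"
     and dvd: "[:monom 1 (Suc T):] dvd p - g * h"
    using assms(1) by blast
  obtain xs where xs: "length xs = degree g"
    "[:monom 1 T:] dvd power_subst M g - prod_linear xs"
    using gh(1) unfolding splits_after_def by blast
  obtain ys where ys: "length ys = degree h"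
    "[:monom 1 T:] dvd power_subst M h - prod_linear ys"
    using gh(2) unfolding splits_after_def by blast
  have "[:monom 1 T:] dvd ([:monom 1 (Suc T):] :: 'a poly poly)"
  proof -
    have "[:monom 1 (Suc T):] = [:monom 1 T:] * ([:monom 1 1:] :: 'a poly poly)"
      by (simp add: mult_monom)
    then show ?thesis
      by (metis dvd_triv_left)
  qed
  then have "[:monom 1 T:] dvd power_subst M (p - g * h)"
    using dvd assms(2) by (intro power_subst_dvd) (rule dvd_trans)
  moreover have "[:monom 1 T:] dvd (power_subst M g - prod_linear xs) * power_subst M h +
      prod_linear xs * (power_subst M h - prod_linear ys)"
    using xs(2) ys(2) by (intro dvd_add dvd_mult dvd_mult2)
  ultimately have "[:monom 1 T:] dvd power_subst M (p - g * h) +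
      ((power_subst M g - prod_linear xs) * power_subst M h +
      prod_linear xs * (power_subst M h - prod_linear ys))"
    by (rule dvd_add)
  moreover have "power_subst M (p - g * h) +
      ((power_subst M g - prod_linear xs) * power_subst M h +
      prod_linear xs * (power_subst M h - prod_linear ys)) =
     power_subst M p - prod_linear (xs @ ys)"
    by (simp add: prod_linear_simps power_subst_hom.hom_minus power_subst_hom.hom_mult
        algebra_simps)
  ultimately show "\<exists>\<phi>s. length \<phi>s = degree p \<and>
    [:monom 1 T:] dvd power_subst M p - prod_linear \<phi>s"
    using xs(1) ys(1) gh(3) by (intro exI[of _ "xs @ ys"]) simp
qed

text \<open>Translation of the unknown translates the roots. This undoes the change of variable that
  removes the coefficient of degree \<open>n - 1\<close>.\<close>

lemma splits_after_shift:
  fixes p :: "'a::idom poly poly"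
  assumes "splits_after M (pcompose p [:b, 1:])"
  shows "splits_after M p"
  unfolding splits_after_def
proof
  fix T
  have deg: "degree (pcompose p [:b, 1:]) = degree p"
    by simp
  obtain xs where xs: "length xs = degree p"
    "[:monom 1 T:] dvd power_subst M (pcompose p [:b, 1:]) - prod_linear xs"
    using assms unfolding splits_after_def deg by blast
  define c where "c = pcompose b (monom 1 M)"
  obtain k where k: "power_subst M (pcompose p [:b, 1:]) - prod_linear xs = [:monom 1 T:] * k"
    using xs(2) by (elim dvdE)
  have "power_subst M p = pcompose (power_subst M (pcompose p [:b, 1:])) [:-c, 1:]"
  proof -
    have "pcompose (pcompose p [:b, 1:]) [:-b, 1:] = pcompose p (pcompose [:b, 1:] [:-b, 1:])"
      by (simp only: pcompose_assoc)
    also have "pcompose [:b, 1:] [:-b, 1:] = [:0, 1:]"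
      by (simp add: pcompose_pCons)
    finally have "pcompose (pcompose p [:b, 1:]) [:-b, 1:] = p"
      by (simp only: pcompose_idR)
    then have "power_subst M p = power_subst M (pcompose (pcompose p [:b, 1:]) [:-b, 1:])"
      by simp
    also have "\<dots> = pcompose (power_subst M (pcompose p [:b, 1:])) (power_subst M [:-b, 1:])"
      unfolding power_subst_def by (rule pcompose_hom.map_poly_pcompose)
    finally show ?thesis
      by (simp only: power_subst_linear c_def)
  qed
  moreover have "pcompose (prod_linear ys) [:-c, 1:] = prod_linear (map (\<lambda>x. x + c) ys)" for ys
  proof (induction ys)
    case (Cons a ys)
    have "pcompose [:-a, 1:] [:-c, 1:] = [:-(a + c), 1:]"
      by (simp add: pcompose_pCons)
    then show ?case
      by (simp only: prod_linear_simps list.map pcompose_mult Cons)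
  qed (simp add: prod_linear_simps)
  ultimately have "power_subst M p - prod_linear (map (\<lambda>x. x + c) xs)
      = pcompose ([:monom 1 T:] * k) [:-c, 1:]"
    unfolding k[symmetric] by (simp add: pcompose_diff)
  also have "\<dots> = [:monom 1 T:] * pcompose k [:-c, 1:]"
    by (simp only: pcompose_mult pcompose_const)
  finally have "[:monom 1 T:] dvd power_subst M p - prod_linear (map (\<lambda>x. x + c) xs)"
    by (metis dvd_triv_left)
  then show "\<exists>xs. length xs = degree p \<and> [:monom 1 T:] dvd power_subst M p - prod_linear xs"
    using xs(1) by (intro exI[of _ "map (\<lambda>x. x + c) xs"]) simp
qed

text \<open>This is \<open>e^n * p(y / e)\<close> written without division: for monic
  \<open>p\<close> of degree \<open>n\<close> its roots are those of \<open>p\<close> multiplied by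
  \<open>e\<close>.\<close>

definition scale_poly :: "nat \<Rightarrow> 'a::comm_ring_1 \<Rightarrow> 'a poly \<Rightarrow> 'a poly" where
  "scale_poly n e p = (\<Sum>i\<le>n. monom (e ^ (n - i) * coeff p i) i)"

lemma coeff_scale_poly: "coeff (scale_poly n e p) i = (if i
    \<le> n then e ^ (n - i) * coeff p i else 0)"
  by (simp add: scale_poly_def coeff_sum)

lemma scale_poly_linear_mult:
  assumes "degree f \<le> n"
  shows "scale_poly (Suc n) e ([:-c, 1:] * f) = [:-(e * c), 1:] * scale_poly n e f"
proof (rule poly_eqI)
  fix i
  show "coeff (scale_poly (Suc n) e ([:-c, 1:] * f)) i
      = coeff ([:-(e * c), 1:] * scale_poly n e f) i"
  proof (cases "i = Suc n")
    case True
    then show ?thesis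
      using assms by (simp add: coeff_scale_poly coeff_eq_0)
  next
    case False
    then have "n - j = Suc (n - i)" if "i = Suc j" "j \<le> n" for j
      using that by simp
    with False show ?thesis
      by (cases i) (auto simp: coeff_scale_poly algebra_simps)
  qed
qed

lemma degree_prod_linear:
  "degree (prod_linear xs :: 'a::idom poly) = length xs \<and>
      lead_coeff (prod_linear xs :: 'a poly) = 1"
proof (induction xs)
  case (Cons a xs)
  then have IH: "degree (prod_linear xs) = length xs" "coeff (prod_linear xs) (length xs) = 1"
    by auto
  then have "prod_linear xs \<noteq> 0"
    by auto
  then have "degree ([:-a, 1:] * prod_linear xs) = Suc (length xs)"
    using IH by (simp add: degree_mult_eq del: mult_pCons_left)
  moreover have "lead_coeff ([:-a, 1:] * prod_linear xs) = 1"
    using IH by (simp only: lead_coeff_mult) simp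
  ultimately show ?case
    by (simp only: prod_linear_simps) simp
qed (simp add: prod_linear_simps)

lemma scale_poly_prod_linear:
  "scale_poly (length xs) e (prod_linear xs :: 'a::idom poly) = prod_linear (map ((*) e) xs)"
proof (induction xs)
  case (Cons a xs)
  then show ?case
    using scale_poly_linear_mult[of "prod_linear xs" "length xs" e a] degree_prod_linear[of xs]
    by (simp only: list.map list.size prod_linear_simps add_0_right add_Suc_right)
qed (simp add: prod_linear_simps scale_poly_def monom_0)

text \<open>The substitution \<open>u -> u^b\<close>, \<open>y -> u^a * y\<close> attached to a
  slope \<open>a / b\<close> of the Newton polygon. Rescaling multiplies the coefficients of the
  error by powers of \<open>u\<close>, so the order \<open>T\<close> is not lost.\<close>

lemma splits_after_scale:
  fixes p q :: "'a::idom poly poly"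
  assumes "splits_after N q" and deg: "degree q = degree p"
    and pq: "power_subst b p = scale_poly (degree p) (monom 1 a) q"
  shows "splits_after (b * N) p"
  unfolding splits_after_def
proof
  fix T
  let ?n = "degree p"
  obtain xs where xs: "length xs = ?n"
    "[:monom 1 T:] dvd power_subst N q - prod_linear xs"
    using assms(1) deg unfolding splits_after_def by metis
  define e where "e = (monom 1 (a * N) :: 'a poly)"
  have "power_subst (b * N) p = power_subst N (power_subst b p)"
    by (simp add: power_subst_power_subst)
  also have "\<dots> = scale_poly ?n e (power_subst N q)"
    unfolding pq by (rule poly_eqI)
      (simp add: coeff_scale_poly pcompose_mult pcompose_hom.hom_power pcompose_monom_monom e_def)
  finally have 1: "power_subst (b * N) p = scale_poly ?n e (power_subst N q)" .
  have 2: "scale_poly ?n e (power_subst N q) - scale_poly ?n e (prod_linear xs) =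
      scale_poly ?n e (power_subst N q - prod_linear xs)"
    by (rule poly_eqI) (simp add: coeff_scale_poly algebra_simps)
  have "[:monom 1 T:] dvd scale_poly ?n e (power_subst N q - prod_linear xs)"
    using xs(2) unfolding const_poly_dvd_iff by (auto simp: coeff_scale_poly)
  then have "[:monom 1 T:] dvd power_subst (b * N) p - prod_linear (map ((*) e) xs)"
    using 1 2 scale_poly_prod_linear[of xs e] xs(1) by simp
  then show "\<exists>xs. length xs = degree p \<and> [:monom 1 T:] dvd power_subst (b * N) p - prod_linear xs"
    using xs(1) by (intro exI[of _ "map ((*) e) xs"]) simp
qed

text \<open>A residue with two distinct roots is a product of two coprime factors of positive
  degree, as the coefficient field is algebraically closed. Hensel's lemma lifts them to factors of
  smaller degree, to which the induction hypothesis applies.\<close>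

lemma splits_after_two_roots:
  fixes p :: "'a::{alg_closed_field, field_gcd} poly poly"
  assumes IH: "\<And>g :: 'a poly poly. degree g < degree p \<Longrightarrow> lead_coeff g = 1 \<Longrightarrow> splits_after M g"
    and "M > 0" and p: "lead_coeff p = 1"
    and xy: "poly (residue_poly p) x = 0" "poly (residue_poly p) y = 0" "x \<noteq> y"
  shows "splits_after M p"
proof (rule splits_after_product[OF _ \<open>M > 0\<close>])
  fix T
  note res = degree_residue_monic[OF p]
  have "residue_poly p \<noteq> 0"
    using res(2) by (metis leading_coeff_0_iff zero_neq_one)
  have "degree (residue_poly p) > 1"
  proof -
    have "card {x, y} \<le> card {z. poly (residue_poly p) z = 0}"
      using xy by (intro card_mono poly_roots_finite \<open>residue_poly p \<noteq> 0\<close>) auto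
    also have "\<dots> \<le> degree (residue_poly p)"
      by (rule card_poly_roots_bound) fact
    finally show ?thesis
      using xy(3) by simp
  qed
  then obtain r s where rs: "degree r > 0" "degree s > 0" "coprime r s" "residue_poly p = r * s"
    using alg_closed_imp_poly_splits_coprime xy by metis
  have lc: "lead_coeff r * lead_coeff s = 1"
    using res rs(4) by (metis lead_coeff_mult)
  then have nz: "lead_coeff r \<noteq> 0" "lead_coeff s \<noteq> 0"
    by auto
  define g0 where "g0 = smult (lead_coeff s) r"
  define h0 where "h0 = smult (lead_coeff r) s"
  have "residue_poly p = g0 * h0"
    using lc by (simp add: g0_def h0_def rs(4) mult.commute)
  moreover have "coprime g0 h0"
    using nz by (intro coprime_divisors[OF _ _ rs(3)]) (auto simp: g0_def h0_def smult_dvd_iff)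
  moreover have "lead_coeff g0 = 1" "lead_coeff h0 = 1" "degree g0 > 0" "degree h0 > 0"
    using lc rs nz by (auto simp: g0_def h0_def mult.commute)
  ultimately obtain g h where gh: "lead_coeff g = 1" "lead_coeff h = 1" "degree g = degree g0"
    "degree h = degree h0" "[:monom 1 (Suc T):] dvd p - g * h"
    using truncated_hensel[OF p, of g0 h0 T] by metis
  have sum: "degree g + degree h = degree p"
    using res(1) rs nz gh by (simp add: g0_def h0_def degree_mult_eq flip: res(1))
  have "degree g > 0" "degree h > 0"
    using gh rs nz by (auto simp: g0_def h0_def)
  then show "\<exists>g h. splits_after M g \<and> splits_after M h \<and> degree g + degree h = degree p \<and>
     [:monom 1 (Suc T):] dvd p - g * h"
    using sum gh by (intro exI[of _ g] exI[of _ h]) (auto intro!: IH)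
qed

text \<open>Taylor expansion: the part of degree below \<open>n\<close> keeps its coefficient of
  degree \<open>n - 1\<close>, and only \<open>(y + b)^n\<close> contributes a term with
  \<open>b\<close>. With \<open>b = - coeff p (n - 1) / n\<close> the coefficient
  disappears.\<close>

lemma coeff_pcompose_shift:
  fixes p :: "'a::idom poly"
  assumes "lead_coeff p = 1" "degree p = n" "n > 0"
  shows "coeff (pcompose p [:b, 1:]) (n - 1) = coeff p (n - 1) + of_nat n * b"
proof -
  define r where "r = p - monom 1 n"
  have "degree r < n"
    unfolding r_def by (rule degree_less_of_coeff_0) (use assms in \<open>auto intro!: degree_diff_le
        simp: degree_monom_eq\<close>)
  have r: "coeff (pcompose r [:b, 1:]) (n - 1) = coeff r (n - 1)"
  proof (cases "degree r = n - 1")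
    case True
    have "lead_coeff (pcompose r [:b, 1:]) = lead_coeff r"
      by (subst lead_coeff_comp) auto
    with True show ?thesis
      by simp
  next
    case False
    with \<open>degree r < n\<close> have "degree r < n - 1"
      by simp
    then show ?thesis
      by (simp add: coeff_eq_0)
  qed
  have p: "p = monom 1 n + r"
    by (simp add: r_def)
  have "n choose (n - 1) = n"
    using assms(3) by (subst binomial_symmetric) auto
  then have "coeff ([:b, 1:] ^ n) (n - 1) = of_nat n * b"
    using assms(3) by (subst coeff_linear_poly_power) auto
  moreover have "pcompose (monom 1 1) [:b, 1:] = [:b, 1:]"
    by (simp add: monom_Suc monom_0 pcompose_pCons)
  then have "pcompose (monom 1 n) [:b, 1:] = [:b, 1:] ^ n"
    by (metis pcompose_hom.hom_power x_pow_n)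
  ultimately show ?thesis
    using r assms(3) by (subst (1 2) p) (simp add: pcompose_add)
qed

lemma monic_single_root:
  fixes P :: "'a::alg_closed_field poly"
  assumes "lead_coeff P = 1" "\<And>x. poly P x = 0 \<Longrightarrow> x = c"
  shows "P = [:-c, 1:] ^ degree P"
proof -
  have "P \<noteq> 0"
    using assms(1) by auto
  then obtain A where A: "size A = degree P" "P = smult (lead_coeff P) (\<Prod>x\<in>#A. [:-x, 1:])"
    using alg_closed_imp_factorization by blast
  have P: "P = (\<Prod>x\<in>#A. [:-x, 1:])"
    using A(2) assms(1) by simp
  have "x = c" if "x \<in># A" for x
  proof -
    have "poly P x = 0"
      using that by (subst P) (auto simp: poly_prod_mset)
    then show ?thesis
      by (rule assms(2))
  qed
  then have "A = replicate_mset (size A) c"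
    by (intro set_mset_subset_singletonD) auto
  then have "(\<Prod>x\<in>#A. [:-x, 1:]) = [:-c, 1:] ^ size A"
    by (metis image_replicate_mset prod_mset_replicate_mset)
  with P A(1) show ?thesis
    by simp
qed

text \<open>The Newton polygon step. Unless the polynomial is \<open>y^n\<close>, rescaling along
  the smallest slope makes the residue different from \<open>y^n\<close>. Since its coefficient of
  degree \<open>n - 1\<close> is zero, it is not the \<open>n\<close>-th power of a monic linear
  polynomial in characteristic zero, so it has two distinct roots.\<close>

lemma splits_after_depressed:
  fixes q :: "'a::{alg_closed_field, field_gcd, field_char_0} poly poly"
  assumes IH: "\<And>g :: 'a poly poly. degree g < degree q \<Longrightarrow> lead_coeff g = 1 \<Longrightarrow> splits_after N g"
    and "N > 0" and q: "lead_coeff q = 1" and n: "degree q = n" "n > 0"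
    and dep: "coeff q (n - 1) = 0"
  shows "splits_after (fact n * N) q"
proof (cases "\<forall>i<n. coeff q i = 0")
  case True
  have q_eq: "q = monom 1 n"
  proof (rule poly_eqI)
    fix i show "coeff q i = coeff (monom 1 n) i"
      using True q n by (cases i n rule: linorder_cases) (auto simp: coeff_eq_0)
  qed
  have "power_subst M q = monom 1 n" for M
    by (rule poly_eqI) (simp add: q_eq coeff_monom)
  moreover have "prod_linear (replicate k 0) = monom (1 :: 'a poly) k" for k
    by (induction k) (simp_all add: prod_linear_simps monom_0 monom_Suc)
  ultimately show ?thesis
    unfolding splits_after_def using n by (intro allI exI[of _ "replicate n 0"]) simp
next
  case False
  define I where "I = {i. i < n \<and> coeff q i \<noteq> 0}"
  define od where "od i = order 0 (coeff q i)" for i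
  \<comment> \<open>The slope of the segment from the point of \<open>y^n\<close> to that of
    \<open>y^i\<close> in the Newton polygon. After rescaling along the minimum no exponent of
    \<open>u\<close> is negative, and the one at \<open>i0\<close> is zero.\<close>
  define f where "f i = real (od i) / real (n - i)" for i
  have "finite I" "I \<noteq> {}"
    using False by (auto simp: I_def)
  then have "Min (f ` I) \<in> f ` I" "\<And>i. i \<in> I \<Longrightarrow> Min (f ` I) \<le> f i"
    by auto
  then obtain i0 where i0: "i0 \<in> I" "\<And>i. i \<in> I \<Longrightarrow> f i0 \<le> f i"
    by (metis imageE)
  define b where "b = n - i0"
  define a where "a = od i0"
  have b: "0 < b" "b \<le> n"
    using i0(1) by (auto simp: b_def I_def)
  have ab: "a * (n - i) \<le> od i * b" if "i \<in> I" for i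
  proof -
    have "real a / real b \<le> real (od i) / real (n - i)"
      using i0(2)[OF that] by (simp add: f_def a_def b_def)
    moreover have "n - i > 0"
      using that by (simp add: I_def)
    ultimately have "real a * real (n - i) \<le> real (od i) * real b"
      using b by (simp add: divide_simps mult.commute)
    then show ?thesis
      by (metis of_nat_le_iff of_nat_mult)
  qed
  have "\<exists>r. \<forall>i\<in>I. coeff q i = monom 1 (od i) * r i \<and> poly (r i) 0 \<noteq> 0"
  proof (rule bchoice, rule ballI)
    fix i assume "i \<in> I"
    then have "coeff q i \<noteq> 0"
      by (simp add: I_def)
    then obtain r where "coeff q i = [:-0, 1:] ^ od i * r" "\<not> [:-0, 1:] dvd r"
      using order_decomp unfolding od_def by blast
    then show "\<exists>r. coeff q i = monom 1 (od i) * r \<and> poly r 0 \<noteq> 0"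
      by (metis minus_zero poly_eq_0_iff_dvd x_as_monom x_pow_n)
  qed
  then obtain r where r: "\<And>i. i \<in> I \<Longrightarrow> coeff q i = monom 1 (od i) * r i"
    "\<And>i. i \<in> I \<Longrightarrow> poly (r i) 0 \<noteq> 0"
    by blast
  define c where "c i = (if i = n then 1 else if i \<in> I
    then monom 1 (od i * b - a * (n - i)) * pcompose (r i) (monom 1 b) else 0)" for i
  define q1 where "q1 = (\<Sum>i\<le>n. monom (c i) i)"
  have coeff_q1: "coeff q1 i = (if i \<le> n then c i else 0)" for i
    by (simp add: q1_def coeff_sum)
  have deg_q1: "degree q1 = n"
  proof (rule antisym)
    show "degree q1 \<le> n"
      by (rule degree_le) (simp add: coeff_q1)
    show "n \<le> degree q1"
      by (rule le_degree) (simp add: coeff_q1 c_def)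
  qed
  then have monic_q1: "lead_coeff q1 = 1"
    by (simp add: coeff_q1 c_def)
  have scale: "power_subst b q = scale_poly n (monom 1 a) q1"
  proof (rule poly_eqI)
    fix i
    consider "i > n" | "i = n" | "i < n" "i \<notin> I" | "i < n" "i \<in> I"
      by linarith
    then show "coeff (power_subst b q) i = coeff (scale_poly n (monom 1 a) q1) i"
    proof cases
      case 4
      have "pcompose (coeff q i) (monom 1 b) = monom 1 (od i * b) * pcompose (r i) (monom 1 b)"
        using r(1)[OF 4(2)] by (simp add: pcompose_mult pcompose_monom_monom)
      also have "monom 1 (od i * b) = (monom 1 (a * (n - i)) * monom 1 (od i * b - a * (n - i)) ::
          'a poly)"
        using ab[OF 4(2)] by (simp add: mult_monom)
      finally show ?thesis
        using 4 by (simp add: coeff_scale_poly coeff_q1 c_def monom_power mult.assoc)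
    qed (use n q in \<open>auto simp: coeff_scale_poly coeff_q1 c_def coeff_eq_0 I_def\<close>)
  qed
  define R where "R = residue_poly q1"
  have R: "degree R = n" "lead_coeff R = 1"
    using degree_residue_monic[OF monic_q1] deg_q1 by (auto simp: R_def)
  have "coeff R i0 \<noteq> 0"
    using i0(1) r(2)[OF i0(1)]
    by (simp add: R_def coeff_q1 c_def a_def b_def I_def poly_pcompose poly_monom power_0_left)
  moreover have "coeff R (n - 1) = 0"
    using dep n by (simp add: R_def coeff_q1 c_def I_def)
  moreover have "i0 < n"
    using i0(1) by (simp add: I_def)
  \<comment> \<open>A single root \<open>x\<close> would give \<open>R = (y - x)^n\<close>; the
    missing coefficient of degree \<open>n - 1\<close> forces \<open>x = 0\<close>, against
    \<open>coeff R i0 \<noteq> 0\<close>.\<close>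
  ultimately have "\<exists>x y. poly R x = 0 \<and> poly R y = 0 \<and> x \<noteq> y"
  proof (rule_tac ccontr)
    assume R0: "coeff R i0 \<noteq> 0" "coeff R (n - 1) = 0" "i0 < n"
      and "\<nexists>x y. poly R x = 0 \<and> poly R y = 0 \<and> x \<noteq> y"
    moreover obtain x where "poly R x = 0"
      using alg_closed_imp_poly_has_root[of R] R n by auto
    ultimately have pw: "R = [:-x, 1:] ^ n"
      using monic_single_root[OF R(2), of x] R(1) by auto
    have "n choose (n - 1) = n"
      using n by (subst binomial_symmetric) auto
    then have "coeff R (n - 1) = - (of_nat n * x)"
      using n unfolding pw by (subst coeff_linear_poly_power) auto
    with R0(2) n have "x = 0"
      by simp
    then have "R = monom 1 n"
      using pw by (metis minus_zero x_as_monom x_pow_n)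
    with R0 show False
      by simp
  qed
  then have "splits_after N q1"
    using splits_after_two_roots[of q1 N] IH \<open>N > 0\<close> monic_q1 deg_q1 n(1) unfolding R_def by metis
  then have "splits_after (b * N) q"
    using scale n(1) deg_q1 by (intro splits_after_scale[of N q1 q b a]) auto
  \<comment> \<open>The denominator \<open>b\<close> depends on the polynomial but is at most
    \<open>n\<close>, so \<open>fact n\<close> is a common multiple for all polynomials of this
    degree.\<close>
  moreover obtain k where k: "fact n = b * k"
    using b dvd_fact[of b n] by (auto elim: dvdE)
  moreover have "k > 0"
    using k by (metis fact_gt_zero nat_0_less_mult_iff)
  ultimately show ?thesis
    using splits_after_mult[of "b * N" q k] by (simp add: k mult_ac)
qed

text \<open>At each degree the index is \<open>fact n\<close> times the product of the indices of
  all smaller degrees. That it depends on the degree alone is used when the expansions at zero and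
  at infinity are taken in the same power of the parameter.\<close>

theorem truncated_puiseux:
  "\<exists>M>0. \<forall>p :: 'a::{alg_closed_field, field_gcd, field_char_0} poly poly.
     degree p = n \<longrightarrow> lead_coeff p = 1 \<longrightarrow> splits_after M p"
proof (induction n rule: less_induct)
  case (less n)
  then obtain Mf where Mf: "\<And>k. k < n \<Longrightarrow> Mf k > 0"
    "\<And>p :: 'a poly poly. degree p < n \<Longrightarrow> lead_coeff p = 1 \<Longrightarrow> splits_after (Mf (degree p)) p"
    by metis
  define N where "N = (\<Prod>k<n. Mf k)"
  have "N > 0"
    unfolding N_def using Mf(1) by (intro prod_pos) auto
  have IH: "splits_after N p" if "degree p < n" "lead_coeff p = 1" for p :: "'a poly poly"
  proof -
    have "N = Mf (degree p) * (\<Prod>k\<in>{..<n} - {degree p}. Mf k)"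
      unfolding N_def using that(1) by (subst prod.remove[of _ "degree p"]) auto
    moreover have "(\<Prod>k\<in>{..<n} - {degree p}. Mf k) > 0"
      using Mf(1) by (intro prod_pos) auto
    ultimately show ?thesis
      using splits_after_mult Mf(2)[OF that] by metis
  qed
  have "splits_after (fact n * N) p" if p: "degree p = n" "lead_coeff p = 1" for p :: "'a poly poly"
  proof (cases "n = 0")
    case True
    with p have "p = 1"
      by (metis degree_eq_zeroE lead_coeff_pCons(2) one_pCons)
    then show ?thesis
      unfolding splits_after_def by (intro allI exI[of _ "[]"]) (simp add: prod_linear_simps)
  next
    case False
    define b where "b = smult (- (1 / of_nat n)) (coeff p (n - 1))"
    define q where "q = pcompose p [:b, 1:]"
    have "degree q = n"
      using p by (simp add: q_def)
    moreover have "lead_coeff q = 1"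
      unfolding q_def by (subst lead_coeff_comp) (use p in auto)
    moreover have "of_nat n * b = - coeff p (n - 1)"
      using False by (simp add: b_def of_nat_poly)
    then have "coeff q (n - 1) = 0"
      unfolding q_def using coeff_pcompose_shift[of p n b] p False by simp
    ultimately have "splits_after (fact n * N) q"
      using splits_after_depressed[of q N n] IH \<open>N > 0\<close> False by auto
    then show ?thesis
      unfolding q_def by (rule splits_after_shift)
  qed
  then show ?case
    using \<open>N > 0\<close> by (intro exI[of _ "fact n * N"]) auto
qed

corollary puiseux_evaluation:
  "\<exists>M>0. \<forall>p :: 'a::{alg_closed_field, field_gcd, field_char_0} poly poly.
     degree p = n \<longrightarrow> lead_coeff p = 1 \<longrightarrow>
     (\<forall>T. \<exists>\<phi>s r. length \<phi>s = n \<and> (\<forall>s y. poly (poly p [:y:]) (s ^ M) =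
        (\<Prod>\<phi>\<leftarrow>\<phi>s. y - poly \<phi> s) + s ^ T * poly (poly r [:y:]) s))"
proof -
  obtain M where M: "M > 0" "\<And>p :: 'a poly poly. degree p = n \<Longrightarrow> lead_coeff p = 1 \<Longrightarrow> splits_after M p"
    using truncated_puiseux by metis
  have "\<exists>\<phi>s r. length \<phi>s = n \<and> (\<forall>s y. poly (poly p [:y:]) (s ^ M) =
        (\<Prod>\<phi>\<leftarrow>\<phi>s. y - poly \<phi> s) + s ^ T * poly (poly r [:y:]) s)"
    if p: "degree p = n" "lead_coeff p = 1" for p :: "'a poly poly" and T
  proof -
    obtain \<phi>s where \<phi>s: "length \<phi>s = n" "[:monom 1 T:] dvd power_subst M p - prod_linear \<phi>s"
      using M(2)[OF p] p(1) unfolding splits_after_def by blast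
    then obtain r where r: "power_subst M p - prod_linear \<phi>s = [:monom 1 T:] * r"
      by (elim dvdE)
    have "poly (poly p [:y:]) (s ^ M) = (\<Prod>\<phi>\<leftarrow>\<phi>s. y - poly \<phi> s) + s ^ T * poly (poly r [:y:]) s"
        for s y
    proof -
      have "poly (power_subst M p) [:y:] = pcompose (poly p [:y:]) (monom 1 M)"
        using pcompose_hom.poly_map_poly[of "monom 1 M" p "[:y:]"] by (simp add: power_subst_def)
      then have "poly (poly (power_subst M p) [:y:]) s = poly (poly p [:y:]) (s ^ M)"
        by (simp add: poly_pcompose poly_monom)
      moreover have "power_subst M p = prod_linear \<phi>s + [:monom 1 T:] * r"
        using r by (simp add: algebra_simps)
      moreover have "poly (poly (prod_linear xs) [:y:]) s = (\<Prod>\<phi>\<leftarrow>xs. y - poly \<phi> s)" for xs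
        by (induction xs) (simp_all add: prod_linear_simps algebra_simps)
      ultimately show ?thesis
        by (simp add: poly_monom)
    qed
    with \<phi>s(1) show ?thesis
      by blast
  qed
  with M(1) show ?thesis
    by blast
qed

section \<open>Homomorphisms of algebraic extensions of the rationals\<close>

definition rat_poly :: "rat poly \<Rightarrow> 'a::field_char_0 \<Rightarrow> 'a" where
  "rat_poly p x = poly (map_poly of_rat p) x"

interpretation rat_map_hom: map_poly_inj_comm_ring_hom "of_rat :: rat \<Rightarrow> 'a::field_char_0" ..

lemma rat_map_eq_0_iff: "map_poly of_rat p = (0 :: 'a::field_char_0 poly) \<longleftrightarrow> p = 0"
  by (simp add: poly_eq_iff coeff_map_poly)

lemma rat_poly_simps [simp]:
  "rat_poly 0 x = 0" "rat_poly 1 x = 1" "rat_poly (pCons a p) x = of_rat a + x * rat_poly p x"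
  "rat_poly (p + q) x = rat_poly p x + rat_poly q x" "rat_poly (p * q) x
      = rat_poly p x * rat_poly q x"
  "rat_poly (p - q) x = rat_poly p x - rat_poly q x" "rat_poly (smult c p) x
      = of_rat c * rat_poly p x"
  "rat_poly (- p) x = - rat_poly p x"
  by (simp_all add: rat_poly_def of_rat_hom.map_poly_hom_add of_rat_hom.map_poly_pCons_hom
      of_rat_hom.map_poly_hom_smult rat_map_hom.hom_mult rat_map_hom.hom_minus
          rat_map_hom.hom_uminus)

definition alg_over_rat :: "'a::field_char_0 \<Rightarrow> bool" where
  "alg_over_rat x \<longleftrightarrow> (\<exists>p. p \<noteq> 0 \<and> rat_poly p x = 0)"

lemma comm_ring_hom_of_rat:
  assumes "comm_ring_hom (h :: 'a::field_char_0 \<Rightarrow> 'b::field_char_0)"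
  shows "h (of_rat q) = of_rat q"
proof -
  interpret comm_ring_hom h by fact
  obtain a b where ab: "quotient_of q = (a, b)"
    by (cases "quotient_of q")
  then have b: "b \<noteq> 0" and q: "q = of_int a / of_int b"
    using quotient_of_denom_pos[OF ab] quotient_of_div[OF ab] by auto
  have "h (of_rat q) * of_int b = h (of_rat q * of_int b)"
    by (simp add: hom_mult hom_of_int)
  also have "of_rat q * of_int b = (of_int a :: 'a)"
    using b by (simp add: q of_rat_divide)
  also have "h (of_int a) = of_int a"
    by (rule hom_of_int)
  finally show ?thesis
    using b by (simp add: q of_rat_divide field_simps)
qed

lemma comm_ring_hom_rat_poly:
  assumes "comm_ring_hom (h :: 'a::field_char_0 \<Rightarrow> 'b::field_char_0)"
  shows "h (rat_poly p x) = rat_poly p (h x)"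
proof -
  interpret comm_ring_hom h by fact
  show ?thesis
    by (induction p) (simp_all add: hom_add hom_mult comm_ring_hom_of_rat[OF assms])
qed

lemma comm_ring_hom_eq_0_iff:
  assumes "comm_ring_hom (h :: 'a::field \<Rightarrow> 'b::field)"
  shows "h x = 0 \<longleftrightarrow> x = 0"
proof -
  interpret comm_ring_hom h by fact
  have "h x * h (inverse x) = 1" if "x \<noteq> 0"
    using that by (metis hom_mult hom_one right_inverse)
  then show ?thesis
    by (metis hom_zero mult_zero_left zero_neq_one)
qed

text \<open>Factors \<open>x\<close> are cancelled from the relation until its constant term is
  nonzero, and then it can be solved for the inverse. Graphs of homomorphisms are closed under ring
  operations only; for algebraic elements this supplies the inverses.\<close>

lemma alg_over_rat_inverse:
  fixes x :: "'a::field_char_0"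
  assumes "p \<noteq> 0" "rat_poly p x = 0" "x \<noteq> 0"
  shows "\<exists>q. rat_poly q x = inverse x"
  using assms
proof (induction p)
  case (pCons c p)
  show ?case
  proof (cases "c = 0")
    case True
    then show ?thesis
      using pCons by auto
  next
    case False
    have "of_rat c = - (x * rat_poly p x)"
      using pCons(4) by (simp add: eq_neg_iff_add_eq_0)
    then have "x * rat_poly (smult (- (1 / c)) p) x = of_rat c * of_rat (1 / c)"
      by simp
    also have "\<dots> = 1"
      using False by (simp add: of_rat_divide)
    finally have "rat_poly (smult (- (1 / c)) p) x = inverse x"
      by (metis inverse_unique)
    then show ?thesis
      by blast
  qed
qed simp

text \<open>Graphs of homomorphisms from \<open>\<rat>\<close>-subalgebras; all such algebras below are fields.\<close>

definition hom_graph :: "('a::field_char_0 \<times> 'b::field_char_0) set \<Rightarrow> bool" where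
  "hom_graph G \<longleftrightarrow> (\<forall>q. (of_rat q, of_rat q) \<in> G) \<and>
     (\<forall>a b c d. (a, b) \<in> G \<longrightarrow> (c, d) \<in> G \<longrightarrow> (a + c, b + d) \<in> G \<and> (a * c, b * d) \<in> G) \<and>
     (\<forall>b. (0, b) \<in> G \<longrightarrow> b = 0)"

lemma hom_graphD:
  assumes "hom_graph G"
  shows "(of_rat q, of_rat q) \<in> G" "(0, 0) \<in> G" "(1, 1) \<in> G"
    "(a, b) \<in> G \<Longrightarrow> (c, d) \<in> G \<Longrightarrow> (a + c, b + d) \<in> G"
    "(a, b) \<in> G \<Longrightarrow> (c, d) \<in> G \<Longrightarrow> (a * c, b * d) \<in> G"
    "(a, b) \<in> G \<Longrightarrow> (c, d) \<in> G \<Longrightarrow> (a - c, b - d) \<in> G"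
    "(a, b) \<in> G \<Longrightarrow> (a, d) \<in> G \<Longrightarrow> b = d"
    "(a, b) \<in> G \<Longrightarrow> (rat_poly f a, rat_poly f b) \<in> G"
proof -
  have rat: "(of_rat q, of_rat q) \<in> G" for q
    using assms unfolding hom_graph_def by blast
  have add: "(a + c, b + d) \<in> G" if "(a, b) \<in> G" "(c, d) \<in> G" for a b c d
    using assms that unfolding hom_graph_def by blast
  have mult: "(a * c, b * d) \<in> G" if "(a, b) \<in> G" "(c, d) \<in> G" for a b c d
    using assms that unfolding hom_graph_def by blast
  have diff: "(a - c, b - d) \<in> G" if "(a, b) \<in> G" "(c, d) \<in> G" for a b c d
  proof -
    have "(- c, - d) \<in> G"
      using mult[OF rat[of "- 1"] that(2)] by (simp add: of_rat_minus)
    then show ?thesis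
      using add[OF that(1), of "- c" "- d"] by simp
  qed
  have zero: "(0, 0) \<in> G" "(1, 1) \<in> G"
    using rat[of 0] rat[of 1] by simp_all
  show "(a, b) \<in> G \<Longrightarrow> (rat_poly f a, rat_poly f b) \<in> G"
    by (induction f) (auto simp: zero intro!: add mult rat)
  show "(a, b) \<in> G \<Longrightarrow> (a, d) \<in> G \<Longrightarrow> b = d"
    using diff[of a b a d] assms unfolding hom_graph_def by auto
  show "(of_rat q, of_rat q) \<in> G" "(0, 0) \<in> G" "(1, 1) \<in> G"
    "(a, b) \<in> G \<Longrightarrow> (c, d) \<in> G \<Longrightarrow> (a + c, b + d) \<in> G"
    "(a, b) \<in> G \<Longrightarrow> (c, d) \<in> G \<Longrightarrow> (a * c, b * d) \<in> G"
    "(a, b) \<in> G \<Longrightarrow> (c, d) \<in> G \<Longrightarrow> (a - c, b - d) \<in> G"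
    by (intro rat zero add mult diff; assumption)+
qed

lemma hom_graph_sum:
  assumes "hom_graph G" "\<And>i. i \<in> A \<Longrightarrow> (f i, g i) \<in> G"
  shows "((\<Sum>i\<in>A. f i), (\<Sum>i\<in>A. g i)) \<in> G"
  using assms(2) by (induction A rule: infinite_finite_induct) (auto intro: hom_graphD[OF assms(1)])

text \<open>The value of \<theta> is a root of the image of its minimal polynomial over the domain
  of \<open>G\<close>. Such a root exists because the target is algebraically closed, and minimality
  makes every relation of \<theta> hold for its value.\<close>

lemma hom_graph_extend:
  fixes G :: "('a::field_char_0 \<times> 'b::{alg_closed_field, field_char_0}) set"
  assumes G: "hom_graph G" and alg: "\<And>x :: 'a. alg_over_rat x"
  shows "\<exists>G1. hom_graph G1 \<and> G \<subseteq> G1 \<and> (\<exists>b. (\<theta>, b) \<in> G1)"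
proof -
  note D = hom_graphD[OF G]
  \<comment> \<open>Pairs of polynomials whose coefficients correspond under \<open>G\<close>; the
    second is the image of the first under the coefficientwise homomorphism.\<close>
  define PL where "PL = {(f, g). \<forall>i. (coeff f i, coeff g i) \<in> G}"
  have PL: "(f, g) \<in> PL \<longleftrightarrow> (\<forall>i. (coeff f i, coeff g i) \<in> G)" for f g
    by (simp add: PL_def)
  have PL_mult: "(f * f1, g * g1) \<in> PL" if "(f, g) \<in> PL" "(f1, g1) \<in> PL" for f g f1 g1
    using that unfolding PL coeff_mult by (auto intro!: hom_graph_sum[OF G] D)
  have PL_add: "(f + f1, g + g1) \<in> PL" and PL_diff: "(f - f1, g - g1) \<in> PL"
    if "(f, g) \<in> PL" "(f1, g1) \<in> PL" for f g f1 g1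
    using that unfolding PL by (auto intro!: D)
  have PL_monom: "(monom a i, monom b i) \<in> PL" if "(a, b) \<in> G" for a b i
    using that unfolding PL by (auto intro!: D)
  have PL_deg: "degree g \<le> degree f" if "(f, g) \<in> PL" for f g
  proof (rule degree_le, intro allI impI)
    fix i assume "i > degree f"
    then have "(0, coeff g i) \<in> G"
      using that unfolding PL by (metis coeff_eq_0)
    then show "coeff g i = 0"
      using D(2,7) by blast
  qed
  define Q where "Q n \<longleftrightarrow> (\<exists>f g. (f, g) \<in> PL \<and> f \<noteq> 0 \<and> poly f \<theta> = 0 \<and> degree f = n)" for n
  have "\<exists>n. Q n"
  proof -
    obtain p where p: "p \<noteq> 0" "rat_poly p \<theta> = 0"
      using alg unfolding alg_over_rat_def by blast
    have "(map_poly of_rat p, map_poly of_rat p) \<in> PL"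
      unfolding PL by (auto intro: D simp: coeff_map_poly)
    moreover have "map_poly of_rat p \<noteq> (0 :: 'a poly)"
      using p(1) by (metis rat_map_eq_0_iff)
    ultimately show ?thesis
      using p(2) unfolding Q_def rat_poly_def by blast
  qed
  define n where "n = (LEAST n. Q n)"
  have "Q n" and least: "\<And>m. Q m \<Longrightarrow> n \<le> m"
    unfolding n_def using \<open>\<exists>n. Q n\<close> by (auto intro: LeastI_ex Least_le)
  then obtain f1 g1 where fg1: "(f1, g1) \<in> PL" "f1 \<noteq> 0" "poly f1 \<theta> = 0" "degree f1 = n"
    unfolding Q_def by blast
  define a where "a = lead_coeff f1"
  have ab: "(a, coeff g1 n) \<in> G" and a0: "a \<noteq> 0"
    using fg1 by (auto simp: a_def PL)
  obtain q where q: "rat_poly q a = inverse a"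
    using alg_over_rat_inverse alg a0 unfolding alg_over_rat_def by metis
  define b where "b = rat_poly q (coeff g1 n)"
  have b: "(inverse a, b) \<in> G"
    using D(8)[OF ab, of q] q by (simp add: b_def)
  define f0 where "f0 = monom (inverse a) 0 * f1"
  define g0 where "g0 = monom b 0 * g1"
  have fg0: "(f0, g0) \<in> PL"
    unfolding f0_def g0_def using PL_mult PL_monom[OF b] fg1(1) by blast
  have f0: "degree f0 = n" "coeff f0 n = 1" "poly f0 \<theta> = 0"
    using fg1 a0 by (auto simp: f0_def monom_0 a_def)
  have "(1, coeff g0 n) \<in> G"
    using fg0 f0(2) unfolding PL by metis
  then have g0_lc: "coeff g0 n = 1"
    using D(3,7) by blast
  then have g0: "degree g0 = n"
    using PL_deg[OF fg0] f0(1) by (metis le_antisym le_degree zero_neq_one)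
  have "n > 0"
  proof (rule ccontr)
    assume "\<not> n > 0"
    then have "f0 = 1"
      using f0 by (metis degree_eq_zeroE coeff_pCons_0 gr0I one_pCons)
    then show False
      using f0(3) by simp
  qed
  then obtain \<theta>1 where \<theta>1: "poly g0 \<theta>1 = 0"
    using alg_closed_imp_poly_has_root[of g0] g0 by auto
  \<comment> \<open>Division by \<open>f0\<close> is carried out on both components at once. By
    minimality of \<open>n\<close> it ends at the zero polynomial, and \<open>G\<close> relates zero
    only to zero.\<close>
  have key: "poly g \<theta>1 = 0" if "(f, g) \<in> PL" "poly f \<theta> = 0" for f g
    using that
  proof (induction "degree f" arbitrary: f g rule: less_induct)
    case less
    show ?case
    proof (cases "f = 0")
      case True
      then have "(0, coeff g i) \<in> G" for i
        using less(2) unfolding PL by (metis coeff_0)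
      then have "g = 0"
        using D(2,7) by (intro poly_eqI) (metis coeff_0)
      then show ?thesis
        by simp
    next
      case False
      then have "Q (degree f)"
        using less unfolding Q_def by blast
      then have le: "n \<le> degree f"
        by (rule least)
      define k where "k = degree f - n"
      define f2 where "f2 = f - monom (lead_coeff f) k * f0"
      define g2 where "g2 = g - monom (coeff g (degree f)) k * g0"
      have "(lead_coeff f, coeff g (degree f)) \<in> G"
        using less(2) unfolding PL by blast
      then have 1: "(f2, g2) \<in> PL"
        unfolding f2_def g2_def using PL_diff PL_mult PL_monom fg0 less(2) by blast
      have 2: "poly f2 \<theta> = 0"
        unfolding f2_def using less(3) f0(3) by simp
      have "degree f2 < degree f"
      proof (rule degree_less_of_coeff_0)
        have "degree (monom (lead_coeff f) k * f0) \<le> k + n"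
          using degree_mult_le[of "monom (lead_coeff f) k" f0] degree_monom_le[of "lead_coeff f" k]
              f0(1)
          by linarith
        then show "degree f2 \<le> degree f"
          unfolding f2_def using le by (intro degree_diff_le) (auto simp: k_def)
        show "coeff f2 (degree f) = 0"
          using le f0 by (simp add: f2_def coeff_monom_mult k_def)
        show "degree f > 0"
          using le \<open>n > 0\<close> by simp
      qed
      then have "poly g2 \<theta>1 = 0"
        using less(1) 1 2 by blast
      then show ?thesis
        using \<theta>1 by (simp add: g2_def)
    qed
  qed
  define G1 where "G1 = {(poly f \<theta>, poly g \<theta>1) | f g. (f, g) \<in> PL}"
  have sub: "G \<subseteq> G1"
  proof
    fix ab assume "ab \<in> G"
    then obtain a b where "ab = (a, b)" "(a, b) \<in> G"
      by (cases ab) auto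
    then show "ab \<in> G1"
      using PL_monom[of a b 0] unfolding G1_def by (force simp: monom_0)
  qed
  have "(monom 1 1, monom 1 1) \<in> PL"
    using PL_monom[OF D(3)] .
  then have "(\<theta>, \<theta>1) \<in> G1"
    unfolding G1_def by (force simp: poly_monom)
  moreover have "hom_graph G1"
    unfolding hom_graph_def
  proof (intro conjI allI impI)
    show "(of_rat q, of_rat q) \<in> G1" for q
      using sub D(1) by blast
    show "b = 0" if "(0, b) \<in> G1" for b
      using that key unfolding G1_def by force
    fix a b c d assume "(a, b) \<in> G1" "(c, d) \<in> G1"
    then obtain f g f' g' where "a = poly f \<theta>" "b = poly g \<theta>1" "(f, g) \<in> PL"
      "c = poly f' \<theta>" "d = poly g' \<theta>1" "(f', g') \<in> PL"
      unfolding G1_def by auto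
    then show "(a + c, b + d) \<in> G1" "(a * c, b * d) \<in> G1"
      unfolding G1_def using PL_add[of f g f' g'] PL_mult[of f g f' g']
        by (auto simp flip: poly_add poly_mult)
  qed
  ultimately show ?thesis
    using sub by blast
qed

text \<open>Zorn's lemma gives a maximal graph; its domain is everything because it could otherwise
  be extended by one element. Uniqueness of values turns it into a function.\<close>

theorem hom_graph_extends_to_hom:
  fixes G :: "('a::field_char_0 \<times> 'b::{alg_closed_field, field_char_0}) set"
  assumes G: "hom_graph G" and alg: "\<And>x :: 'a. alg_over_rat x"
  shows "\<exists>\<tau>. comm_ring_hom \<tau> \<and> (\<forall>a b. (a, b) \<in> G \<longrightarrow> \<tau> a = b)"
proof -
  define \<A> where "\<A> = {H. hom_graph H \<and> G \<subseteq> H}"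
  have "\<exists>M\<in>\<A>. \<forall>H\<in>\<A>. M \<subseteq> H \<longrightarrow> H = M"
  proof (rule subset_Zorn_nonempty)
    show "\<A> \<noteq> {}"
      using G by (auto simp: \<A>_def)
    fix \<C> assume C: "\<C> \<noteq> {}" "subset.chain \<A> \<C>"
    then have CA: "H \<in> \<A>" if "H \<in> \<C>" for H
      using that unfolding subset.chain_def by blast
    have lin: "H \<subseteq> K \<or> K \<subseteq> H" if "H \<in> \<C>" "K \<in> \<C>" for H K
      using C(2) that unfolding subset.chain_def by blast
    have "hom_graph (\<Union> \<C>)"
      unfolding hom_graph_def
    proof (intro conjI allI impI)
      show "(of_rat q, of_rat q) \<in> \<Union> \<C>" for q
      proof -
        obtain H where "H \<in> \<C>"
          using C(1) by blast
        then show ?thesis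
          using CA[of H] hom_graphD(1)[of H q] by (auto simp: \<A>_def)
      qed
      show "b = 0" if "(0, b) \<in> \<Union> \<C>" for b
        using that CA by (auto simp: \<A>_def hom_graph_def)
      fix a b c d assume "(a, b) \<in> \<Union> \<C>" "(c, d) \<in> \<Union> \<C>"
      then obtain H where "H \<in> \<C>" "(a, b) \<in> H" "(c, d) \<in> H"
        using lin by blast
      then show "(a + c, b + d) \<in> \<Union> \<C>" "(a * c, b * d) \<in> \<Union> \<C>"
        using hom_graphD(4,5)[of H] CA[of H] by (auto simp: \<A>_def intro!: bexI[of _ H])
    qed
    then show "\<Union> \<C> \<in> \<A>"
      using C(1) CA by (auto simp: \<A>_def)
  qed
  then obtain M where M: "hom_graph M" "G \<subseteq> M" "\<And>H. hom_graph H \<Longrightarrow> M \<subseteq> H \<Longrightarrow> H = M"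
    unfolding \<A>_def by auto
  have "\<exists>b. (x, b) \<in> M" for x
    using hom_graph_extend[OF M(1) alg, of x] M(3) by metis
  then obtain \<tau> where \<tau>: "\<And>x. (x, \<tau> x) \<in> M"
    by metis
  have uniq: "\<tau> x = b" if "(x, b) \<in> M" for x b
    using hom_graphD(7)[OF M(1) \<tau> that] .
  have "comm_ring_hom \<tau>"
    by unfold_locales (auto intro!: uniq hom_graphD[OF M(1)] \<tau>)
  then show ?thesis
    using uniq M(2) by blast
qed

text \<open>Every root \<open>x\<close> of the minimal polynomial of \<open>y\<close> is the image
  of \<open>y\<close> under some endomorphism, namely an extension of \<open>f(y) -> f(x)\<close>.
  If all endomorphisms fix \<open>y\<close>, the minimal polynomial is a power of one linear
  polynomial, and its second coefficient \<open>- n * y\<close> is rational.\<close>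

lemma alg_over_rat_not_rational:
  fixes y :: "'a::{alg_closed_field, field_char_0}"
  assumes alg: "\<And>x :: 'a. alg_over_rat x"
    and fixed: "\<And>\<tau> :: 'a \<Rightarrow> 'a. comm_ring_hom \<tau> \<Longrightarrow> \<tau> y = y"
  shows "\<exists>q. y = of_rat q"
proof -
  define Q where "Q n \<longleftrightarrow> (\<exists>p. p \<noteq> 0 \<and> rat_poly p y = 0 \<and> degree p = n)" for n
  have "\<exists>n. Q n"
    using alg[of y] unfolding alg_over_rat_def Q_def by blast
  define n where "n = (LEAST n. Q n)"
  have "Q n" and least: "\<And>m. Q m \<Longrightarrow> n \<le> m"
    unfolding n_def using \<open>\<exists>n. Q n\<close> by (auto intro: LeastI_ex Least_le)
  then obtain p1 where p1: "p1 \<noteq> 0" "rat_poly p1 y = 0" "degree p1 = n"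
    unfolding Q_def by blast
  define p where "p = smult (inverse (lead_coeff p1)) p1"
  have p: "lead_coeff p = 1" "rat_poly p y = 0" "degree p = n"
    using p1 by (auto simp: p_def)
  define P where "P = (map_poly of_rat p :: 'a poly)"
  have P: "degree P = n" "lead_coeff P = 1"
    using p by (auto simp: P_def coeff_map_poly degree_map_poly)
  have "x = y" if x: "poly P x = 0" for x
  proof -
    define G where "G = {(rat_poly f y, rat_poly f x) | f. True}"
    have "hom_graph G"
      unfolding hom_graph_def
    proof (intro conjI allI impI)
      show "(of_rat q, of_rat q) \<in> G" for q
        unfolding G_def by (auto intro!: exI[of _ "[:q:]"])
      show "b = 0" if "(0, b) \<in> G" for b
      proof -
        obtain f where f: "rat_poly f y = 0" "b = rat_poly f x"
          using \<open>(0, b) \<in> G\<close> unfolding G_def by auto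
        have eq: "f = p * (f div p) + f mod p"
          by simp
        have "rat_poly f y = rat_poly p y * rat_poly (f div p) y + rat_poly (f mod p) y"
          by (subst eq) (simp only: rat_poly_simps)
        then have "rat_poly (f mod p) y = 0"
          using f(1) p(2) by simp
        moreover have "f mod p = 0 \<or> degree (f mod p) < n"
          using p degree_mod_less[of p f] by (metis leading_coeff_0_iff zero_neq_one)
        ultimately have "f mod p = 0"
          using least[of "degree (f mod p)"] unfolding Q_def by fastforce
        then have "rat_poly f x = rat_poly p x * rat_poly (f div p) x"
          by (subst eq) (simp only: rat_poly_simps, simp)
        then show ?thesis
          using x f(2) by (simp add: P_def rat_poly_def)
      qed
      fix a b c d assume "(a, b) \<in> G" "(c, d) \<in> G"
      then obtain f g where "a = rat_poly f y" "b = rat_poly f x" "c = rat_poly g y" "d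
          = rat_poly g x"
        unfolding G_def by auto
      then show "(a + c, b + d) \<in> G" "(a * c, b * d) \<in> G"
        unfolding G_def by (auto intro: exI[of _ "f + g"] exI[of _ "f * g"])
    qed
    then obtain \<tau> :: "'a \<Rightarrow> 'a" where \<tau>: "comm_ring_hom \<tau>" "\<And>a b. (a, b) \<in> G \<Longrightarrow> \<tau> a = b"
      using hom_graph_extends_to_hom alg by blast
    have "(rat_poly [:0, 1:] y, rat_poly [:0, 1:] x) \<in> G"
      unfolding G_def by blast
    then have "(y, x) \<in> G"
      by simp
    then have "\<tau> y = x"
      by (rule \<tau>(2))
    then show "x = y"
      using fixed[OF \<tau>(1)] by simp
  qed
  then have "P = [:-y, 1:] ^ degree P"
    by (rule monic_single_root[OF P(2)])
  then have pw: "P = [:-y, 1:] ^ n"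
    unfolding P(1) .
  have "n > 0"
  proof (rule ccontr)
    assume "\<not> n > 0"
    then have "p = 1"
      using p by (metis degree_eq_zeroE coeff_pCons_0 gr0I one_pCons)
    then show False
      using p(2) by simp
  qed
  then have "n choose (n - 1) = n"
    by (subst binomial_symmetric) auto
  then have "coeff P (n - 1) = - (of_nat n * y)"
    using \<open>n > 0\<close> unfolding pw by (subst coeff_linear_poly_power) auto
  then have "y = of_rat (- (coeff p (n - 1) / of_nat n))"
    using \<open>n > 0\<close> by (simp add: P_def coeff_map_poly of_rat_minus of_rat_divide field_simps)
  then show ?thesis
    by blast
qed

section \<open>Embeddings and norms of a number field\<close>

lemma vector_space_of_rat: "vector_space (\<lambda>(q::rat) (x::'a::field_char_0). of_rat q * x)"
  by unfold_locales (simp_all add: algebra_simps of_rat_add of_rat_mult)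

lemma number_field_span:
  assumes "number_field TYPE('k::field_char_0)"
  obtains B :: "'k::field_char_0 set" where "finite B" "module.span (\<lambda>(q::rat) x. of_rat q * x) B
      = UNIV"
proof -
  obtain B where "finite_dimensional_vector_space (\<lambda>(q::rat) (x::'k). of_rat q * x) B"
    using assms unfolding number_field_def by blast
  then interpret finite_dimensional_vector_space "\<lambda>(q::rat) (x::'k). of_rat q * x" B .
  show thesis
    using that finite_Basis span_Basis by blast
qed

text \<open>Let \<open>r\<close> be the degree of a monic equation of \<open>y\<close> over
  \<open>k\<close>. The finitely many products \<open>b * y^i\<close>, with \<open>b\<close> from a
  spanning set of \<open>k\<close> and \<open>i < r\<close>, span a rational space that contains
  every power of \<open>y\<close>, so these powers are linearly dependent.\<close>

theorem number_field_alg_closure_algebraic: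
  fixes y :: "'k::field_char_0 alg_closure"
  assumes "number_field TYPE('k)"
  shows "alg_over_rat y"
proof -
  interpret k: vector_space "\<lambda>(q::rat) (x::'k). of_rat q * x"
    by (rule vector_space_of_rat)
  interpret V: vector_space "\<lambda>(q::rat) (x::'k alg_closure). of_rat q * x"
    by (rule vector_space_of_rat)
  obtain B :: "'k set" where B: "finite B" "k.span B = UNIV"
    using number_field_span[OF assms] by blast
  obtain p1 where p1: "p1 \<noteq> 0" "poly (map_poly to_ac p1) y = 0"
    by (rule alg_closure_algebraic)
  define p where "p = smult (inverse (lead_coeff p1)) p1"
  define r where "r = degree p"
  have "map_poly to_ac p = smult (to_ac (inverse (lead_coeff p1))) (map_poly to_ac p1)"
    by (rule poly_eqI) (simp add: p_def coeff_map_poly)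
  then have p: "coeff p r = 1" "poly (map_poly to_ac p) y = 0"
    using p1 by (auto simp: p_def r_def)
  have "r > 0"
  proof (rule ccontr)
    assume "\<not> r > 0"
    then have "p = 1"
      using p unfolding r_def by (metis degree_eq_zeroE coeff_pCons_0 gr0I one_pCons)
    then show False
      using p(2) by simp
  qed
  have deg: "degree (map_poly to_ac p) = r"
    by (simp add: r_def degree_map_poly)
  have yr: "y ^ r = - (\<Sum>i<r. to_ac (coeff p i) * y ^ i)"
  proof -
    have "0 = (\<Sum>i\<le>r. to_ac (coeff p i) * y ^ i)"
      using p(2) unfolding poly_altdef deg by (simp add: coeff_map_poly)
    also have "\<dots> = (\<Sum>i<r. to_ac (coeff p i) * y ^ i) + y ^ r"
      using p(1) by (simp add: lessThan_Suc_atMost[symmetric])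
    finally show ?thesis
      by (simp add: eq_neg_iff_add_eq_0 add.commute)
  qed
  define S where "S = (\<lambda>(b, i). to_ac b * y ^ i) ` (B \<times> {..<r})"
  have "finite S"
    using B(1) by (simp add: S_def)
  have to_ac_rat: "to_ac (of_rat q) = of_rat q" for q
    by (rule comm_ring_hom_of_rat) (unfold_locales; simp)
  have base: "to_ac x * y ^ i \<in> V.span S" if "i < r" for x i
  proof -
    have "x \<in> k.span B"
      using B(2) by blast
    then show ?thesis
    proof (induction rule: k.span_induct_alt)
      case base
      show ?case
        by (simp add: V.span_zero)
    next
      case (step c b x)
      have "to_ac b * y ^ i \<in> S"
        using step(1) that by (auto simp: S_def)
      then have "of_rat c * (to_ac b * y ^ i) + to_ac x * y ^ i \<in> V.span S"
        by (rule V.span_add[OF V.span_scale[OF V.span_base] step(2)])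
      then show ?case
        by (simp add: to_ac_rat algebra_simps)
    qed
  qed
  have mult: "y * v \<in> V.span S" if "v \<in> V.span S" for v
    using that
  proof (induction rule: V.span_induct_alt)
    case base
    show ?case
      by (simp add: V.span_zero)
  next
    case (step c s v)
    obtain b i where bi: "s = to_ac b * y ^ i" "b \<in> B" "i < r"
      using step(1) by (auto simp: S_def)
    have "y * s \<in> V.span S"
    proof (cases "Suc i < r")
      case True
      then show ?thesis
        using base[of "Suc i" b] bi(1) by (simp add: mult_ac)
    next
      case False
      then have "Suc i = r"
        using bi(3) by simp
      then have "y * s = to_ac b * y ^ r"
        using bi(1) by (auto simp: mult_ac)
      also have "\<dots> = - (\<Sum>i<r. to_ac (b * coeff p i) * y ^ i)"
        unfolding yr by (simp add: sum_distrib_left mult_ac)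
      also have "\<dots> \<in> V.span S"
        by (intro V.span_neg V.span_sum base) auto
      finally show ?thesis .
    qed
    then have "of_rat c * (y * s) + y * v \<in> V.span S"
      using step(2) by (intro V.span_add V.span_scale)
    then show ?case
      by (simp add: algebra_simps)
  qed
  have pows: "y ^ n \<in> V.span S" for n
  proof (induction n)
    case 0
    show ?case
      using base[of 0 1] \<open>r > 0\<close> by simp
  qed (use mult in simp)
  define N where "N = card S"
  show ?thesis
  \<comment> \<open>Dependence is a notion for sets of vectors, so the case of two equal powers,
    which is a relation by itself, is separated.\<close>
  proof (cases "inj_on (\<lambda>i. y ^ i) {..N}")
    case False
    then obtain i j where ij: "i \<noteq> j" "y ^ i = y ^ j"
      by (auto simp: inj_on_def)
    have "rat_poly (monom 1 i) y = y ^ i" for i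
      by (simp add: rat_poly_def poly_monom)
    then have "rat_poly (monom 1 i - monom 1 j) y = 0"
      using ij(2) by simp
    moreover have "monom 1 i - monom (1::rat) j \<noteq> 0"
      using ij(1) by (simp add: monom_eq_iff')
    ultimately show ?thesis
      unfolding alg_over_rat_def by blast
  next
    case True
    define T where "T = (\<lambda>i. y ^ i) ` {..N}"
    have "card T = Suc N"
      unfolding T_def using True by (simp add: card_image)
    then have "V.dependent T"
      using V.independent_span_bound[OF \<open>finite S\<close>, of T] pows
      unfolding N_def T_def by (metis Suc_n_not_le_n image_subsetI)
    then obtain u where u: "\<exists>v\<in>T. u v \<noteq> 0" "(\<Sum>v\<in>T. of_rat (u v) * v) = 0"
      using V.dependent_finite[of T] by (auto simp: T_def)
    define f where "f = (\<Sum>i\<le>N. monom (u (y ^ i)) i)"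
    have "rat_poly (\<Sum>i\<in>A. g i) y = (\<Sum>i\<in>A. rat_poly (g i) y)" for g :: "nat \<Rightarrow> rat poly" and A
      by (induction A rule: infinite_finite_induct) simp_all
    moreover have "rat_poly (monom c i) y = of_rat c * y ^ i" for c i
      by (simp add: rat_poly_def poly_monom)
    ultimately have "rat_poly f y = (\<Sum>i\<le>N. of_rat (u (y ^ i)) * y ^ i)"
      by (simp add: f_def)
    also have "\<dots> = 0"
      using u(2) True unfolding T_def by (simp add: sum.reindex)
    finally have "rat_poly f y = 0" .
    moreover have "f \<noteq> 0"
    proof -
      obtain i where i: "i \<le> N" "u (y ^ i) \<noteq> 0"
        using u(1) unfolding T_def by auto
      then have "coeff f i \<noteq> 0"
        by (simp add: f_def coeff_sum)
      then show ?thesis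
        by auto
    qed
    ultimately show ?thesis
      unfolding alg_over_rat_def by blast
  qed
qed

text \<open>An embedding is determined by its values on a finite spanning set, and each value is a
  root of a fixed rational polynomial.\<close>

lemma finite_number_field_homs:
  assumes "number_field TYPE('k::field_char_0)"
  shows "finite {\<sigma> :: 'k::field_char_0 \<Rightarrow> 'k alg_closure. comm_ring_hom \<sigma>}" (is "finite ?E")
proof -
  interpret k: vector_space "\<lambda>(q::rat) (x::'k). of_rat q * x"
    by (rule vector_space_of_rat)
  obtain B :: "'k set" where B: "finite B" "k.span B = UNIV"
    using number_field_span[OF assms] by blast
  have "\<exists>p. p \<noteq> 0 \<and> rat_poly p b = 0" for b :: 'k
  proof -
    obtain p where p: "p \<noteq> 0" "rat_poly p (to_ac b) = 0"
      using number_field_alg_closure_algebraic[OF assms] unfolding alg_over_rat_def by blast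
    have "comm_ring_hom (to_ac :: 'k \<Rightarrow> _)"
      by (unfold_locales; simp)
    then have "to_ac (rat_poly p b) = 0"
      using p(2) by (simp add: comm_ring_hom_rat_poly)
    then show ?thesis
      using p(1) by auto
  qed
  then obtain p where p: "\<And>b :: 'k. p b \<noteq> 0" "\<And>b :: 'k. rat_poly (p b) b = 0"
    by metis
  define R where "R b = {z :: 'k alg_closure. rat_poly (p b) z = 0}" for b :: 'k
  have "finite (R b)" for b
    unfolding R_def rat_poly_def using p(1)[of b]
      by (intro poly_roots_finite) (metis rat_map_eq_0_iff)
  then have fin: "finite (PiE B R)"
    using B(1) by (intro finite_PiE) auto
  have "(\<lambda>\<sigma>. restrict \<sigma> B) ` ?E \<subseteq> PiE B R"
    using p(2) by (auto simp: R_def simp flip: comm_ring_hom_rat_poly dest: comm_ring_hom_eq_0_iff)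
  moreover have "inj_on (\<lambda>\<sigma>. restrict \<sigma> B) ?E"
  proof (rule inj_onI, rule ext)
    fix \<sigma> \<tau> :: "'k \<Rightarrow> 'k alg_closure" and x
    assume E: "\<sigma> \<in> ?E" "\<tau> \<in> ?E" and eq: "restrict \<sigma> B = restrict \<tau> B"
    interpret \<sigma>: comm_ring_hom \<sigma> using E by simp
    interpret \<tau>: comm_ring_hom \<tau> using E by simp
    have "x \<in> k.span B"
      using B(2) by blast
    then show "\<sigma> x = \<tau> x"
    proof (induction rule: k.span_induct_alt)
      case (step c b x)
      have "\<sigma> b = \<tau> b"
        using eq step(1) by (metis restrict_apply')
      then show ?case
        using step E by (simp add: \<sigma>.hom_add \<tau>.hom_add \<sigma>.hom_mult \<tau>.hom_mult comm_ring_hom_of_rat)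
    qed simp
  qed
  ultimately show ?thesis
    using fin by (meson finite_imageD finite_subset)
qed

text \<open>Composition with an endomorphism of the closure permutes the embeddings, so the norm is
  fixed by all endomorphisms and hence rational.\<close>

theorem norm_rational:
  fixes x :: "'k::field_char_0"
  assumes "number_field TYPE('k)"
  shows "\<exists>q. (\<Prod>\<sigma> | comm_ring_hom \<sigma>. \<sigma> x) = (of_rat q :: 'k alg_closure)"
proof (rule alg_over_rat_not_rational)
  show "alg_over_rat z" for z :: "'k alg_closure"
    by (rule number_field_alg_closure_algebraic[OF assms])
  fix \<tau> :: "'k alg_closure \<Rightarrow> 'k alg_closure" assume \<tau>: "comm_ring_hom \<tau>"
  interpret \<tau>: comm_ring_hom \<tau> by (rule \<tau>)
  let ?E = "{\<sigma> :: 'k \<Rightarrow> 'k alg_closure. comm_ring_hom \<sigma>}"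
  have inj\<tau>: "\<tau> a = \<tau> b \<Longrightarrow> a = b" for a b
    using comm_ring_hom_eq_0_iff[OF \<tau>, of "a - b"] by (simp add: \<tau>.hom_minus)
  have "(\<lambda>\<sigma>. \<tau> \<circ> \<sigma>) ` ?E \<subseteq> ?E"
  proof
    fix \<rho> assume "\<rho> \<in> (\<lambda>\<sigma>. \<tau> \<circ> \<sigma>) ` ?E"
    then obtain \<sigma> where "comm_ring_hom \<sigma>" and \<rho>: "\<rho> = \<tau> \<circ> \<sigma>"
      by auto
    then interpret \<sigma>: comm_ring_hom \<sigma> by simp
    show "\<rho> \<in> ?E"
      unfolding \<rho> mem_Collect_eq
      by unfold_locales (simp_all add: \<sigma>.hom_add \<tau>.hom_add \<sigma>.hom_mult \<tau>.hom_mult)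
  qed
  moreover have inj: "inj_on (\<lambda>\<sigma>. \<tau> \<circ> \<sigma>) ?E"
    by (rule inj_onI, rule ext) (metis comp_apply inj\<tau>)
  ultimately have "(\<lambda>\<sigma>. \<tau> \<circ> \<sigma>) ` ?E = ?E"
    by (intro endo_inj_surj finite_number_field_homs[OF assms])
  then have "(\<Prod>\<sigma>\<in>?E. \<sigma> x) = (\<Prod>\<sigma>\<in>(\<lambda>\<sigma>. \<tau> \<circ> \<sigma>) ` ?E. \<sigma> x)"
    by simp
  also have "\<dots> = (\<Prod>\<sigma>\<in>?E. \<tau> (\<sigma> x))"
    using inj by (simp add: prod.reindex)
  also have "\<dots> = \<tau> (\<Prod>\<sigma>\<in>?E. \<sigma> x)"
    by (simp add: \<tau>.hom_prod)
  finally show "\<tau> (\<Prod>\<sigma>\<in>?E. \<sigma> x) = (\<Prod>\<sigma>\<in>?E. \<sigma> x)"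
    by simp
qed

section \<open>Absolute values and the product formula\<close>

definition is_subring :: "'a::comm_ring_1 set \<Rightarrow> bool" where
  "is_subring V \<longleftrightarrow> 1 \<in> V \<and> (\<forall>a\<in>V. \<forall>b\<in>V. a + b \<in> V \<and> a * b \<in> V \<and> - a \<in> V)"

lemma is_subringD:
  assumes "is_subring V"
  shows "1 \<in> V" "0 \<in> V" "a \<in> V \<Longrightarrow> b \<in> V \<Longrightarrow> a + b \<in> V" "a \<in> V \<Longrightarrow> b \<in> V \<Longrightarrow> a * b \<in> V"
    "a \<in> V \<Longrightarrow> - a \<in> V" "a \<in> V \<Longrightarrow> b \<in> V \<Longrightarrow> a - b \<in> V" "a \<in> V \<Longrightarrow> a ^ n \<in> V"
    "of_nat n \<in> V" "of_int z \<in> V" "(\<And>i. i \<in> A \<Longrightarrow> f i \<in> V) \<Longrightarrow> (\<Sum>i\<in>A. f i) \<in> V"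
    "(\<And>i. i \<in> A \<Longrightarrow> f i \<in> V) \<Longrightarrow> (\<Prod>i\<in>A. f i) \<in> V"
proof -
  show one: "1 \<in> V" and add: "a \<in> V \<Longrightarrow> b \<in> V \<Longrightarrow> a + b \<in> V"
    and mult: "a \<in> V \<Longrightarrow> b \<in> V \<Longrightarrow> a * b \<in> V" and neg: "a \<in> V \<Longrightarrow> - a \<in> V" for a b
    using assms unfolding is_subring_def by blast+
  show zero: "0 \<in> V"
    using add[OF one neg[OF one]] by simp
  show "a \<in> V \<Longrightarrow> b \<in> V \<Longrightarrow> a - b \<in> V"
    using add[of a "- b"] neg by simp
  show "a \<in> V \<Longrightarrow> a ^ n \<in> V"
    by (induction n) (auto intro: one mult)
  show nat: "of_nat n \<in> V" for n
    by (induction n) (auto intro: one zero add)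
  show "of_int z \<in> V"
    by (cases z) (auto intro!: nat neg simp del: of_nat_Suc)
  show "(\<And>i. i \<in> A \<Longrightarrow> f i \<in> V) \<Longrightarrow> (\<Sum>i\<in>A. f i) \<in> V"
    by (induction A rule: infinite_finite_induct) (auto intro: zero add)
  show "(\<And>i. i \<in> A \<Longrightarrow> f i \<in> V) \<Longrightarrow> (\<Prod>i\<in>A. f i) \<in> V"
    by (induction A rule: infinite_finite_induct) (auto intro: one mult)
qed

section \<open>Chevalley's construction of p-adic absolute values\<close>

lemma maximal_subring_avoiding:
  fixes c :: "'a::comm_ring_1"
  assumes "c \<notin> \<int>"
  shows "\<exists>V. is_subring V \<and> c \<notin> V \<and> (\<forall>W. is_subring W \<longrightarrow> V \<subseteq> W \<longrightarrow> c \<notin> W \<longrightarrow> W = V)"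
proof -
  define \<A> where "\<A> = {V. is_subring V \<and> c \<notin> V}"
  have "\<exists>M\<in>\<A>. \<forall>W\<in>\<A>. M \<subseteq> W \<longrightarrow> W = M"
  proof (rule subset_Zorn_nonempty)
    have "is_subring (\<int> :: 'a set)"
      unfolding is_subring_def by simp
    then show "\<A> \<noteq> {}"
      using assms by (auto simp: \<A>_def)
    fix \<C> assume C: "\<C> \<noteq> {}" "subset.chain \<A> \<C>"
    then have CA: "H \<in> \<A>" if "H \<in> \<C>" for H
      using that unfolding subset.chain_def by blast
    have lin: "H \<subseteq> K \<or> K \<subseteq> H" if "H \<in> \<C>" "K \<in> \<C>" for H K
      using C(2) that unfolding subset.chain_def by blast
    have "is_subring (\<Union> \<C>)"
      unfolding is_subring_def
    proof (intro conjI ballI)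
      show "1 \<in> \<Union> \<C>"
        using C(1) CA by (auto simp: \<A>_def is_subring_def)
      fix a b assume "a \<in> \<Union> \<C>" "b \<in> \<Union> \<C>"
      then obtain H where "H \<in> \<C>" "a \<in> H" "b \<in> H"
        using lin by blast
      then show "a + b \<in> \<Union> \<C>" "a * b \<in> \<Union> \<C>" "- a \<in> \<Union> \<C>"
        using CA[of H] by (auto simp: \<A>_def is_subring_def intro!: bexI[of _ H])
    qed
    then show "\<Union> \<C> \<in> \<A>"
      using CA by (auto simp: \<A>_def)
  qed
  then show ?thesis
    unfolding \<A>_def by auto
qed

text \<open>A subring that is maximal without \<open>1 / p\<close> is a valuation ring, which
  extends the p-adic absolute value to the whole closure without ideals or completions. Algebraicity
  over the rationals makes the valuation take rational values.\<close>

locale padic_ring =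
  fixes p :: nat and V :: "'a::field_char_0 set"
  assumes prime: "prime p" and sub: "is_subring V" and notin: "inverse (of_nat p) \<notin> V"
    and maximal: "\<And>W. is_subring W \<Longrightarrow> V \<subseteq> W \<Longrightarrow> inverse (of_nat p) \<notin> W \<Longrightarrow> W = V"
    and alg: "\<And>x :: 'a. alg_over_rat x"
begin

lemmas V = is_subringD[OF sub]

definition P :: 'a where "P = of_nat p"

lemma P0: "P \<noteq> 0"
  using prime by (simp add: P_def prime_gt_0_nat)

lemma P_in: "P \<in> V"
  unfolding P_def by (rule V)

lemma P_notin: "inverse P \<notin> V"
  using notin by (simp add: P_def)

definition coeffs_in :: "'a poly \<Rightarrow> bool" where "coeffs_in f \<longleftrightarrow> (\<forall>i. coeff f i \<in> V)"

lemma adjoin: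
  assumes "x \<notin> V"
  shows "\<exists>f. coeffs_in f \<and> poly f x = inverse P"
proof (rule ccontr)
  assume no: "\<not> ?thesis"
  define W where "W = {poly f x | f. coeffs_in f}"
  have "is_subring W"
    unfolding is_subring_def
  proof (intro conjI ballI)
    have "coeffs_in 1" "poly 1 x = 1"
      by (auto simp: coeffs_in_def coeff_1 intro: V)
    then show "1 \<in> W"
      unfolding W_def by force
    fix a b assume "a \<in> W" "b \<in> W"
    then obtain f g where fg: "a = poly f x" "b = poly g x" "coeffs_in f" "coeffs_in g"
      unfolding W_def by blast
    have "coeffs_in (f + g)" "coeffs_in (f * g)" "coeffs_in (- f)"
      using fg(3,4) by (auto simp: coeffs_in_def coeff_mult intro!: V)
    moreover have "a + b = poly (f + g) x" "a * b = poly (f * g) x" "- a = poly (- f) x"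
      using fg by simp_all
    ultimately show "a + b \<in> W" "a * b \<in> W" "- a \<in> W"
      unfolding W_def by blast+
  qed
  moreover have "V \<subseteq> W"
  proof
    fix v assume "v \<in> V"
    then have "coeffs_in [:v:]" "v = poly [:v:] x"
      by (auto simp: coeffs_in_def coeff_pCons V split: nat.splits)
    then show "v \<in> W"
      unfolding W_def by blast
  qed
  moreover have "inverse (of_nat p) \<notin> W"
    using no unfolding W_def P_def by force
  ultimately have "W = V"
    by (rule maximal)
  moreover have "coeffs_in [:0, 1:]" "x = poly [:0, 1:] x"
    by (auto simp: coeffs_in_def coeff_pCons V split: nat.splits)
  then have "x \<in> W"
    unfolding W_def by blast
  ultimately show False
    using assms by simp
qed

text \<open>\<open>P\<close> lies in the Jacobson radical. If the inverse of
  \<open>d = 1 - P * c\<close> were missing from \<open>V\<close>, then \<open>1 / P\<close> would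
  be a polynomial in it; clearing denominators puts \<open>d^n / P\<close> into \<open>V\<close>,
  and \<open>d^n\<close> is \<open>1\<close> modulo \<open>P\<close>, so \<open>1 / P\<close> would
  be in \<open>V\<close>.\<close>

lemma one_minus_unit:
  assumes c: "c \<in> V"
  shows "1 - P * c \<noteq> 0" "inverse (1 - P * c) \<in> V"
proof -
  show nz: "1 - P * c \<noteq> 0"
  proof
    assume "1 - P * c = 0"
    then have "c = inverse P"
      by (metis eq_iff_diff_eq_0 inverse_unique)
    then show False
      using c P_notin by simp
  qed
  show "inverse (1 - P * c) \<in> V"
  proof (rule ccontr)
    assume "inverse (1 - P * c) \<notin> V"
    then obtain f where f: "coeffs_in f" "poly f (inverse (1 - P * c)) = inverse P"
      using adjoin by blast
    define d n where "d = 1 - P * c" and "n = degree f"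
    have d: "d \<in> V" "d \<noteq> 0"
      using c nz by (auto simp: d_def intro!: V P_in)
    have "d ^ n * inverse P = (\<Sum>i\<le>n. coeff f i * (d ^ n * inverse d ^ i))"
      unfolding f(2)[symmetric] poly_altdef n_def[symmetric] d_def[symmetric]
      by (simp add: sum_distrib_left mult_ac)
    also have "\<dots> = (\<Sum>i\<le>n. coeff f i * d ^ (n - i))"
      using d(2) by (intro sum.cong) (auto simp: power_diff field_simps)
    also have "\<dots> \<in> V"
      using f(1) d(1) by (auto simp: coeffs_in_def intro!: V)
    finally have 1: "d ^ n * inverse P \<in> V" .
    have "\<exists>c1\<in>V. d ^ k = 1 - P * c1" for k
    proof (induction k)
      case 0
      show ?case
        by (intro bexI[of _ 0]) (auto intro: V)
    next
      case (Suc k)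
      then obtain c1 where c1: "c1 \<in> V" "d ^ k = 1 - P * c1"
        by blast
      have "d ^ Suc k = d * (1 - P * c1)"
        using c1 by simp
      also have "\<dots> = 1 - P * (c + c1 - P * c * c1)"
        unfolding d_def by (simp add: algebra_simps)
      finally show ?case
        using c c1 by (intro bexI[of _ "c + c1 - P * c * c1"]) (auto intro!: V P_in)
    qed
    then obtain c1 where c1: "c1 \<in> V" "d ^ n = 1 - P * c1"
      by blast
    have "inverse P = d ^ n * inverse P + c1"
      unfolding c1(2) using P0 by (simp add: field_simps)
    also have "\<dots> \<in> V"
      by (rule V(3)[OF 1 c1(1)])
    finally show False
      using P_notin by simp
  qed
qed

text \<open>The relation for \<open>1 / x\<close> expresses the unit
  \<open>1 - P * coeff g 0\<close> through negative powers of \<open>x\<close>. Multiplied by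
  \<open>x^n\<close>, it rewrites the leading term of \<open>f\<close> in lower powers.\<close>

lemma reduce_degree:
  assumes f: "coeffs_in f" "poly f x = inverse P"
      and g: "coeffs_in g" "poly g (inverse x) = inverse P"
    and "x \<noteq> 0" and le: "degree g \<le> degree f"
  shows "\<exists>f1. coeffs_in f1 \<and> poly f1 x = inverse P \<and> degree f1 < degree f"
proof -
  define n m where "n = degree f" and "m = degree g"
  define u where "u = inverse (1 - P * coeff g 0)"
  have g0: "coeff g 0 \<in> V"
    using g(1) by (simp add: coeffs_in_def)
  note u = one_minus_unit[OF g0]
  have "n > 0"
  proof (rule ccontr)
    assume "\<not> n > 0"
    then obtain c where "f = [:c:]"
      unfolding n_def by (metis degree_eq_zeroE gr0I)
    then show False
      using f P_notin by (auto simp: coeffs_in_def) (metis coeff_pCons_0)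
  qed
  \<comment> \<open>\<open>h\<close> takes the same value at \<open>x\<close> as the leading term of
    \<open>f\<close>. The exponents \<open>n - j\<close> are not truncated because
    \<open>degree g \<le> degree f\<close>, and \<open>j \<ge> 1\<close> makes them smaller than
    \<open>n\<close>.\<close>
  define h where "h = (\<Sum>j\<in>{1..m}. monom (P * u * lead_coeff f * coeff g j) (n - j))"
  define f1 where "f1 = (f - monom (lead_coeff f) n) + h"
  have h_deg: "degree h < n"
    unfolding h_def
  proof (rule degree_sum_less)
    fix j assume "j \<in> {1..m}"
    then have "n - j < n"
      using \<open>n > 0\<close> by auto
    then show "degree (monom (P * u * lead_coeff f * coeff g j) (n - j)) < n"
      by (rule le_less_trans[OF degree_monom_le])
  qed (use \<open>n > 0\<close> in simp)
  have "degree (f - monom (lead_coeff f) n) < n"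
  proof (rule degree_less_of_coeff_0)
    show "degree (f - monom (lead_coeff f) n) \<le> n"
      by (intro degree_diff_le) (auto simp: n_def degree_monom_le)
  qed (use \<open>n > 0\<close> in \<open>auto simp: n_def\<close>)
  then have "degree f1 < n"
    unfolding f1_def using h_deg by (rule degree_add_less)
  moreover have "coeffs_in f1"
    using f(1) g(1) u unfolding f1_def h_def coeffs_in_def
    by (auto simp: coeff_sum u_def intro!: V P_in)
  moreover have "poly f1 x = inverse P"
  proof -
    have "P * poly g (inverse x) = 1"
      using g(2) P0 by simp
    moreover have "poly g (inverse x) = coeff g 0 + (\<Sum>j\<in>{1..m}. coeff g j * inverse x ^ j)"
      unfolding poly_altdef m_def[symmetric]
      by (simp add: atMost_atLeast0 sum.atLeast_Suc_atMost)
    ultimately have eq: "P * (\<Sum>j\<in>{1..m}. coeff g j * inverse x ^ j) = 1 - P * coeff g 0"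
      by (simp add: algebra_simps)
    have "poly h x = (\<Sum>j\<in>{1..m}. P * u * lead_coeff f * coeff g j * x ^ (n - j))"
      unfolding h_def by (simp add: poly_sum poly_monom)
    also have "\<dots> = (\<Sum>j\<in>{1..m}. u * lead_coeff f * x ^ n * (P * (coeff g j * inverse x ^ j)))"
      using le \<open>x \<noteq> 0\<close> by (intro sum.cong) (auto simp: m_def n_def power_diff field_simps)
    also have "\<dots> = u * lead_coeff f * x ^ n * (P * (\<Sum>j\<in>{1..m}. coeff g j * inverse x ^ j))"
      by (simp add: sum_distrib_left)
    also have "\<dots> = lead_coeff f * x ^ n * (u * (1 - P * coeff g 0))"
      unfolding eq by (simp add: mult_ac)
    also have "u * (1 - P * coeff g 0) = 1"
      unfolding u_def using u(1) by simp
    finally show ?thesis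
      using f(2) by (simp add: f1_def poly_monom)
  qed
  ultimately show ?thesis
    unfolding n_def by blast
qed

text \<open>If neither element were in \<open>V\<close>, both would satisfy a relation with value
  \<open>1 / P\<close>, and the longer of the two could be shortened forever.\<close>

lemma valuation_ring:
  assumes "x \<noteq> 0"
  shows "x \<in> V \<or> inverse x \<in> V"
proof -
  have "False" if "coeffs_in f" "poly f x = inverse P" "coeffs_in g" "poly g (inverse x)
      = inverse P" "x \<noteq> 0"
    for x f g
    using that
  proof (induction "degree f + degree g" arbitrary: x f g rule: less_induct)
    case less
    show False
    proof (cases "degree g \<le> degree f")
      case True
      then obtain f1 where "coeffs_in f1" "poly f1 x = inverse P" "degree f1 < degree f"
        using reduce_degree[OF less(2-6)] by blast
      then show False
        using less(1)[of f1 g x] less(4-6) by auto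
    next
      case False
      then obtain g1 where "coeffs_in g1" "poly g1 (inverse x) = inverse P" "degree g1 < degree g"
        using reduce_degree[OF less(4,5), of f] less(2,3,6) by auto
      then show False
        using less(1)[of f g1 x] less(2,3,6) by auto
    qed
  qed
  then show ?thesis
    using adjoin[of x] adjoin[of "inverse x"] assms by blast
qed

definition is_unit :: "'a \<Rightarrow> bool" where
  "is_unit u \<longleftrightarrow> u \<noteq> 0 \<and> u \<in> V \<and> inverse u \<in> V"

lemma is_unit_mult: "is_unit u \<Longrightarrow> is_unit v \<Longrightarrow> is_unit (u * v)"
  and is_unit_inverse: "is_unit u \<Longrightarrow> is_unit (inverse u)"
  and is_unit_one: "is_unit 1"
  and is_unit_uminus: "is_unit u \<Longrightarrow> is_unit (- u)"
  by (auto simp: is_unit_def V)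

lemma is_unit_power: "is_unit u \<Longrightarrow> is_unit (u ^ n)"
  by (induction n) (auto intro: is_unit_mult is_unit_one)

lemma is_unit_coprime_nat:
  assumes "\<not> p dvd n"
  shows "is_unit (of_nat n)"
proof -
  have "coprime (int n) (int p)"
    using prime assms by (metis coprime_commute coprime_int_iff prime_imp_coprime)
  then obtain a b where "a * int n + b * int p = 1"
    by (metis bezout_int coprime_imp_gcd_eq_1)
  then have "of_int (a * int n + b * int p) = (1 :: 'a)"
    by simp
  then have eq: "of_int a * of_nat n = 1 - P * of_int b"
    by (simp add: P_def algebra_simps)
  have "of_int b \<in> V"
    by (rule V)
  note u = one_minus_unit[OF this]
  have nz: "of_nat n \<noteq> (0 :: 'a)"
    using assms by (metis dvd_0_right of_nat_eq_0_iff)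
  have "inverse (of_nat n) = of_int a * inverse (1 - P * of_int b)"
    using u(1) nz eq by (simp add: field_simps)
  also have "\<dots> \<in> V"
    using u(2) by (intro V)
  finally show ?thesis
    using nz by (simp add: is_unit_def V)
qed

text \<open>The condition describes the maximal ideal of \<open>V\<close>. One of
  \<open>a / b\<close> and \<open>b / a\<close> lies in \<open>V\<close>, and then
  \<open>1 / b = (1 + a / b) / (a + b)\<close> or its mirror image would lie in \<open>V\<close>
  together with \<open>1 / (a + b)\<close>.\<close>

lemma nonunit_add:
  assumes "inverse a \<notin> V \<or> a = 0" "inverse b \<notin> V \<or> b = 0"
  shows "inverse (a + b) \<notin> V \<or> a + b = 0"
proof (rule ccontr)
  have main: False if "inverse (a + b) \<in> V" "a + b \<noteq> 0" "inverse b \<notin> V" "b \<noteq> 0" "a * inverse b \<in> V"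
      for a b
  proof -
    have "inverse b = (1 + a * inverse b) * inverse (a + b)"
      using that by (simp add: field_simps)
    also have "\<dots> \<in> V"
      by (rule V(4)[OF V(3)[OF V(1) that(5)] that(1)])
    finally show False
      using that by simp
  qed
  assume "\<not> ?thesis"
  then have ab: "inverse (a + b) \<in> V" "a + b \<noteq> 0"
    by auto
  show False
  proof (cases "a = 0 \<or> b = 0")
    case True
    then show False
      using ab assms by auto
  next
    case False
    then have "a * inverse b \<in> V \<or> inverse (a * inverse b) \<in> V"
      by (intro valuation_ring) simp
    then have "a * inverse b \<in> V \<or> b * inverse a \<in> V"
      by (simp add: mult.commute)
    then show False
      using main[of a b] main[of b a] ab assms False by (auto simp: add.commute)
  qed
qed

lemma largest_term:
  assumes "finite S" "S \<noteq> {}" "\<And>i. i \<in> S \<Longrightarrow> f i \<noteq> (0 :: 'a)"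
  shows "\<exists>i\<in>S. \<forall>j\<in>S. f j / f i \<in> V"
  using assms
proof (induction S rule: finite_ne_induct)
  case (singleton x)
  then show ?case
    by (simp add: V)
next
  case (insert x S)
  have "\<exists>i\<in>S. \<forall>j\<in>S. f j / f i \<in> V"
    by (rule insert(4)) (rule insert(5), simp)
  then obtain i where i: "i \<in> S" "\<And>j. j \<in> S \<Longrightarrow> f j / f i \<in> V"
    by blast
  have nz: "f x \<noteq> 0" "f i \<noteq> 0"
    using insert(5) i(1) by auto
  then consider "f x / f i \<in> V" | "f i / f x \<in> V"
    using valuation_ring[of "f x / f i"] by (auto simp: inverse_divide)
  then show ?case
  proof cases
    case 1
    then have "\<forall>j\<in>insert x S. f j / f i \<in> V"
      using i(2) by blast
    then show ?thesis
      using i(1) by blast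
  next
    case 2
    have "f j / f x \<in> V" if "j \<in> insert x S" for j
    proof (cases "j = x")
      case True
      then show ?thesis
        using nz by (auto intro: V)
    next
      case False
      then have "(f j / f i) * (f i / f x) \<in> V"
        using i(2) that 2 by (intro V(4)) auto
      then show ?thesis
        using nz by simp
    qed
    then show ?thesis
      by blast
  qed
qed

text \<open>States that \<open>x\<close> has valuation \<open>(b - a) / n\<close>; two natural
  exponents avoid negative powers of \<open>P\<close>.\<close>

definition ord_rel :: "'a \<Rightarrow> nat \<Rightarrow> nat \<Rightarrow> nat \<Rightarrow> bool" where
  "ord_rel x n a b \<longleftrightarrow> n > 0 \<and> (\<exists>u. is_unit u \<and> x ^ n * P ^ a = u * P ^ b)"

lemma ord_rel_int:
  assumes "z \<noteq> 0"
  shows "\<exists>b. ord_rel (of_int z) 1 0 b"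
proof -
  have nat: "\<exists>u b. is_unit u \<and> of_nat n = u * P ^ b" if n0: "n > 0" for n
  proof -
    obtain b m where "n = p ^ b * m" "\<not> p dvd m"
      by (rule multiplicity_decompose'[of n p]) (use n0 prime in auto)
    then show ?thesis
      using is_unit_coprime_nat[of m] by (intro exI[of _ "of_nat m"] exI[of _ b]) (simp add: P_def)
  qed
  obtain u b where "is_unit u" "of_nat (nat \<bar>z\<bar>) = u * P ^ b"
    using nat[of "nat \<bar>z\<bar>"] assms by auto
  moreover have "of_int z = (of_nat (nat \<bar>z\<bar>) :: 'a) \<or> of_int z = - (of_nat (nat \<bar>z\<bar>) :: 'a)"
    by (cases "z \<ge> 0") auto
  ultimately have "\<exists>u. is_unit u \<and> of_int z = u * P ^ b"
    by (metis is_unit_uminus mult_minus_left)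
  then show ?thesis
    by (auto simp: ord_rel_def)
qed

lemma ord_rel_rat:
  assumes "q \<noteq> 0"
  shows "\<exists>a b u. is_unit u \<and> of_rat q * P ^ a = u * P ^ b"
proof -
  obtain c d where cd: "quotient_of q = (c, d)"
    by (cases "quotient_of q")
  then have d: "d \<noteq> 0" and q: "q = of_int c / of_int d"
    using quotient_of_denom_pos[OF cd] quotient_of_div[OF cd] by auto
  then have "c \<noteq> 0"
    using assms by auto
  obtain a u where u: "is_unit u" "of_int d = u * P ^ a"
    using ord_rel_int[OF d] by (auto simp: ord_rel_def)
  obtain b v where v: "is_unit v" "of_int c = v * P ^ b"
    using ord_rel_int[OF \<open>c \<noteq> 0\<close>] by (auto simp: ord_rel_def)
  have "of_rat q * (u * P ^ a) = v * P ^ b"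
    using d unfolding u(2)[symmetric] v(2)[symmetric] q by (simp add: of_rat_divide)
  then have "of_rat q * P ^ a = (v * inverse u) * P ^ b"
    using u(1) by (simp add: is_unit_def field_simps)
  moreover have "is_unit (v * inverse u)"
    using u v by (intro is_unit_mult is_unit_inverse)
  ultimately show ?thesis
    by blast
qed

text \<open>In a rational polynomial relation for \<open>x\<close>, two terms must share the largest
  size, since a single largest term cannot be cancelled by smaller ones. Their quotient is a unit,
  so a power of \<open>x\<close> is a unit times a rational number.\<close>

lemma ord_rel_exists:
  assumes "x \<noteq> 0"
  shows "\<exists>n a b. ord_rel x n a b"
proof -
  obtain q where q: "q \<noteq> 0" "rat_poly q x = 0"
    using alg unfolding alg_over_rat_def by blast
  define S where "S = {i. coeff q i \<noteq> 0}"
  define f where "f i = of_rat (coeff q i) * x ^ i" for i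
  have "S \<subseteq> {..degree q}"
    unfolding S_def using le_degree by auto
  then have S: "finite S" "S \<noteq> {}"
    using q(1) finite_subset[of S "{..degree q}"] by (simp, auto simp: S_def poly_eq_iff)
  have f0: "f i \<noteq> 0" if "i \<in> S" for i
    using that assms by (simp add: f_def S_def)
  have "\<exists>i\<in>S. \<forall>j\<in>S. f j / f i \<in> V"
    by (rule largest_term[OF S]) (rule f0)
  then obtain i where i: "i \<in> S" "\<And>j. j \<in> S \<Longrightarrow> f j / f i \<in> V"
    by blast
  have "0 = (\<Sum>j\<le>degree q. f j)"
    using q(2) unfolding rat_poly_def poly_altdef f_def
      by (simp add: degree_map_poly coeff_map_poly)
  also have "\<dots> = (\<Sum>j\<in>S. f j)"
    using \<open>S \<subseteq> {..degree q}\<close> by (intro sum.mono_neutral_right) (auto simp: S_def f_def)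
  also have "\<dots> = f i + (\<Sum>j\<in>S - {i}. f j)"
    using S(1) i(1) by (rule sum.remove)
  finally have "(\<Sum>j\<in>S - {i}. f j) = - f i"
    by (metis eq_neg_iff_add_eq_0 add.commute)
  moreover have "(\<Sum>j\<in>S - {i}. f j / f i) = (\<Sum>j\<in>S - {i}. f j) / f i"
    by (rule sum_divide_distrib[symmetric])
  ultimately have sum: "(\<Sum>j\<in>S - {i}. f j / f i) = - 1"
    using f0[OF i(1)] by simp
  have "\<exists>j\<in>S - {i}. inverse (f j / f i) \<in> V"
  proof (rule ccontr)
    assume no: "\<not> ?thesis"
    have "inverse (\<Sum>j\<in>A. f j / f i) \<notin> V \<or> (\<Sum>j\<in>A. f j / f i) = 0" if "A \<subseteq> S - {i}" for A
      using that no
    proof (induction A rule: infinite_finite_induct)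
      case (insert j A)
      then show ?case
        using nonunit_add[of "f j / f i" "\<Sum>j\<in>A. f j / f i"] by auto
    qed auto
    from this[of "S - {i}"] show False
      using V(5)[OF V(1)] unfolding sum by simp
  qed
  then obtain j where j: "j \<in> S" "j \<noteq> i" "inverse (f j / f i) \<in> V"
    by auto
  have main: "\<exists>n a b. ord_rel x n a b"
    if ij: "i \<in> S" "j \<in> S" "i < j" "is_unit (f j / f i)" for i j
  proof -
    define r where "r = coeff q i / coeff q j"
    have "r \<noteq> 0"
      using ij by (simp add: r_def S_def)
    then obtain a b u where u: "is_unit u" "of_rat r * P ^ a = u * P ^ b"
      using ord_rel_rat by blast
    have "x ^ (j - i) = (f j / f i) * of_rat r"
      using ij assms by (simp add: f_def r_def S_def of_rat_divide power_diff field_simps)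
    then have "x ^ (j - i) * P ^ a = (f j / f i) * (of_rat r * P ^ a)"
      by (simp only: mult.assoc)
    also have "\<dots> = (f j / f i * u) * P ^ b"
      unfolding u(2) by (simp only: mult.assoc)
    finally have "x ^ (j - i) * P ^ a = (f j / f i * u) * P ^ b" .
    moreover have "j - i > 0"
      using ij(3) by simp
    ultimately have "ord_rel x (j - i) a b"
      using is_unit_mult[OF ij(4) u(1)] unfolding ord_rel_def by blast
    then show ?thesis
      by blast
  qed
  have "is_unit (f j / f i)" "is_unit (f i / f j)"
    using i j f0 by (auto simp: is_unit_def inverse_divide)
  then show ?thesis
    using main[of i j] main[of j i] i(1) j(1,2) by (metis linorder_neqE_nat)
qed

lemma unit_power_eq:
  assumes "is_unit u" "is_unit v" "u * P ^ c = v * P ^ d"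
  shows "c = d"
proof -
  have main: False if "is_unit u" "is_unit v" "u * P ^ c = v * P ^ d" "c < d" for u v c d
  proof -
    define k where "k = d - c - 1"
    have "P ^ d = P ^ c * (P * P ^ k)"
      using that(4) by (simp add: k_def flip: power_Suc power_add)
    then have "u = v * (P * P ^ k)"
      using that(3) P0 by simp
    then have "inverse P = v * P ^ k * inverse u"
      using that(1) P0 by (simp add: is_unit_def field_simps)
    also have "\<dots> \<in> V"
      using that by (auto simp: is_unit_def intro!: V P_in)
    finally show False
      using P_notin by simp
  qed
  show ?thesis
    using main[OF assms(1,2,3)] main[OF assms(2,1) assms(3)[symmetric]] by (metis linorder_neqE_nat)
qed

lemma ord_rel_power:
  assumes "is_unit u" "x ^ n * P ^ a = u * P ^ b"
  shows "x ^ (n * k) * P ^ (a * k) = u ^ k * P ^ (b * k)"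
  using assms(2) by (metis power_mult power_mult_distrib)

lemma ord_rel_unique:
  assumes "ord_rel x n a b" "ord_rel x m c d" "x \<noteq> 0"
  shows "(real a - real b) / real n = (real c - real d) / real m"
proof -
  obtain u where u: "is_unit u" "x ^ n * P ^ a = u * P ^ b" "n > 0"
    using assms(1) by (auto simp: ord_rel_def)
  obtain v where v: "is_unit v" "x ^ m * P ^ c = v * P ^ d" "m > 0"
    using assms(2) by (auto simp: ord_rel_def)
  note 1 = ord_rel_power[OF u(1,2), of m] and 2 = ord_rel_power[OF v(1,2), of n]
  have "u ^ m * P ^ (b * m + c * n) = x ^ (n * m) * P ^ (a * m) * P ^ (c * n)"
    unfolding 1 by (simp add: power_add mult_ac)
  also have "\<dots> = x ^ (m * n) * P ^ (c * n) * P ^ (a * m)"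
    by (simp add: mult_ac)
  also have "\<dots> = v ^ n * P ^ (d * n + a * m)"
    unfolding 2 by (simp add: power_add mult_ac)
  finally have "b * m + c * n = d * n + a * m"
    using unit_power_eq u v is_unit_power by blast
  then have "real b * real m + real c * real n = real d * real n + real a * real m"
    by (metis of_nat_add of_nat_mult)
  then show ?thesis
    using u(3) v(3) by (simp add: field_simps)
qed

text \<open>The sign of the exponent gives \<open>p\<close> the value \<open>1 / p\<close>. By
  \<open>ord_rel_exists\<close> and \<open>ord_rel_unique\<close> the number selected by
  \<open>SOME\<close> is determined.\<close>

definition pval :: "'a \<Rightarrow> real" where
  "pval x = (if x = 0 then 0 else real p powr
     (SOME r. \<exists>n a b. ord_rel x n a b \<and> r = (real a - real b) / real n))"

lemma pval_eq:
  assumes "ord_rel x n a b" "x \<noteq> 0"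
  shows "pval x = real p powr ((real a - real b) / real n)"
proof -
  have "(SOME r. \<exists>n a b. ord_rel x n a b \<and> r = (real a - real b) / real n)
      = (real a - real b) / real n"
    using assms ord_rel_unique by (intro some_equality) blast+
  then show ?thesis
    using assms(2) by (simp add: pval_def)
qed

lemma p_gt_1: "real p > 1"
  using prime prime_gt_1_nat by simp

lemma pval_nonneg: "pval x \<ge> 0" and pval_eq_0: "pval x = 0 \<longleftrightarrow> x = 0"
  using p_gt_1 by (auto simp: pval_def)

lemma pval_mult: "pval (x * y) = pval x * pval y"
proof (cases "x = 0 \<or> y = 0")
  case True
  then show ?thesis
    by (auto simp: pval_def)
next
  case False
  obtain n a b where x: "ord_rel x n a b"
    using ord_rel_exists False by blast
  obtain m c d where y: "ord_rel y m c d"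
    using ord_rel_exists False by blast
  obtain u where u: "is_unit u" "x ^ n * P ^ a = u * P ^ b" "n > 0"
    using x by (auto simp: ord_rel_def)
  obtain v where v: "is_unit v" "y ^ m * P ^ c = v * P ^ d" "m > 0"
    using y by (auto simp: ord_rel_def)
  note 1 = ord_rel_power[OF u(1,2), of m] and 2 = ord_rel_power[OF v(1,2), of n]
  have "(x * y) ^ (n * m) * P ^ (a * m + c * n)
      = (x ^ (n * m) * P ^ (a * m)) * (y ^ (m * n) * P ^ (c * n))"
    by (simp add: power_mult_distrib power_add mult_ac)
  also have "\<dots> = (u ^ m * v ^ n) * P ^ (b * m + d * n)"
    unfolding 1 2 by (simp add: power_add mult_ac)
  finally have "ord_rel (x * y) (n * m) (a * m + c * n) (b * m + d * n)"
    unfolding ord_rel_def using u(3) v(3) is_unit_mult[OF is_unit_power[OF u(1)] is_unit_power[OF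
        v(1)]]
    by (intro conjI exI[of _ "u ^ m * v ^ n"]) simp_all
  then have "pval (x * y) = real p powr
      ((real (a * m + c * n) - real (b * m + d * n)) / real (n * m))"
    using False by (intro pval_eq) auto
  also have "(real (a * m + c * n) - real (b * m + d * n)) / real (n * m) =
      (real a - real b) / real n + (real c - real d) / real m"
    using u(3) v(3) by (simp add: field_simps)
  finally show ?thesis
    using pval_eq[OF x] pval_eq[OF y] False by (simp add: powr_add)
qed

lemma pval_le_1: "pval x \<le> 1 \<longleftrightarrow> x \<in> V"
proof (cases "x = 0")
  case False
  obtain n a b where x: "ord_rel x n a b"
    using ord_rel_exists False by blast
  obtain u where u: "is_unit u" "x ^ n * P ^ a = u * P ^ b" "n > 0"
    using x by (auto simp: ord_rel_def)
  have "pval x \<le> 1 \<longleftrightarrow> a \<le> b"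
    using pval_eq[OF x False] p_gt_1 u(3)
      powr_le_cancel_iff[of "real p" "(real a - real b) / real n" 0] by (simp add: field_simps)
  also have "\<dots> \<longleftrightarrow> x \<in> V"
  proof
    assume "a \<le> b"
    then have "P ^ b = P ^ (b - a) * P ^ a"
      by (simp flip: power_add)
    then have xn: "x ^ n = u * P ^ (b - a)"
      using u(2) P0 by simp
    then have "x ^ n \<in> V"
      using u(1) by (auto simp: is_unit_def intro!: V P_in)
    show "x \<in> V"
    proof (rule ccontr)
      assume "x \<notin> V"
      then have "inverse x \<in> V"
        using valuation_ring[OF False] by blast
      \<comment> \<open>A valuation ring is integrally closed: with \<open>x^n\<close> and
        \<open>1 / x\<close> also \<open>x = x^n * (1 / x)^(n - 1)\<close> is in
        \<open>V\<close>.\<close>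
      then have "x ^ n * inverse x ^ (n - 1) \<in> V"
        by (rule V(4)[OF \<open>x ^ n \<in> V\<close> V(7)])
      moreover have "x ^ n * inverse x ^ (n - 1) = x"
        using False u(3) by (cases n) (simp_all add: power_inverse)
      ultimately show False
        using \<open>x \<notin> V\<close> by simp
    qed
  next
    assume "x \<in> V"
    show "a \<le> b"
    proof (rule ccontr)
      assume "\<not> a \<le> b"
      define k where "k = a - b - 1"
      have "P ^ a = P ^ b * (P * P ^ k)"
        using \<open>\<not> a \<le> b\<close> by (simp add: k_def flip: power_Suc power_add)
      then have "x ^ n * (P * P ^ k) = u"
        using u(2) P0 by simp
      then have "inverse P = x ^ n * P ^ k * inverse u"
        using u(1) P0 by (simp add: is_unit_def field_simps)
      also have "\<dots> \<in> V"
        using \<open>x \<in> V\<close> u(1) by (auto simp: is_unit_def intro!: V P_in)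
      finally show False
        using P_notin by simp
    qed
  qed
  finally show ?thesis .
qed (simp add: pval_def V)

lemma pval_ultrametric: "pval (x + y) \<le> max (pval x) (pval y)"
proof -
  have main: "pval (x + y) \<le> pval y" if "pval x \<le> pval y" for x y
  proof (cases "y = 0")
    case True
    then show ?thesis
      using that pval_nonneg[of x] by (simp add: pval_eq_0 pval_def split: if_splits)
  next
    case False
    have "pval (x / y) * pval y = pval x"
      using False by (simp flip: pval_mult)
    moreover have "pval y > 0"
      using False pval_nonneg[of y] pval_eq_0[of y] by simp
    ultimately have "pval (x / y) \<le> 1"
      using that by (metis divide_le_eq_1_pos nonzero_mult_div_cancel_right order_less_irrefl)
    then have "1 + x / y \<in> V"
      by (intro V) (simp add: pval_le_1)
    then have "pval (1 + x / y) \<le> 1"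
      by (simp add: pval_le_1)
    then have "pval (1 + x / y) * pval y \<le> 1 * pval y"
      using pval_nonneg by (intro mult_right_mono)
    moreover have "(1 + x / y) * y = x + y"
      using False by (simp add: field_simps)
    then have "pval (1 + x / y) * pval y = pval (x + y)"
      by (metis pval_mult)
    ultimately show ?thesis
      by simp
  qed
  show ?thesis
    using main[of x y] main[of y x] by (cases "pval x \<le> pval y") (auto simp: add.commute max_def)
qed

lemma pval_p: "pval (of_nat p) = 1 / real p"
proof -
  have "ord_rel (of_nat p) 1 0 1"
    unfolding ord_rel_def using is_unit_one by (intro conjI exI[of _ 1]) (auto simp: P_def)
  then show ?thesis
    using pval_eq[of "of_nat p" 1 0 1] P0 p_gt_1 by (simp add: P_def powr_minus_divide)
qed

lemma pval_coprime:
  assumes "\<not> p dvd n"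
  shows "pval (of_nat n) = 1"
proof -
  have "ord_rel (of_nat n) 1 0 0"
    unfolding ord_rel_def using is_unit_coprime_nat[OF assms] by auto
  moreover have "of_nat n \<noteq> (0 :: 'a)"
    using assms by (metis dvd_0_right of_nat_eq_0_iff)
  ultimately show ?thesis
    using pval_eq[of "of_nat n" 1 0 0] p_gt_1 by simp
qed

end

section \<open>Abstract absolute values\<close>

definition absval :: "('a::field \<Rightarrow> real) \<Rightarrow> bool" where
  "absval w \<longleftrightarrow> (\<forall>x. w x \<ge> 0) \<and> (\<forall>x. w x = 0 \<longleftrightarrow> x = 0) \<and> (\<forall>x y. w (x * y) = w x * w y) \<and>
     (\<forall>x y. w (x + y) \<le> w x + w y)"

theorem padic_absolute_value:
  assumes alg: "\<And>x :: 'a::field_char_0. alg_over_rat x" and "prime p"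
  shows "\<exists>w :: 'a \<Rightarrow> real. absval w \<and> (\<forall>x y. w (x + y) \<le> max (w x) (w y)) \<and>
    w (of_nat p) = 1 / real p \<and> (\<forall>n. \<not> p dvd n \<longrightarrow> w (of_nat n) = 1)"
proof -
  have "inverse (of_nat p) \<notin> (\<int> :: 'a set)"
  proof
    assume "inverse (of_nat p) \<in> (\<int> :: 'a set)"
    then obtain z where z: "inverse (of_nat p) = (of_int z :: 'a)"
      by (auto elim: Ints_cases)
    have "of_int (z * int p) = (1 :: 'a)"
      using assms(2) by (simp flip: z add: prime_gt_0_nat)
    then have "z * int p = 1"
      by (metis of_int_eq_1_iff)
    then have "int p dvd 1"
      by (metis dvd_triv_right)
    then show False
      using assms(2) by (simp add: prime_nat_iff)
  qed
  then obtain V where "is_subring V" "inverse (of_nat p) \<notin> V"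
    "\<forall>W. is_subring W \<longrightarrow> V \<subseteq> W \<longrightarrow> inverse (of_nat p :: 'a) \<notin> W \<longrightarrow> W = V"
    using maximal_subring_avoiding by blast
  then interpret padic_ring p V
    using assms by unfold_locales auto
  have "pval (x + y) \<le> pval x + pval y" for x y
    using pval_ultrametric[of x y] pval_nonneg[of x] pval_nonneg[of y] by linarith
  then have "absval pval"
    unfolding absval_def using pval_nonneg pval_eq_0 pval_mult by blast
  then show ?thesis
    using pval_ultrametric pval_p pval_coprime by blast
qed

lemma absvalD:
  assumes "absval (w :: 'a::field \<Rightarrow> real)"
  shows "w x \<ge> 0" "w x = 0 \<longleftrightarrow> x = 0" "w (x * y) = w x * w y" "w (x + y) \<le> w x + w y"
    "w 0 = 0" "w 1 = 1" "w (- x) = w x" "w (x - y) \<le> w x + w y" "w (x ^ n) = w x ^ n"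
    "w (inverse x) = inverse (w x)" "w (x / y) = w x / w y"
    "w (\<Sum>i\<in>A. f i) \<le> (\<Sum>i\<in>A. w (f i))" "w (\<Prod>i\<in>A. f i) = (\<Prod>i\<in>A. w (f i))"
proof -
  show nonneg: "w x \<ge> 0" and eq0: "w x = 0 \<longleftrightarrow> x = 0" and mult: "w (x * y) = w x * w y"
    and add: "w (x + y) \<le> w x + w y" for x y
    using assms unfolding absval_def by blast+
  show w0: "w 0 = 0"
    using eq0 by simp
  have "w 1 * w 1 = w 1"
    using mult[of 1 1] by simp
  then show w1: "w 1 = 1"
    using eq0[of 1] by simp
  have "w (- 1) * w (- 1) = 1"
    using mult[of "- 1" "- 1"] w1 by simp
  then have wm1: "w (- 1) = 1"
    using nonneg[of "- 1"] by (metis abs_of_nonneg real_sqrt_abs2 real_sqrt_one)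
  show neg: "w (- x) = w x" for x
    using mult[of "- 1" x] wm1 by simp
  show "w (x - y) \<le> w x + w y"
    using add[of x "- y"] neg by simp
  show "w (x ^ n) = w x ^ n"
    by (induction n) (simp_all add: w1 mult)
  show inv: "w (inverse x) = inverse (w x)" for x
  proof (cases "x = 0")
    case False
    then have "w x * w (inverse x) = 1"
      using mult[of x "inverse x"] w1 by simp
    then show ?thesis
      by (metis inverse_unique)
  qed (simp add: w0)
  show "w (x / y) = w x / w y"
    by (simp add: divide_inverse mult inv)
  show "w (\<Sum>i\<in>A. f i) \<le> (\<Sum>i\<in>A. w (f i))"
    by (induction A rule: infinite_finite_induct) (auto simp: w0 intro: order_trans[OF add])
  show "w (\<Prod>i\<in>A. f i) = (\<Prod>i\<in>A. w (f i))"
    by (induction A rule: infinite_finite_induct) (auto simp: w1 mult)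
qed

lemma absval_comp:
  assumes w: "absval (w :: 'b::field \<Rightarrow> real)" and h: "comm_ring_hom (h :: 'a::field \<Rightarrow> 'b)"
  shows "absval (w \<circ> h)"
proof -
  interpret comm_ring_hom h by (rule h)
  show ?thesis
    unfolding absval_def using absvalD[OF w] comm_ring_hom_eq_0_iff[OF h]
    by (simp add: hom_add hom_mult)
qed

lemma absval_cmod: "absval cmod"
  unfolding absval_def by (simp add: norm_mult norm_triangle_ineq)

definition ultrametric :: "('a::field \<Rightarrow> real) \<Rightarrow> bool" where
  "ultrametric w \<longleftrightarrow> absval w \<and> (\<forall>x y. w (x + y) \<le> max (w x) (w y))"

lemma ultrametric_sum:
  assumes w: "ultrametric w" and "B \<ge> 0" "\<And>i. i \<in> A \<Longrightarrow> w (f i) \<le> B"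
  shows "w (\<Sum>i\<in>A. f i) \<le> B"
proof -
  have w0: "w 0 = 0" and um: "w (x + y) \<le> max (w x) (w y)" for x y
    using w absvalD(5) unfolding ultrametric_def by blast+
  show ?thesis
    using assms(3)
  proof (induction A rule: infinite_finite_induct)
    case (insert x A)
    then have "max (w (f x)) (w (\<Sum>i\<in>A. f i)) \<le> B"
      by simp
    then show ?case
      using insert(1,2) um[of "f x" "\<Sum>i\<in>A. f i"] by (simp add: max_def split: if_splits)
  qed (use \<open>B \<ge> 0\<close> in \<open>simp_all add: w0\<close>)
qed

lemma ultrametric_subring:
  assumes "ultrametric w"
  shows "is_subring {x. w x \<le> 1}"
proof -
  have w: "absval w" and um: "w (x + y) \<le> max (w x) (w y)" for x y
    using assms by (simp_all add: ultrametric_def)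
  have "w (a + b) \<le> 1" if "w a \<le> 1" "w b \<le> 1" for a b
    using um[of a b] that by (simp add: max_def split: if_splits)
  moreover have "w (a * b) \<le> 1" if "w a \<le> 1" "w b \<le> 1" for a b
    unfolding absvalD(3)[OF w] using that absvalD(1)[OF w] by (intro mult_le_one)
  ultimately show ?thesis
    unfolding is_subring_def using absvalD(6,7)[OF w] by simp
qed

lemma ultrametric_integral:
  assumes "ultrametric w" "lead_coeff p = 1" "\<And>i. w (coeff p i) \<le> 1" "poly p z = 0"
  shows "w z \<le> 1"
proof (rule ccontr)
  assume wz: "\<not> w z \<le> 1"
  have w: "absval w"
    using assms by (simp add: ultrametric_def)
  note W = absvalD[OF w]
  define n where "n = degree p"
  have "n > 0"
  proof (rule ccontr)
    assume "\<not> n > 0"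
    then have "p = 1"
      unfolding n_def using assms(2) by (metis degree_eq_zeroE coeff_pCons_0 gr0I one_pCons)
    then show False
      using assms(4) by simp
  qed
  have "0 = (\<Sum>i<n. coeff p i * z ^ i) + z ^ n"
    using assms(2,4) unfolding poly_altdef n_def by (simp add: lessThan_Suc_atMost[symmetric])
  then have "w (z ^ n) = w (\<Sum>i<n. coeff p i * z ^ i)"
    by (metis W(7) add.inverse_unique)
  also have "\<dots> \<le> w z ^ (n - 1)"
  proof (rule ultrametric_sum[OF assms(1)])
    fix i assume "i \<in> {..<n}"
    then have "w z ^ i \<le> w z ^ (n - 1)"
      using wz by (intro power_increasing) auto
    moreover have "w (coeff p i) * w z ^ i \<le> 1 * w z ^ i"
      using assms(3) W(1) by (intro mult_right_mono) auto
    ultimately show "w (coeff p i * z ^ i) \<le> w z ^ (n - 1)"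
      by (simp add: W)
  qed (simp add: W)
  finally have "w z * w z ^ (n - 1) \<le> 1 * w z ^ (n - 1)"
    using \<open>n > 0\<close> by (simp add: W flip: power_Suc)
  moreover have "w z ^ (n - 1) > 0"
    using wz by simp
  ultimately show False
    using wz by (metis mult_le_cancel_right_pos)
qed

section \<open>Product formulas over the rationals and over a number field\<close>

lemma nat_prime_power_product:
  assumes "n > 0" "finite S" "\<And>p. p \<in> S \<Longrightarrow> prime p"
  shows "real n * (\<Prod>p\<in>S. (1 / real p) ^ multiplicity p n) \<ge> 1"
    and "prime_factors n \<subseteq> S \<Longrightarrow> real n * (\<Prod>p\<in>S. (1 / real p) ^ multiplicity p n) = 1"
proof -
  define T where "T = S \<union> prime_factors n"
  have T: "finite T" "\<And>p. p \<in> T \<Longrightarrow> prime p"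
    using assms by (auto simp: T_def)
  have "n = (\<Prod>p\<in>prime_factors n. p ^ multiplicity p n)"
    using prod_prime_factors[of n] assms(1) by simp
  also have "\<dots> = (\<Prod>p\<in>T. p ^ multiplicity p n)"
  proof (rule prod.mono_neutral_left)
    show "\<forall>p\<in>T - prime_factors n. p ^ multiplicity p n = 1"
    proof
      fix p assume p: "p \<in> T - prime_factors n"
      then have "\<not> p dvd n"
        using T(2)[of p] assms(1) by (simp add: prime_factors_dvd)
      then show "p ^ multiplicity p n = 1"
        by (simp add: not_dvd_imp_multiplicity_0)
    qed
  qed (use T(1) in \<open>auto simp: T_def\<close>)
  finally have "real n = real (\<Prod>p\<in>T. p ^ multiplicity p n)"
    by (rule arg_cong)
  then have "real n = (\<Prod>p\<in>T. real p ^ multiplicity p n)"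
    by (simp only: of_nat_prod of_nat_power)
  also have "\<dots> = (\<Prod>p\<in>T - S. real p ^ multiplicity p n) * (\<Prod>p\<in>S. real p ^ multiplicity p n)"
    using T(1) by (intro prod.subset_diff) (auto simp: T_def)
  finally have n: "real n = (\<Prod>p\<in>T - S. real p ^ multiplicity p n) * (\<Prod>p\<in>S. real p ^ multiplicity p
      n)" .
  have "(\<Prod>p\<in>S. real p ^ multiplicity p n) * (\<Prod>p\<in>S. (1 / real p) ^ multiplicity p n) = 1"
    unfolding prod.distrib[symmetric] using assms(3)
    by (intro prod.neutral) (auto simp: power_one_over prime_gt_0_nat)
  then have eq: "real n * (\<Prod>p\<in>S. (1 / real p) ^ multiplicity p n)
      = (\<Prod>p\<in>T - S. real p ^ multiplicity p n)"
    unfolding n by (simp add: mult.assoc)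
  show "real n * (\<Prod>p\<in>S. (1 / real p) ^ multiplicity p n) \<ge> 1"
    unfolding eq using T(2) by (intro prod_ge_1) (auto intro!: one_le_power
        simp: Suc_leI prime_gt_0_nat)
  show "real n * (\<Prod>p\<in>S. (1 / real p) ^ multiplicity p n) = 1" if "prime_factors n \<subseteq> S"
    unfolding eq using that by (simp add: T_def Un_absorb2)
qed

definition padic :: "nat \<Rightarrow> ('a::field_char_0 \<Rightarrow> real) \<Rightarrow> bool" where
  "padic p w \<longleftrightarrow> ultrametric w \<and> w (of_nat p) = 1 / real p \<and> (\<forall>n. \<not> p dvd n \<longrightarrow> w (of_nat n) = 1)"

lemma padic_of_nat:
  assumes "padic p w" "prime p" "n > 0"
  shows "w (of_nat n) = (1 / real p) ^ multiplicity p n"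
proof -
  obtain m where m: "n = p ^ multiplicity p n * m" "\<not> p dvd m"
    by (rule multiplicity_decompose'[of n p]) (use assms in auto)
  have w: "absval w"
    using assms by (simp add: padic_def ultrametric_def)
  have "w (of_nat n) = w (of_nat p ^ multiplicity p n * of_nat m)"
    by (subst m(1)) simp
  then show ?thesis
    using assms(1) m(2) by (simp add: padic_def absvalD[OF w])
qed

lemma padic_of_int: 
  assumes "padic p w" 
  shows "w (of_int z) = w (of_nat (nat \<bar>z\<bar>))"
proof -
  have w: "absval w"
    using assms by (simp add: padic_def ultrametric_def)
  show ?thesis
    using absvalD(7)[OF w] by (cases z rule: int_cases2) simp_all
qed

lemma padic_of_rat_bad:
  assumes w: "padic p (w :: 'a::field_char_0 \<Rightarrow> real)" "prime p" and q: "quotient_of q = (a, b)"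
  shows "w (of_rat q) \<le> 1 \<longleftrightarrow> \<not> p dvd nat b"
proof -
  have av: "absval w" and um: "ultrametric w"
    using w by (simp_all add: padic_def ultrametric_def)
  have b: "b > 0" "q = of_int a / of_int b" "coprime a b"
    using quotient_of_denom_pos[OF q] quotient_of_div[OF q] quotient_of_coprime[OF q] by auto
  have "of_rat q = (of_int a / of_int b :: 'a)"
    unfolding b(2) by (simp add: of_rat_divide)
  then have "w (of_rat q) = w (of_int a) / w (of_int b)"
    by (simp only: absvalD(11)[OF av])
  then have wq: "w (of_rat q) = w (of_nat (nat \<bar>a\<bar>)) / w (of_nat (nat b))"
    using b(1) unfolding padic_of_int[OF w(1), of a] padic_of_int[OF w(1), of b]
      by (simp only: abs_of_pos)
  have le: "w (of_nat n) \<le> 1" for n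
    using is_subringD(8)[OF ultrametric_subring[OF um], of n] by simp
  show ?thesis
  proof
    assume "\<not> p dvd nat b"
    then have "w (of_nat (nat b)) = 1"
      using w(1) unfolding padic_def by blast
    then show "w (of_rat q) \<le> 1"
      unfolding wq using le[of "nat \<bar>a\<bar>"] by (simp only: div_by_1)
  next
    assume 1: "w (of_rat q) \<le> 1"
    show "\<not> p dvd nat b"
    proof
      assume pb: "p dvd nat b"
      have "\<not> p dvd nat \<bar>a\<bar>"
      proof
        assume "p dvd nat \<bar>a\<bar>"
        then have "int p dvd a" "int p dvd b"
          using pb b(1) by (auto simp: int_dvd_int_iff[symmetric])
        then have "int p dvd 1"
          using b(3) by (metis coprime_common_divisor_int coprime_def)
        then show False
          using w(2) by (simp add: prime_nat_iff)
      qed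
      then have "w (of_nat (nat \<bar>a\<bar>)) = 1"
        using w(1) unfolding padic_def by blast
      moreover have "w (of_nat (nat b)) < 1"
      proof -
        have "multiplicity p (nat b) > 0"
          using pb b(1) w(2) by (simp add: prime_multiplicity_gt_zero_iff)
        moreover have "1 / real p < 1"
          using prime_gt_1_nat[OF w(2)] by simp
        ultimately show ?thesis
          using padic_of_nat[OF w, of "nat b"] b(1) by (simp add: power_less_one_iff)
      qed
      moreover have "w (of_nat (nat b)) > 0"
        using absvalD(1,2)[OF av, of "of_nat (nat b)"] b(1) by (simp add: less_le)
      ultimately show False
        using 1 unfolding wq by (simp add: field_simps)
    qed
  qed
qed

text \<open>Integrality outside \<open>S\<close> confines the primes of the denominator to
  \<open>S\<close>, where they cancel completely against its size. The numerator may have further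
  primes, so an inequality remains.\<close>

lemma rational_product_formula:
  fixes w :: "nat \<Rightarrow> 'a::field_char_0 \<Rightarrow> real"
  assumes w: "\<And>p. prime p \<Longrightarrow> padic p (w p)" and S: "finite S" "\<And>p. p \<in> S \<Longrightarrow> prime p"
    and "q \<noteq> 0" and int: "\<And>p. prime p \<Longrightarrow> p \<notin> S \<Longrightarrow> w p (of_rat q) \<le> 1"
  shows "\<bar>real_of_rat q\<bar> * (\<Prod>p\<in>S. w p (of_rat q)) \<ge> 1"
proof -
  obtain a b where ab: "quotient_of q = (a, b)"
    by (cases "quotient_of q")
  have b: "b > 0" "q = of_int a / of_int b"
    using quotient_of_denom_pos[OF ab] quotient_of_div[OF ab] by auto
  then have a: "a \<noteq> 0"
    using \<open>q \<noteq> 0\<close> by auto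
  define m n where "m = nat \<bar>a\<bar>" and "n = nat b"
  have mn: "m > 0" "n > 0"
    using a b by (auto simp: m_def n_def)
  have "prime_factors n \<subseteq> S"
  proof
    fix p assume p: "p \<in> prime_factors n"
    then have "prime p" "p dvd nat b"
      by (auto simp: n_def)
    then show "p \<in> S"
      using int[of p] padic_of_rat_bad[OF w, of p q a b] ab by blast
  qed
  then have N: "real n * (\<Prod>p\<in>S. (1 / real p) ^ multiplicity p n) = 1"
    using nat_prime_power_product(2)[OF mn(2) S] by blast
  have M: "real m * (\<Prod>p\<in>S. (1 / real p) ^ multiplicity p m) \<ge> 1"
    using nat_prime_power_product(1)[OF mn(1) S] by blast
  have "\<bar>real_of_rat q\<bar> = real m / real n"
    using b(1) unfolding b(2) m_def n_def by (simp add: of_rat_divide)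
  moreover have "w p (of_rat q) = (1 / real p) ^ multiplicity p m / (1 / real p) ^ multiplicity p n"
    if "p \<in> S" for p
  proof -
    have p: "prime p" "padic p (w p)" "absval (w p)"
      using S(2)[OF that] w by (auto simp: padic_def ultrametric_def)
    have "of_rat q = (of_int a / of_int b :: 'a)"
      unfolding b(2) by (simp add: of_rat_divide)
    then have "w p (of_rat q) = w p (of_int a) / w p (of_int b)"
      by (simp only: absvalD(11)[OF p(3)])
    then have "w p (of_rat q) = w p (of_nat m) / w p (of_nat n)"
      using b(1) unfolding padic_of_int[OF p(2), of a] padic_of_int[OF p(2), of b] m_def n_def
      by (simp only: abs_of_pos)
    then show ?thesis
      using padic_of_nat[OF p(2,1)] mn by simp
  qed
  ultimately have "\<bar>real_of_rat q\<bar> * (\<Prod>p\<in>S. w p (of_rat q)) =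
     (real m * (\<Prod>p\<in>S. (1 / real p) ^ multiplicity p m)) /
     (real n * (\<Prod>p\<in>S. (1 / real p) ^ multiplicity p n))"
    by (simp add: prod_dividef)
  then show ?thesis
    using M unfolding N by simp
qed

text \<open>Absolute values are evaluated at coefficients of Puiseux expansions, which lie in the
  closure, so each embedding of \<open>k\<close> has to be extended to it.\<close>

lemma number_field_hom_extends:
  fixes \<sigma> :: "'k::field_char_0 \<Rightarrow> 'k alg_closure"
  assumes K: "number_field TYPE('k)" and "comm_ring_hom \<sigma>"
  shows "\<exists>\<tau> :: 'k alg_closure \<Rightarrow> 'k alg_closure. comm_ring_hom \<tau> \<and> (\<forall>x. \<tau> (to_ac x) = \<sigma> x)"
proof -
  interpret \<sigma>: comm_ring_hom \<sigma> by fact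
  have to_ac: "comm_ring_hom (to_ac :: 'k \<Rightarrow> _)"
    by (unfold_locales; simp)
  define G where "G = {(to_ac x, \<sigma> x) | x. True}"
  have "hom_graph G"
    unfolding hom_graph_def
  proof (intro conjI allI impI)
    show "(of_rat q, of_rat q) \<in> G" for q
      using comm_ring_hom_of_rat[OF to_ac, of q] comm_ring_hom_of_rat[OF assms(2), of q]
      unfolding G_def by (metis (mono_tags, lifting) mem_Collect_eq)
    show "b = 0" if "(0, b) \<in> G" for b
      using that unfolding G_def by auto
    fix a b c d assume "(a, b) \<in> G" "(c, d) \<in> G"
    then obtain x y where "a = to_ac x" "b = \<sigma> x" "c = to_ac y" "d = \<sigma> y"
      unfolding G_def by auto
    then show "(a + c, b + d) \<in> G" "(a * c, b * d) \<in> G"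
      unfolding G_def by (auto simp: \<sigma>.hom_add \<sigma>.hom_mult
          intro: exI[of _ "x + y"] exI[of _ "x * y"])
  qed
  then obtain \<tau> :: "'k alg_closure \<Rightarrow> 'k alg_closure"
    where "comm_ring_hom \<tau>" "\<And>a b. (a, b) \<in> G \<Longrightarrow> \<tau> a = b"
    using hom_graph_extends_to_hom number_field_alg_closure_algebraic[OF K] by blast
  then show ?thesis
    unfolding G_def by blast
qed

lemma number_field_complex_embedding:
  assumes K: "number_field TYPE('k::field_char_0)"
  shows "\<exists>\<iota> :: 'k alg_closure \<Rightarrow> complex. comm_ring_hom \<iota>"
proof -
  have "hom_graph {(of_rat q :: 'k alg_closure, of_rat q :: complex) | q. True}"
    unfolding hom_graph_def
    by (auto simp flip: of_rat_add of_rat_mult)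
  then show ?thesis
    using hom_graph_extends_to_hom number_field_alg_closure_algebraic[OF K] by blast
qed

definition integrally_closed_in :: "'a::field set \<Rightarrow> bool" where
  "integrally_closed_in R \<longleftrightarrow> (\<forall>p z. lead_coeff p = 1 \<longrightarrow> (\<forall>i. coeff p i \<in> R) \<longrightarrow> poly p z = 0 \<longrightarrow> z \<in> R)"

text \<open>
  The absolute values are \<open>v \<circ> \<sigma>\<close>, with \<open>\<sigma>\<close> ranging
  over the embeddings of \<open>'k\<close> and \<open>v\<close> over the complex and finitely many \<open>p\<close>-adic absolute values,
  and \<open>R\<close> consists of the elements integral at the remaining primes.
\<close>

theorem product_formula:
  fixes Y :: "'k::field_char_0 alg_closure set"
  assumes K: "number_field TYPE('k)" and "finite Y"
  shows "\<exists>(I :: (('k \<Rightarrow> 'k alg_closure) \<times> nat) set) w R.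
    finite I \<and> (\<forall>i\<in>I. absval (w i :: 'k alg_closure \<Rightarrow> real)) \<and> is_subring R \<and> Y \<subseteq> R \<and>
    integrally_closed_in R \<and>
    (\<forall>y :: 'k. y \<noteq> 0 \<longrightarrow> to_ac y \<in> R \<longrightarrow> (\<Prod>i\<in>I. w i (to_ac y)) \<ge> 1) \<and>
    (\<forall>t :: 'k. t \<noteq> 0 \<longrightarrow> to_ac t \<in> R \<longrightarrow> (\<forall>i\<in>I. w i (to_ac t) = 1) \<longrightarrow> (\<exists>n>0. t ^ n = 1))"
proof -
  define E where "E = {\<sigma> :: 'k \<Rightarrow> 'k alg_closure. comm_ring_hom \<sigma>}"
  have E: "finite E"
    unfolding E_def by (rule finite_number_field_homs[OF K])
  have "to_ac \<in> E"
    unfolding E_def by (simp, unfold_locales; simp)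
  have "\<forall>\<sigma>. \<exists>\<tau>. \<sigma> \<in> E \<longrightarrow> comm_ring_hom \<tau> \<and> (\<forall>x. \<tau> (to_ac x) = \<sigma> x)"
    using number_field_hom_extends[OF K] unfolding E_def by blast
  then obtain ext where ext: "\<And>\<sigma>. \<sigma> \<in> E \<Longrightarrow> comm_ring_hom (ext \<sigma>)"
    "\<And>\<sigma> x. \<sigma> \<in> E \<Longrightarrow> ext \<sigma> (to_ac x) = \<sigma> x"
    by metis
  obtain \<iota> :: "'k alg_closure \<Rightarrow> complex" where \<iota>: "comm_ring_hom \<iota>"
    using number_field_complex_embedding[OF K] by blast
  have "\<forall>p. \<exists>w :: 'k alg_closure \<Rightarrow> real. prime p \<longrightarrow> padic p w"
    using padic_absolute_value[OF number_field_alg_closure_algebraic[OF K]]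
    unfolding padic_def ultrametric_def by blast
  then obtain wp :: "nat \<Rightarrow> 'k alg_closure \<Rightarrow> real" where wp: "\<And>p. prime p \<Longrightarrow> padic p (wp p)"
    by metis
  have ultra: "ultrametric (wp p)" if "prime p" for p
    using wp[OF that] by (simp add: padic_def)
  \<comment> \<open>The primes at which some conjugate of \<open>y\<close> is not integral. They
    divide a denominator in a monic rational equation of \<open>y\<close>, so there are finitely
    many.\<close>
  define bad where "bad y = {p. prime p \<and> (\<exists>\<sigma>\<in>E. \<not> wp p (ext \<sigma> y) \<le> 1)}" for y
  have fin_bad: "finite (bad y)" for y
  proof -
    obtain f1 where f1: "f1 \<noteq> 0" "rat_poly f1 y = 0"
      using number_field_alg_closure_algebraic[OF K] unfolding alg_over_rat_def by blast
    define f where "f = smult (inverse (lead_coeff f1)) f1"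
    have f: "lead_coeff f = 1" "rat_poly f y = 0"
      using f1 by (auto simp: f_def)
    define g where "g = (map_poly of_rat f :: 'k alg_closure poly)"
    have g: "lead_coeff g = 1"
      using f by (simp add: g_def coeff_map_poly degree_map_poly)
    have "bad y \<subseteq> (\<Union>i\<in>{..degree f}. prime_factors (nat (snd (quotient_of (coeff f i)))))"
    proof
      fix p assume "p \<in> bad y"
      then obtain \<sigma> where p: "prime p" and \<sigma>: "\<sigma> \<in> E" "\<not> wp p (ext \<sigma> y) \<le> 1"
        by (auto simp: bad_def)
      have "poly g (ext \<sigma> y) = 0"
        using comm_ring_hom_rat_poly[OF ext(1)[OF \<sigma>(1)], of f y] f(2)
          comm_ring_hom_eq_0_iff[OF ext(1)[OF \<sigma>(1)], of 0]
        by (simp add: g_def rat_poly_def)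
      then obtain i where "\<not> wp p (coeff g i) \<le> 1"
        using ultrametric_integral[OF ultra[OF p] g] \<sigma>(2) by blast
      then have i: "\<not> wp p (of_rat (coeff f i)) \<le> 1"
        by (simp add: g_def coeff_map_poly)
      obtain a b where ab: "quotient_of (coeff f i) = (a, b)"
        by (cases "quotient_of (coeff f i)")
      have "p dvd nat b"
        using padic_of_rat_bad[OF wp[OF p] p ab] i by blast
      moreover have "b > 0"
        using quotient_of_denom_pos[OF ab] .
      ultimately have "p \<in> prime_factors (nat (snd (quotient_of (coeff f i))))"
        using p ab by (auto simp: prime_factors_dvd)
      moreover have "i \<le> degree f"
      proof (rule ccontr)
        assume "\<not> i \<le> degree f"
        then have "coeff f i = 0"
          by (simp add: coeff_eq_0)
        moreover have "wp p 0 = 0"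
          using ultra[OF p] absvalD(5) unfolding ultrametric_def by blast
        ultimately show False
          using i by simp
      qed
      ultimately show "p \<in> (\<Union>i\<in>{..degree f}. prime_factors (nat (snd (quotient_of (coeff f i)))))"
        by blast
    qed
    then show ?thesis
      by (rule finite_subset) auto
  qed
  define S where "S = (\<Union>y\<in>Y. bad y)"
  have S: "finite S" "\<And>p. p \<in> S \<Longrightarrow> prime p"
    using fin_bad \<open>finite Y\<close> by (auto simp: S_def bad_def)
  have "0 \<notin> S"
    using S(2) not_prime_0 by blast
  define R where "R = {y. \<forall>p. prime p \<longrightarrow> p \<notin> S \<longrightarrow> (\<forall>\<sigma>\<in>E. wp p (ext \<sigma> y) \<le> 1)}"
  \<comment> \<open>The index \<open>0\<close>, which is not a prime, stands for the archimedean
    absolute value and is paired with every embedding like the primes of \<open>S\<close>.\<close>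
  define I where "I = E \<times> insert 0 S"
  define v where "v p = (if p = 0 then cmod \<circ> \<iota> else wp p)" for p
  define w where "w i = v (snd i) \<circ> ext (fst i)" for i
  have av: "absval (v p)" if "p \<in> insert 0 S" for p
  proof (cases "p = 0")
    case True
    then show ?thesis
      using absval_comp[OF absval_cmod \<iota>] by (simp add: v_def)
  next
    case False
    then have "prime p"
      using that S(2) by blast
    then show ?thesis
      using False ultra unfolding v_def ultrametric_def by simp
  qed
  have avw: "absval (w i)" if "i \<in> I" for i
    unfolding w_def using that av ext(1) by (intro absval_comp) (auto simp: I_def)
  have ultra_ext: "ultrametric (wp p \<circ> ext \<sigma>)" if "prime p" "\<sigma> \<in> E" for p \<sigma>
  proof -
    interpret comm_ring_hom "ext \<sigma>"
      using ext(1) that by blast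
    show ?thesis
      using ultra[OF that(1)] absval_comp[OF _ ext(1)[OF that(2)], of "wp p"]
      unfolding ultrametric_def by (simp add: hom_add)
  qed
  have subring: "is_subring R"
  proof -
    have R: "y \<in> R \<longleftrightarrow> (\<forall>p \<sigma>. prime p \<longrightarrow> p \<notin> S \<longrightarrow> \<sigma> \<in> E \<longrightarrow> y \<in> {x. (wp p \<circ> ext \<sigma>) x \<le> 1})" for y
      by (auto simp: R_def)
    note sub = is_subringD[OF ultrametric_subring[OF ultra_ext]]
    show ?thesis
      unfolding is_subring_def
    proof (intro conjI ballI)
      show "1 \<in> R"
        unfolding R using sub(1) by blast
      fix a b assume "a \<in> R" "b \<in> R"
      then show "a + b \<in> R" "a * b \<in> R" "- a \<in> R"
        unfolding R using sub(3)[of _ _ a b] sub(4)[of _ _ a b] sub(5)[of _ _ a] by blast+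
    qed
  qed
  have "Y \<subseteq> R"
    unfolding R_def S_def bad_def by blast
  have closed: "integrally_closed_in R"
    unfolding integrally_closed_in_def
  proof (intro allI impI)
    fix p z assume p: "lead_coeff p = 1" "\<forall>i. coeff p i \<in> R" "poly p z = 0"
    have "(wp l \<circ> ext \<sigma>) z \<le> 1" if "prime l" "l \<notin> S" "\<sigma> \<in> E" for l \<sigma>
      by (rule ultrametric_integral[OF ultra_ext[OF that(1,3)] p(1) _ p(3)])
        (use p(2) that in \<open>auto simp: R_def\<close>)
    then show "z \<in> R"
      by (simp add: R_def)
  qed
  have prod: "(\<Prod>i\<in>I. w i (to_ac y)) \<ge> 1" if y: "y \<noteq> 0" "to_ac y \<in> R" for y :: 'k
  proof -
    obtain q where q: "(\<Prod>\<sigma>\<in>E. \<sigma> y) = of_rat q"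
      using norm_rational[OF K, of y] unfolding E_def by blast
    have "(\<Prod>\<sigma>\<in>E. \<sigma> y) \<noteq> 0"
      using y(1) E comm_ring_hom_eq_0_iff by (auto simp: E_def)
    then have "q \<noteq> 0"
      using q by auto
    \<comment> \<open>For a fixed absolute value the product over the embeddings is its value at the
      norm, so the rational product formula applies.\<close>
    have vq: "(\<Prod>\<sigma>\<in>E. u (ext \<sigma> (to_ac y))) = u (of_rat q)" if "absval u" for u
      using absvalD(13)[OF that, of "\<lambda>\<sigma>. \<sigma> y" E] ext(2) by (simp flip: q)
    have "(\<Prod>i\<in>I. w i (to_ac y)) = (\<Prod>\<sigma>\<in>E. \<Prod>p\<in>insert 0 S. v p (ext \<sigma> (to_ac y)))"
      unfolding I_def w_def by (simp add: prod.cartesian_product split_def)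
    also have "\<dots> = (\<Prod>p\<in>insert 0 S. \<Prod>\<sigma>\<in>E. v p (ext \<sigma> (to_ac y)))"
      by (rule prod.swap)
    also have "\<dots> = (\<Prod>p\<in>insert 0 S. v p (of_rat q))"
      using vq av by (intro prod.cong) auto
    also have "\<dots> = v 0 (of_rat q) * (\<Prod>p\<in>S. wp p (of_rat q))"
    proof -
      have "(\<Prod>p\<in>S. v p (of_rat q)) = (\<Prod>p\<in>S. wp p (of_rat q))"
        using \<open>0 \<notin> S\<close> by (intro prod.cong) (auto simp: v_def)
      then show ?thesis
        using S(1) \<open>0 \<notin> S\<close> by simp
    qed
    also have "v 0 (of_rat q) = \<bar>real_of_rat q\<bar>"
    proof -
      have "comm_ring_hom complex_of_real"
        by (unfold_locales; simp)
      from comm_ring_hom_of_rat[OF this, of q] have "complex_of_real (of_rat q) = of_rat q" .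
      then have "\<iota> (of_rat q) = complex_of_real (of_rat q)"
        using comm_ring_hom_of_rat[OF \<iota>, of q] by metis
      moreover have "v 0 (of_rat q) = cmod (\<iota> (of_rat q))"
        by (simp add: v_def)
      ultimately show ?thesis
        by (simp only: norm_of_real)
    qed
    also have "\<bar>real_of_rat q\<bar> * (\<Prod>p\<in>S. wp p (of_rat q)) \<ge> 1"
    proof (rule rational_product_formula[OF wp S \<open>q \<noteq> 0\<close>])
      fix p assume p: "prime p" "p \<notin> S"
      have avp: "absval (wp p)"
        using ultra[OF p(1)] by (simp add: ultrametric_def)
      have "wp p (of_rat q) = (\<Prod>\<sigma>\<in>E. wp p (ext \<sigma> (to_ac y)))"
        by (rule vq[OF avp, symmetric])
      also have "\<dots> \<le> 1"
      proof (rule prod_le_1, rule conjI)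
        fix \<sigma> assume "\<sigma> \<in> E"
        then show "wp p (ext \<sigma> (to_ac y)) \<le> 1"
          using y(2) p by (simp add: R_def)
      qed (rule absvalD(1)[OF avp])
      finally show "wp p (of_rat q) \<le> 1" .
    qed
    finally show ?thesis .
  qed
  have kron: "\<exists>n>0. t ^ n = 1" if t: "t \<noteq> 0" "to_ac t \<in> R" "\<forall>i\<in>I. w i (to_ac t) = 1" for t :: 'k
  proof -
    define z where "z \<sigma> j = \<iota> (ext \<sigma> (to_ac (t ^ j)))" for \<sigma> j
    have wt: "v p (ext \<sigma> (to_ac (t ^ j))) = 1" if "\<sigma> \<in> E" "p \<in> insert 0 S" for \<sigma> p j
    proof -
      have i: "(\<sigma>, p) \<in> I"
        using that by (simp add: I_def)
      have "w (\<sigma>, p) (to_ac (t ^ j)) = w (\<sigma>, p) (to_ac t) ^ j"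
        using absvalD(9)[OF avw[OF i]] by simp
      moreover have "w (\<sigma>, p) (to_ac t) = 1"
        using t(3) i by blast
      ultimately have "w (\<sigma>, p) (to_ac (t ^ j)) = 1"
        by (simp only: power_one)
      then show ?thesis
        by (simp only: w_def comp_apply fst_conv snd_conv)
    qed
    have z1: "cmod (z \<sigma> j) = 1" if "\<sigma> \<in> E" for \<sigma> j
      using wt[OF that, of 0 j] by (simp add: v_def z_def)
    \<comment> \<open>Kronecker's theorem by pigeonhole: at every embedding the powers of
      \<open>t\<close> are sorted into squares of side \<open>1 / 2\<close>. Two powers in the same
      squares differ by less than one at all archimedean places and by at most one at the others, so
      the product formula makes them equal.\<close>
    define col where "col j = restrict (\<lambda>\<sigma>. (\<lfloor>2 * Re (z \<sigma> j)\<rfloor>, \<lfloor>2 * Im (z \<sigma> j)\<rfloor>)) E" for j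
    have bound: "\<lfloor>2 * x\<rfloor> \<in> {-2..2}" if "\<bar>x\<bar> \<le> 1" for x :: real
    proof -
      have "- 2 \<le> 2 * x" "2 * x \<le> 2"
        using that by linarith+
      then have "\<lfloor>-2 :: real\<rfloor> \<le> \<lfloor>2 * x\<rfloor>" "\<lfloor>2 * x\<rfloor> \<le> \<lfloor>2 :: real\<rfloor>"
        by (intro floor_mono; simp)+
      then show ?thesis
        by simp
    qed
    have "range col \<subseteq> PiE E (\<lambda>_. {-2..2} \<times> {-2..2})"
    proof (rule image_subsetI)
      fix j
      have "(\<lfloor>2 * Re (z \<sigma> j)\<rfloor>, \<lfloor>2 * Im (z \<sigma> j)\<rfloor>) \<in> {-2..2} \<times> {-2..2}" if "\<sigma> \<in> E" for \<sigma>
        using bound[of "Re (z \<sigma> j)"] bound[of "Im (z \<sigma> j)"] z1[OF that, of j]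
          abs_Re_le_cmod[of "z \<sigma> j"] abs_Im_le_cmod[of "z \<sigma> j"] by (intro SigmaI) auto
      then show "col j \<in> PiE E (\<lambda>_. {-2..2} \<times> {-2..2})"
        unfolding col_def restrict_PiE_iff by blast
    qed
    then have "finite (range col)"
      using E by (rule finite_subset[OF _ finite_PiE]) auto
    then have "\<not> inj col"
      using finite_imageD infinite_UNIV_nat by blast
    then obtain i j where "i \<noteq> j" "col i = col j"
      by (auto simp: inj_def)
    then obtain i j where ij: "i < j" "col i = col j"
      by (metis linorder_neqE_nat)
    define y where "y = t ^ j - t ^ i"
    have yR: "to_ac y \<in> R"
      unfolding y_def to_ac_diff to_ac_power using t(2) by (intro is_subringD[OF subring])
    have arch: "cmod (\<iota> (ext \<sigma> (to_ac y))) < 1" if \<sigma>: "\<sigma> \<in> E" for \<sigma>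
    proof -
      interpret e: comm_ring_hom "ext \<sigma>" using ext(1)[OF \<sigma>] .
      interpret \<iota>: comm_ring_hom \<iota> by (rule \<iota>)
      have eq: "\<iota> (ext \<sigma> (to_ac y)) = z \<sigma> j - z \<sigma> i"
        by (simp add: y_def z_def e.hom_minus \<iota>.hom_minus)
      have "\<lfloor>2 * Re (z \<sigma> i)\<rfloor> = \<lfloor>2 * Re (z \<sigma> j)\<rfloor>" "\<lfloor>2 * Im (z \<sigma> i)\<rfloor> = \<lfloor>2 * Im (z \<sigma> j)\<rfloor>"
        using fun_cong[OF ij(2), of \<sigma>] \<sigma> by (simp_all add: col_def)
      then have "\<bar>2 * Re (z \<sigma> j) - 2 * Re (z \<sigma> i)\<bar> < 1" "\<bar>2 * Im (z \<sigma> j) - 2 * Im (z \<sigma> i)\<bar> < 1"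
        by linarith+
      then have "\<bar>Re (z \<sigma> j - z \<sigma> i)\<bar> + \<bar>Im (z \<sigma> j - z \<sigma> i)\<bar> < 1"
        by simp
      then show ?thesis
        unfolding eq using cmod_le[of "z \<sigma> j - z \<sigma> i"] by linarith
    qed
    have nonarch: "wp p (ext \<sigma> (to_ac y)) \<le> 1" if "\<sigma> \<in> E" "p \<in> S" for \<sigma> p
    proof -
      have p: "prime p" "p \<noteq> 0"
        using S(2)[OF that(2)] by auto
      have "(wp p \<circ> ext \<sigma>) (to_ac (t ^ k)) \<le> 1" for k
        using wt[OF that(1), of p k] that(2) p(2) by (simp add: v_def)
      then have "to_ac (t ^ j) - to_ac (t ^ i) \<in> {x. (wp p \<circ> ext \<sigma>) x \<le> 1}"
        by (intro is_subringD(6)[OF ultrametric_subring[OF ultra_ext[OF p(1) that(1)]]]) auto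
      then show ?thesis
        by (simp add: y_def)
    qed
    have "y = 0"
    proof (rule ccontr)
      assume "y \<noteq> 0"
      have I: "finite I" "(to_ac, 0) \<in> I"
        using E S(1) \<open>to_ac \<in> E\<close> by (auto simp: I_def)
      have le: "w i (to_ac y) \<le> 1" if "i \<in> I" for i
        using that arch nonarch \<open>0 \<notin> S\<close> unfolding I_def w_def v_def
        by (auto simp: less_imp_le)
      have "(\<Prod>i\<in>I. w i (to_ac y)) = w (to_ac, 0) (to_ac y) * (\<Prod>i\<in>I - {(to_ac, 0)}. w i (to_ac y))"
        using I by (rule prod.remove)
      also have "\<dots> \<le> w (to_ac, 0) (to_ac y) * 1"
        using le absvalD(1)[OF avw] I(2) by (intro mult_left_mono prod_le_1) simp_all
      also have "\<dots> < 1"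
        using arch[OF \<open>to_ac \<in> E\<close>] by (simp add: w_def v_def)
      finally show False
        using prod[OF \<open>y \<noteq> 0\<close> yR] by simp
    qed
    then have "t ^ i * t ^ (j - i) = t ^ i * 1"
      using ij(1) by (simp add: y_def flip: power_add)
    then show ?thesis
      using t(1) ij(1) by (intro exI[of _ "j - i"]) simp
  qed
  have "finite I"
    using E S(1) by (simp add: I_def)
  then show ?thesis
    using avw subring \<open>Y \<subseteq> R\<close> closed prod kron by blast
qed

section \<open>Regular differentials on a smooth plane curve\<close>

text \<open>Coefficients are sent to an arbitrary ring by \<open>h\<close>. One notion thus covers
  values in the closure, in polynomials and in power or Laurent series, and homomorphisms carry
  identities from one to another.\<close>

definition eval3 :: "('k \<Rightarrow> 'r::comm_ring_1) \<Rightarrow> 'k::comm_ring_1 ternary \<Rightarrow> 'r \<Rightarrow> 'r \<Rightarrow> 'r \<Rightarrow> 'r" where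
  "eval3 h F x y z = (\<Sum>m\<in>Poly_Mapping.keys F. h (Poly_Mapping.lookup F m) *
     (x ^ Poly_Mapping.lookup m 1 * y ^ Poly_Mapping.lookup m 2 * z ^ Poly_Mapping.lookup m 3))"

lemma UNIV_3_prod: "(\<Prod>i\<in>(UNIV :: 3 set). f i) = f 1 * f 2 * (f 3 :: 'a::comm_monoid_mult)"
  unfolding UNIV_3 by (simp add: mult.assoc)

lemma UNIV_3_sum: "(\<Sum>i\<in>(UNIV :: 3 set). f i) = f 1 + f 2 + (f 3 :: 'a::comm_monoid_add)"
  unfolding UNIV_3 by (simp add: add.assoc)

lemma eval_ac_eval3: "eval_ac F v = eval3 to_ac F (vec_nth v 1) (vec_nth v 2) (vec_nth v 3)"
  by (simp add: eval_ac_def eval3_def UNIV_3_prod)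

lemma eval3_superset:
  assumes "finite S" "Poly_Mapping.keys F \<subseteq> S" "h 0 = 0"
  shows "eval3 h F x y z = (\<Sum>m\<in>S. h (Poly_Mapping.lookup F m) *
     (x ^ Poly_Mapping.lookup m 1 * y ^ Poly_Mapping.lookup m 2 * z ^ Poly_Mapping.lookup m 3))"
  unfolding eval3_def using assms
  by (intro sum.mono_neutral_left) (auto simp: in_keys_iff)

lemma eval3_add:
  assumes "comm_ring_hom h"
  shows "eval3 h (F + G) x y z = eval3 h F x y z + eval3 h G x y z"
proof -
  interpret comm_ring_hom h by fact
  let ?S = "Poly_Mapping.keys F \<union> Poly_Mapping.keys G"
  have sub: "Poly_Mapping.keys (F + G) \<subseteq> ?S"
    by (rule keys_add)
  show ?thesis
    using eval3_superset[OF _ sub, of h] eval3_superset[of ?S F h] eval3_superset[of ?S G h]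
    by (simp add: lookup_add hom_add distrib_right sum.distrib)
qed

lemma eval3_zero [simp]: "eval3 h 0 x y z = 0"
  by (simp add: eval3_def)

lemma eval3_sum:
  assumes "comm_ring_hom h"
  shows "eval3 h (\<Sum>i\<in>A. G i) x y z = (\<Sum>i\<in>A. eval3 h (G i) x y z)"
  by (induction A rule: infinite_finite_induct) (simp_all add: eval3_add[OF assms])

lemma eval3_single:
  assumes "h 0 = 0"
  shows "eval3 h (Poly_Mapping.single m c) x y z =
    h c * (x ^ Poly_Mapping.lookup m 1 * y ^ Poly_Mapping.lookup m 2 * z ^ Poly_Mapping.lookup m 3)"
  using eval3_superset[of "{m}" "Poly_Mapping.single m c" h] assms by simp

lemma eval3_partial:
  assumes "comm_ring_hom h"
  shows "eval3 h (partial i F) x y z = (\<Sum>m\<in>Poly_Mapping.keys F.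
     of_nat (Poly_Mapping.lookup m i) * h (Poly_Mapping.lookup F m) *
     (x ^ (Poly_Mapping.lookup m 1 - (if i = 1 then 1 else 0)) *
      y ^ (Poly_Mapping.lookup m 2 - (if i = 2 then 1 else 0)) *
      z ^ (Poly_Mapping.lookup m 3 - (if i = 3 then 1 else 0))))"
proof -
  interpret comm_ring_hom h by fact
  show ?thesis
    unfolding partial_def eval3_sum[OF assms]
    by (simp add: eval3_single lookup_minus lookup_single when_def hom_mult hom_of_nat if_distrib
        cong: if_cong)
qed

lemma eval3_hom:
  assumes "comm_ring_hom \<phi>"
  shows "\<phi> (eval3 h F x y z) = eval3 (\<phi> \<circ> h) F (\<phi> x) (\<phi> y) (\<phi> z)"
proof -
  interpret comm_ring_hom \<phi> by fact
  show ?thesis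
    unfolding eval3_def hom_sum by (rule sum.cong) (simp_all add: hom_mult hom_power)
qed

lemma euler_monomial:
  fixes x :: "'a::comm_ring_1"
  shows "x * (of_nat k * c * (x ^ (k - Suc 0) * B * C)) = of_nat k * (c * (x ^ k * B * C))"
    "x * (of_nat k * c * (A * x ^ (k - Suc 0) * C)) = of_nat k * (c * (A * x ^ k * C))"
    "x * (of_nat k * c * (A * B * x ^ (k - Suc 0))) = of_nat k * (c * (A * B * x ^ k))"
  by (cases k; simp add: mult_ac)+

lemma eval3_euler:
  assumes "comm_ring_hom h" "homogeneous d F"
  shows "x * eval3 h (partial 1 F) x y z + y * eval3 h (partial 2 F) x y z +
    z * eval3 h (partial 3 F) x y z = of_nat d * eval3 h F x y z"
proof -
  let ?c = "\<lambda>m. h (Poly_Mapping.lookup F m)" and ?l = "Poly_Mapping.lookup :: (3 \<Rightarrow>\<^sub>0 nat) \<Rightarrow> _"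
  have 1: "x * eval3 h (partial 1 F) x y z =
     (\<Sum>m\<in>Poly_Mapping.keys F. of_nat (?l m 1) * (?c m * (x ^ ?l m 1 * y ^ ?l m 2 * z ^ ?l m 3)))"
    unfolding eval3_partial[OF assms(1)] sum_distrib_left
    by (rule sum.cong) (simp_all add: euler_monomial)
  have 2: "y * eval3 h (partial 2 F) x y z =
     (\<Sum>m\<in>Poly_Mapping.keys F. of_nat (?l m 2) * (?c m * (x ^ ?l m 1 * y ^ ?l m 2 * z ^ ?l m 3)))"
    unfolding eval3_partial[OF assms(1)] sum_distrib_left
    by (rule sum.cong) (simp_all add: euler_monomial)
  have 3: "z * eval3 h (partial 3 F) x y z =
     (\<Sum>m\<in>Poly_Mapping.keys F. of_nat (?l m 3) * (?c m * (x ^ ?l m 1 * y ^ ?l m 2 * z ^ ?l m 3)))"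
    unfolding eval3_partial[OF assms(1)] sum_distrib_left
    by (rule sum.cong) (simp_all add: euler_monomial)
  have d: "of_nat (?l m 1) + of_nat (?l m 2) + of_nat (?l m 3) = (of_nat d :: 'b)"
    if "m \<in> Poly_Mapping.keys F" for m
    using assms(2) that unfolding homogeneous_def UNIV_3_sum by (metis of_nat_add)
  show ?thesis
    unfolding 1 2 3 sum.distrib[symmetric] distrib_right[symmetric]
    unfolding eval3_def sum_distrib_left by (rule sum.cong) (simp_all add: d)
qed

lemma eval3_scale:
  assumes "homogeneous d F"
  shows "eval3 h F (g * x) (g * y) (g * z) = g ^ d * eval3 h F x y z"
  unfolding eval3_def sum_distrib_left
proof (rule sum.cong)
  fix m assume "m \<in> Poly_Mapping.keys F"
  then have "d = Poly_Mapping.lookup m 1 + Poly_Mapping.lookup m 2 + Poly_Mapping.lookup m 3"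
    using assms unfolding homogeneous_def UNIV_3_sum by metis
  then show "h (Poly_Mapping.lookup F m) * ((g * x) ^ Poly_Mapping.lookup m 1 *
      (g * y) ^ Poly_Mapping.lookup m 2 * (g * z) ^ Poly_Mapping.lookup m 3) =
      g ^ d * (h (Poly_Mapping.lookup F m) * (x ^ Poly_Mapping.lookup m 1 *
      y ^ Poly_Mapping.lookup m 2 * z ^ Poly_Mapping.lookup m 3))"
    by (simp add: power_mult_distrib power_add mult_ac)
qed simp

lemma homogeneous_partial:
  assumes "homogeneous d (F :: 'k::field_char_0 ternary)"
  shows "homogeneous (d - 1) (partial i F)"
  unfolding homogeneous_def
proof
  fix m assume "m \<in> Poly_Mapping.keys (partial i F)"
  then have "m \<in> (\<Union>n\<in>Poly_Mapping.keys F. Poly_Mapping.keys (Poly_Mapping.single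
      (n - Poly_Mapping.single i 1) (of_nat (Poly_Mapping.lookup n i) * Poly_Mapping.lookup F n)))"
    unfolding partial_def using keys_sum subsetD by fastforce
  then obtain n where n: "n \<in> Poly_Mapping.keys F"
    "m \<in> Poly_Mapping.keys (Poly_Mapping.single (n - Poly_Mapping.single i 1)
        (of_nat (Poly_Mapping.lookup n i) * Poly_Mapping.lookup F n))"
    by (elim UN_E)
  then have m: "m = n - Poly_Mapping.single i 1" "Poly_Mapping.lookup n i \<noteq> 0"
    by (auto split: if_splits)
  have "(\<Sum>j\<in>UNIV. Poly_Mapping.lookup n j) = Poly_Mapping.lookup n i + (\<Sum>j\<in>UNIV - {i}.
      Poly_Mapping.lookup n j)"
    by (rule sum.remove) auto
  moreover have "(\<Sum>j\<in>UNIV. Poly_Mapping.lookup m j)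
      = Poly_Mapping.lookup m i + (\<Sum>j\<in>UNIV - {i}. Poly_Mapping.lookup m j)"
    by (rule sum.remove) auto
  moreover have "(\<Sum>j\<in>UNIV - {i}. Poly_Mapping.lookup m j)
      = (\<Sum>j\<in>UNIV - {i}. Poly_Mapping.lookup n j)"
    unfolding m by (rule sum.cong) (auto simp: lookup_minus lookup_single when_def)
  moreover have "(\<Sum>j\<in>UNIV. Poly_Mapping.lookup n j) = d"
    using assms n(1) unfolding homogeneous_def by blast
  moreover have "Poly_Mapping.lookup m i = Poly_Mapping.lookup n i - 1"
    unfolding m by (simp add: lookup_minus lookup_single)
  ultimately show "(\<Sum>j\<in>UNIV. Poly_Mapping.lookup m j) = d - 1"
    using m(2) by linarith
qed

text \<open>The chain rule for any derivation that kills the coefficients; it serves both for power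
  series and for polynomials.\<close>

lemma eval3_deriv:
  fixes h :: "'k::comm_ring_1 \<Rightarrow> 'r::comm_ring_1" and D :: "'r \<Rightarrow> 'r"
  assumes h: "comm_ring_hom h" and D: "\<And>a b. D (a + b) = D a + D b" "\<And>a b. D (a * b)
      = D a * b + a * D b"
    and Dh: "\<And>c. D (h c) = 0"
  shows "D (eval3 h F x y z) = eval3 h (partial 1 F) x y z * D x + eval3 h (partial 2 F) x y z * D y
    + eval3 h (partial 3 F) x y z * D z"
proof -
  have D0: "D 0 = 0"
    using D(1)[of 0 0] by simp
  have D1: "D 1 = 0"
    using D(2)[of 1 1] by simp
  have Dsum: "D (\<Sum>i\<in>A. f i) = (\<Sum>i\<in>A. D (f i))" for f :: "(3 \<Rightarrow>\<^sub>0 nat) \<Rightarrow> 'r" and A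
    by (induction A rule: infinite_finite_induct) (simp_all add: D0 D(1))
  have Dpow: "D (a ^ n) = of_nat n * a ^ (n - 1) * D a" for a n
  proof (induction n)
    case (Suc n)
    then show ?case
      by (cases n) (simp_all add: D(2) D1 algebra_simps)
  qed (simp add: D1)
  show ?thesis
    unfolding eval3_partial[OF h] sum_distrib_right sum.distrib[symmetric]
    unfolding eval3_def Dsum
    by (rule sum.cong) (simp_all add: D(2) Dh Dpow algebra_simps)
qed

section \<open>Regularity of differentials along Laurent series arcs\<close>

interpretation fls_const_hom: comm_ring_hom "fls_const :: 'a::comm_ring_1 \<Rightarrow> _"
  by unfold_locales (simp_all add: fls_plus_const)

interpretation fps_const_hom: comm_ring_hom "fps_const :: 'a::comm_ring_1 \<Rightarrow> _"
  by unfold_locales simp_all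

interpretation fps_to_fls_hom: comm_ring_hom "fps_to_fls :: 'a::comm_ring_1 fps \<Rightarrow> _"
  by unfold_locales (simp_all add: fls_times_fps_to_fls)

interpretation fps_nth_0_hom: comm_ring_hom "\<lambda>f :: 'a::comm_ring_1 fps. fps_nth f 0"
  by unfold_locales simp_all

interpretation to_ac_hom: comm_ring_hom "to_ac :: 'a::field \<Rightarrow> _"
  by unfold_locales simp_all

lemma comm_ring_hom_comp:
  assumes "comm_ring_hom f" "comm_ring_hom g"
  shows "comm_ring_hom (f \<circ> g)"
proof -
  interpret f: comm_ring_hom f by fact
  interpret g: comm_ring_hom g by fact
  show ?thesis
    by unfold_locales (simp_all add: f.hom_add g.hom_add f.hom_mult g.hom_mult)
qed

text \<open>
  Along an arc \<open>P = (\<Psi> : 1 : \<zeta>)\<close> on the curve, \<open>P \<times> P'\<close> is a multiple of the gradient of \<open>F\<close>,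
  and smoothness makes the factor regular once \<open>P\<close> is rescaled to a primitive vector; this is the
  regularity of the holomorphic differentials of the curve.
\<close>

lemma cross_product_multiple_of_gradient:
  fixes a b c :: "'a::field fps" and G1 G2 G3 :: "'a fps"
  assumes E: "a * G1 + b * G2 + c * G3 = 0"
    and D: "G1 * fps_deriv a + G2 * fps_deriv b + G3 * fps_deriv c = 0"
    and G: "fps_nth G1 0 \<noteq> 0 \<or> fps_nth G2 0 \<noteq> 0 \<or> fps_nth G3 0 \<noteq> 0"
  shows "\<exists>l. a * fps_deriv b - b * fps_deriv a = G3 * l"
proof -
  define a' b' c' where "a' = fps_deriv a" and "b' = fps_deriv b" and "c' = fps_deriv c"
  have "(a * b' - b * a') * G1 = G3 * (b * c' - c * b')"
  proof -
    have "(a * b' - b * a') * G1 - G3 * (b * c' - c * b') =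
       b' * (a * G1 + b * G2 + c * G3) - b * (G1 * a' + G2 * b' + G3 * c')"
      by (simp add: algebra_simps)
    then show ?thesis
      using E D by (simp add: a'_def b'_def c'_def)
  qed
  moreover have "(a * b' - b * a') * G2 = G3 * (c * a' - a * c')"
  proof -
    have "(a * b' - b * a') * G2 - G3 * (c * a' - a * c') =
       a * (G1 * a' + G2 * b' + G3 * c') - a' * (a * G1 + b * G2 + c * G3)"
      by (simp add: algebra_simps)
    then show ?thesis
      using E D by (simp add: a'_def b'_def c'_def)
  qed
  moreover have "(a * b' - b * a') * G3 = G3 * (a * b' - b * a')"
    by (simp add: mult.commute)
  ultimately obtain G w where "fps_nth G 0 \<noteq> 0" "(a * b' - b * a') * G = G3 * w"
    using G by blast
  then have "a * b' - b * a' = G3 * (w * inverse G)"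
    by (metis (no_types, opaque_lifting) inverse_mult_eq_1' mult.assoc mult.right_neutral)
  then show ?thesis
    unfolding a'_def b'_def by blast
qed

lemma fls_shift_to_fps:
  fixes f :: "'a::field fls"
  assumes "int k \<ge> - fls_subdegree f"
  shows "\<exists>a. fps_to_fls a = fls_X ^ k * f"
    and "f \<noteq> 0 \<Longrightarrow> int k = - fls_subdegree f \<Longrightarrow> fps_to_fls a = fls_X ^ k * f \<Longrightarrow> fps_nth a 0 \<noteq> 0"
proof -
  have "fls_subdegree (fls_X ^ k * f) \<ge> 0"
    using assms by (cases "f = 0") simp_all
  then show "\<exists>a. fps_to_fls a = fls_X ^ k * f"
    by (metis fls_regpart_as_fls_nth fls_regpart_to_fls_trivial)
next
  assume "f \<noteq> 0" "int k = - fls_subdegree f" and a: "fps_to_fls a = fls_X ^ k * f"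
  then have "fls_subdegree (fps_to_fls a) = 0" "fps_to_fls a \<noteq> 0"
    by simp_all
  then have "subdegree a = 0" "a \<noteq> 0"
    by (auto simp: fls_subdegree_fls_to_fps)
  then show "fps_nth a 0 \<noteq> 0"
    using subdegree_eq_0_iff by blast
qed

text \<open>\<open>k\<close> is the largest pole order among the coordinates \<open>\<Psi>\<close>,
  \<open>1\<close>, \<open>\<zeta>\<close>. It clears all poles and leaves a coordinate with nonzero
  constant term, so the reduction at \<open>X = 0\<close> is a point of the projective
  plane.\<close>

lemma primitive_rescaling:
  fixes \<Psi> \<zeta> :: "'a::field fls"
  obtains k a b c where "fps_to_fls a = fls_X ^ k * \<Psi>" "fps_to_fls b = (fls_X ^ k :: 'a fls)"
    "fps_to_fls c = fls_X ^ k * \<zeta>" "fps_nth a 0 \<noteq> 0 \<or> fps_nth b 0 \<noteq> 0 \<or> fps_nth c 0 \<noteq> 0"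
proof -
  define k where "k = nat (max 0 (max (- fls_subdegree \<Psi>) (- fls_subdegree \<zeta>)))"
  have k: "int k \<ge> - fls_subdegree \<Psi>" "int k \<ge> - fls_subdegree \<zeta>"
    by (auto simp: k_def)
  obtain a c where ac: "fps_to_fls a = fls_X ^ k * \<Psi>" "fps_to_fls c = fls_X ^ k * \<zeta>"
    using fls_shift_to_fps(1)[OF k(1)] fls_shift_to_fps(1)[OF k(2)] by blast
  have b: "fps_to_fls (fps_X ^ k) = (fls_X ^ k :: 'a fls)"
    by (simp add: fps_to_fls_power)
  consider "k = 0" | "k > 0" "int k = - fls_subdegree \<Psi>" | "k > 0" "int k = - fls_subdegree \<zeta>"
    unfolding k_def by linarith
  then have "fps_nth a 0 \<noteq> 0 \<or> fps_nth (fps_X ^ k :: 'a fps) 0 \<noteq> 0 \<or> fps_nth c 0 \<noteq> 0"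
  proof cases
    case 2
    then have "\<Psi> \<noteq> 0"
      by auto
    then show ?thesis
      using fls_shift_to_fps(2)[OF k(1)] 2 ac by blast
  next
    case 3
    then have "\<zeta> \<noteq> 0"
      by auto
    then show ?thesis
      using fls_shift_to_fps(2)[OF k(2)] 3 ac by blast
  qed simp
  with that ac b show thesis
    by blast
qed

definition smooth3 :: "'k::field ternary \<Rightarrow> bool" where
  "smooth3 F \<longleftrightarrow> (\<forall>x y z. (x, y, z) \<noteq> (0, 0, 0) \<longrightarrow> eval3 to_ac F x y z = 0 \<longrightarrow>
     eval3 to_ac (partial 1 F) x y z \<noteq> 0 \<or> eval3 to_ac (partial 2 F) x y z \<noteq> 0 \<or>
     eval3 to_ac (partial 3 F) x y z \<noteq> 0)"

lemma smooth_plane_curve_smooth3: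
  assumes "smooth_plane_curve d F"
  shows "smooth3 F"
  unfolding smooth3_def
proof (intro allI impI)
  fix x y z assume xyz: "(x, y, z) \<noteq> (0, 0, 0)" and 0: "eval3 to_ac F x y z = 0"
  define v :: "'a alg_closure ^ 3" where "v = vector [x, y, z]"
  have v: "vec_nth v 1 = x" "vec_nth v 2 = y" "vec_nth v 3 = z"
    by (simp_all add: v_def vector_3)
  have "v \<noteq> 0"
    using xyz v by auto
  moreover have "eval_ac F v = 0"
    using 0 by (simp add: eval_ac_eval3 v)
  ultimately obtain i where "eval_ac (partial i F) v \<noteq> 0"
    using assms unfolding smooth_plane_curve_def by blast
  then show "eval3 to_ac (partial 1 F) x y z \<noteq> 0 \<or> eval3 to_ac (partial 2 F) x y z \<noteq> 0 \<or>
     eval3 to_ac (partial 3 F) x y z \<noteq> 0"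
    using exhaust_3[of i] by (auto simp: eval_ac_eval3 v)
qed

text \<open>The origin of \<open>d \<ge> 4\<close>: rescaling by \<open>X^k\<close> multiplies
  \<open>F_Z\<close> by \<open>X^(k * (d - 1))\<close> and the cross product by
  \<open>X^(2 * k)\<close>, so the quotient \<open>\<Psi>' / F_Z\<close> is divisible by
  \<open>X^(k * (d - 3))\<close>. Multiplication with \<open>\<zeta>\<close> costs a pole of order
  at most \<open>k\<close>.\<close>

theorem regular_differentials:
  fixes F :: "'k::field_char_0 ternary" and \<Psi> \<zeta> :: "'k alg_closure fls"
  defines "h \<equiv> fls_const \<circ> to_ac"
  defines "FZ \<equiv> eval3 h (partial 3 F) \<Psi> 1 \<zeta>"
  assumes F: "homogeneous d F" "d \<ge> 4" "smooth3 F" and on: "eval3 h F \<Psi> 1 \<zeta> = 0"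
    and \<Psi>': "fls_deriv \<Psi> \<noteq> 0"
  shows "FZ \<noteq> 0" "\<exists>f. fls_deriv \<Psi> / FZ = fps_to_fls f" "\<exists>f. \<zeta> * fls_deriv \<Psi> / FZ = fps_to_fls f"
proof -
  obtain k a b c where abc: "fps_to_fls a = fls_X ^ k * \<Psi>" "fps_to_fls b
      = (fls_X ^ k :: 'k alg_closure fls)"
    "fps_to_fls c = fls_X ^ k * \<zeta>" and prim: "fps_nth a 0 \<noteq> 0 \<or> fps_nth b 0 \<noteq> 0 \<or> fps_nth c 0 \<noteq> 0"
    by (rule primitive_rescaling[of \<Psi> \<zeta>])
  define hp where "hp = (fps_const \<circ> to_ac :: 'k \<Rightarrow> 'k alg_closure fps)"
  have hp: "comm_ring_hom hp" and h: "comm_ring_hom h"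
    unfolding hp_def h_def
    by (intro comm_ring_hom_comp fps_const_hom.comm_ring_hom_axioms
        fls_const_hom.comm_ring_hom_axioms
        to_ac_hom.comm_ring_hom_axioms)+
  have hh: "fps_to_fls \<circ> hp = h"
    by (auto simp: hp_def h_def)
  have to_fls: "fps_to_fls (eval3 hp G a b c)
      = eval3 h G (fls_X ^ k * \<Psi>) (fls_X ^ k * 1) (fls_X ^ k * \<zeta>)" for G
    unfolding eval3_hom[OF fps_to_fls_hom.comm_ring_hom_axioms] hh abc by simp
  have "fps_to_fls (eval3 hp F a b c) = 0"
    unfolding to_fls eval3_scale[OF F(1)] on by simp
  then have F0: "eval3 hp F a b c = 0"
    by simp
  have nth0: "fps_nth (eval3 hp G a b c) 0 = eval3 to_ac G (fps_nth a 0) (fps_nth b 0) (fps_nth c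
      0)" for G
    using eval3_hom[OF fps_nth_0_hom.comm_ring_hom_axioms, of hp G a b c]
    by (simp add: hp_def comp_def)
  define G where "G i = eval3 hp (partial i F) a b c" for i
  have "eval3 to_ac F (fps_nth a 0) (fps_nth b 0) (fps_nth c 0) = 0"
    using F0 nth0[of F] by simp
  then have "fps_nth (G 1) 0 \<noteq> 0 \<or> fps_nth (G 2) 0 \<noteq> 0 \<or> fps_nth (G 3) 0 \<noteq> 0"
    using F(3) prim unfolding smooth3_def G_def nth0 by blast
  moreover have "a * G 1 + b * G 2 + c * G 3 = 0"
    using eval3_euler[OF hp F(1), of a b c] F0 by (simp add: G_def)
  moreover have "G 1 * fps_deriv a + G 2 * fps_deriv b + G 3 * fps_deriv c = 0"
    using eval3_deriv[OF hp, of fps_deriv F a b c] F0 by (simp add: G_def hp_def)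
  ultimately obtain l where l: "a * fps_deriv b - b * fps_deriv a = G 3 * l"
    using cross_product_multiple_of_gradient by blast
  define Xf where "Xf = (fls_X :: 'k alg_closure fls)"
  have Xf0: "Xf \<noteq> 0"
    by (simp add: Xf_def)
  have G3: "fps_to_fls (G 3) = Xf ^ (k * (d - 1)) * FZ"
    unfolding G_def to_fls eval3_scale[OF homogeneous_partial[OF F(1)]] FZ_def
    by (simp add: Xf_def power_mult)
  have "fps_to_fls (a * fps_deriv b - b * fps_deriv a) = - (Xf ^ (2 * k) * fls_deriv \<Psi>)"
  proof -
    have "fps_to_fls (a * fps_deriv b - b * fps_deriv a) =
       (Xf ^ k * \<Psi>) * fls_deriv (Xf ^ k) - Xf ^ k * fls_deriv (Xf ^ k * \<Psi>)"
      by (simp add: fps_to_fls_hom.hom_minus fps_to_fls_hom.hom_mult flip: fls_deriv_fps_to_fls)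
        (simp add: abc Xf_def)
    also have "\<dots> = - (Xf ^ k * Xf ^ k * fls_deriv \<Psi>)"
      by (simp add: algebra_simps)
    finally show ?thesis
      by (simp add: power_add[symmetric] mult_2)
  qed
  then have key: "- (Xf ^ (2 * k) * fls_deriv \<Psi>) = Xf ^ (k * (d - 1)) * FZ * fps_to_fls l"
    unfolding l by (simp add: fps_to_fls_hom.hom_mult G3)
  show FZ: "FZ \<noteq> 0"
    using key \<Psi>' Xf0 by auto
  define e where "e = k * (d - 4)"
  obtain j where j: "d = 4 + j"
    using F(2) le_Suc_ex by blast
  have "k * (d - 1) = 2 * k + (k + e)"
    by (simp add: e_def j algebra_simps)
  then have pow: "Xf ^ (k * (d - 1)) = Xf ^ (2 * k) * Xf ^ (k + e)"
    by (simp only: power_add)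
  have "Xf ^ (2 * k) * fls_deriv \<Psi> = - (Xf ^ (k * (d - 1)) * FZ * fps_to_fls l)"
    using key by (metis minus_minus)
  also have "\<dots> = Xf ^ (2 * k) * (- (Xf ^ (k + e) * FZ * fps_to_fls l))"
    unfolding pow by (simp only: mult.assoc mult_minus_right)
  finally have "Xf ^ (2 * k) * fls_deriv \<Psi> = Xf ^ (2 * k) * (- (Xf ^ (k + e) * FZ * fps_to_fls l))"
      .
  then have "fls_deriv \<Psi> = - (Xf ^ (k + e) * FZ * fps_to_fls l)"
    using Xf0 by (metis mult_left_cancel power_not_zero)
  then have lam: "fls_deriv \<Psi> / FZ = - (Xf ^ (k + e) * fps_to_fls l)"
    using FZ by (simp add: field_simps)
  then have "fls_deriv \<Psi> / FZ = fps_to_fls (- (fps_X ^ (k + e) * l))"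
    by (simp add: Xf_def fls_times_fps_to_fls fps_to_fls_power)
  then show "\<exists>f. fls_deriv \<Psi> / FZ = fps_to_fls f"
    by blast
  have "\<zeta> * fls_deriv \<Psi> / FZ = - (Xf ^ e * (Xf ^ k * \<zeta>) * fps_to_fls l)"
    using lam by (simp add: power_add mult_ac times_divide_eq_right[symmetric] del:
        times_divide_eq_right)
  also have "\<dots> = fps_to_fls (- (fps_X ^ e * c * l))"
    by (simp add: Xf_def abc fls_times_fps_to_fls fps_to_fls_power)
  finally show "\<exists>f. \<zeta> * fls_deriv \<Psi> / FZ = fps_to_fls f"
    by blast
qed

section \<open>Differentials on the projective line at doubly ramified parameters\<close>

definition laurent_eval :: "'a::field fls \<Rightarrow> 'a poly \<Rightarrow> 'a fls" where
  "laurent_eval U p = poly (map_poly fls_const p) U"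

interpretation laurent_eval_hom: comm_ring_hom "laurent_eval U"
proof -
  interpret map_poly_comm_ring_hom "fls_const :: 'a \<Rightarrow> _"
    by (rule map_poly_comm_ring_hom.intro) (rule fls_const_hom.comm_ring_hom_axioms)
  show "comm_ring_hom (laurent_eval U)"
    unfolding laurent_eval_def by unfold_locales (simp_all add: hom_add hom_mult)
qed

lemma laurent_eval_pCons [simp]: "laurent_eval U (pCons a p) = fls_const a + U * laurent_eval U p"
  unfolding laurent_eval_def by (simp add: fls_const_hom.map_poly_pCons_hom)

lemma laurent_eval_deriv: "fls_deriv (laurent_eval U p) = laurent_eval U (pderiv p) * fls_deriv U"
  by (induction p) (simp_all add: pderiv_pCons laurent_eval_hom.hom_add algebra_simps)

text \<open>
  Local parameters at the points over \<open>u = u\<^sub>0\<close> and \<open>u = \<infinity>\<close> of any double cover of the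
  \<open>u\<close>-line.
\<close>

definition double_parameter :: "'a::field fls \<Rightarrow> bool" where
  "double_parameter U \<longleftrightarrow> (\<exists>u0. U = fls_const u0 + fls_X ^ 2) \<or> U = fls_X_inv ^ 2"

lemma fps_square_root:
  fixes f :: "'a::{alg_closed_field, field_char_0} fps"
  assumes "fps_nth f 0 \<noteq> 0"
  shows "\<exists>g. f = g * g"
proof -
  obtain y where "y ^ 2 = fps_nth f 0"
    using nth_root_exists[of 2] by auto
  then have "(fps_radical (\<lambda>_ _. y) (Suc 1) f) ^ Suc 1 = f"
    using power_radical[OF assms, of "\<lambda>_ _. y" 1] by (simp add: power2_eq_square)
  then show ?thesis
    by (metis One_nat_def power_Suc power_one_right)
qed

text \<open>Centred at \<open>a\<close> the difference is the square of the parameter. Elsewhere it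
  is a unit, at infinity up to \<open>X^(-2)\<close>, and units of the power series ring have square
  roots because constants have them and the characteristic is zero.\<close>

lemma double_parameter_linear_square:
  fixes U :: "'a::{alg_closed_field, field_char_0} fls"
  assumes "double_parameter U"
  shows "\<exists>S. S \<noteq> 0 \<and> U - fls_const a = S * S"
proof -
  consider u0 where "U = fls_const u0 + fls_X ^ 2" | "U = fls_X_inv ^ 2"
    using assms unfolding double_parameter_def by blast
  then show ?thesis
  proof cases
    case 1
    show ?thesis
    proof (cases "u0 = a")
      case True
      then show ?thesis
        using 1 by (intro exI[of _ fls_X]) (simp add: power2_eq_square)
    next
      case False
      define f where "f = fps_const (u0 - a) + fps_X ^ 2"
      have f0: "fps_nth f 0 \<noteq> 0"
        using False by (simp add: f_def)
      then obtain g where g: "f = g * g"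
        using fps_square_root by blast
      have "U - fls_const a = fps_to_fls f"
        unfolding 1 f_def by (simp add: fps_to_fls_hom.hom_add fps_to_fls_power fls_minus_const)
      then show ?thesis
        using g f0 by (intro exI[of _ "fps_to_fls g"]) (auto simp: fls_times_fps_to_fls)
    qed
  next
    case 2
    define f where "f = 1 - fps_const a * fps_X ^ 2"
    have f0: "fps_nth f 0 \<noteq> 0"
      by (simp add: f_def)
    then obtain g where g: "f = g * g"
      using fps_square_root by blast
    have X: "fls_X_inv * fls_X = (1 :: 'a fls)"
      by (rule fls_eqI) (auto simp: fls_X_inv_times_conv_shift)
    have "fps_to_fls f = 1 - fls_const a * fls_X ^ 2"
      unfolding f_def by (simp add: fps_to_fls_hom.hom_minus fps_to_fls_hom.hom_mult
          fps_to_fls_power)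
    then have "fls_X_inv ^ 2 * fps_to_fls f = fls_X_inv ^ 2 - fls_const a * (fls_X_inv * fls_X) ^ 2"
      by (simp only: right_diff_distrib power_mult_distrib mult_1_right mult.left_commute)
    then have "U - fls_const a = (fls_X_inv * fps_to_fls g) * (fls_X_inv * fps_to_fls g)"
      unfolding 2 X by (simp add: g fls_times_fps_to_fls power2_eq_square mult_ac)
    moreover have "fls_X_inv * fps_to_fls g \<noteq> 0"
      using g f0 by auto
    ultimately show ?thesis
      by blast
  qed
qed

text \<open>This makes the quadratic formula available: for any nonzero discriminant over the
  \<open>u\<close>-line, both roots are Laurent series in such a parameter.\<close>

lemma laurent_eval_square:
  fixes U :: "'a::{alg_closed_field, field_char_0} fls"
  assumes "double_parameter U" "p \<noteq> 0"
  shows "\<exists>S. S \<noteq> 0 \<and> laurent_eval U p = S * S"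
proof -
  obtain A where A: "p = smult (lead_coeff p) (\<Prod>x\<in>#A. [:-x, 1:])"
    using alg_closed_imp_factorization[OF assms(2)] by blast
  have "\<exists>S. S \<noteq> 0 \<and> laurent_eval U (\<Prod>x\<in>#B. [:-x, 1:]) = S * S" for B
  proof (induction B)
    case empty
    show ?case
      by (intro exI[of _ 1]) simp
  next
    case (add x B)
    then obtain S where S: "S \<noteq> 0" "laurent_eval U (\<Prod>x\<in>#B. [:-x, 1:]) = S * S"
      by blast
    obtain R where R: "R \<noteq> 0" "U - fls_const x = R * R"
      using double_parameter_linear_square[OF assms(1)] by blast
    have "laurent_eval U [:-x, 1:] = R * R"
      using R(2) by simp
    then have "laurent_eval U (\<Prod>x\<in>#add_mset x B. [:-x, 1:]) = (R * S) * (R * S)"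
      unfolding image_mset_add_mset prod_mset.add_mset laurent_eval_hom.hom_mult S(2)
      by (simp only: mult_ac)
    with S(1) R(1) show ?case
      by (intro exI[of _ "R * S"]) simp
  qed
  then obtain S where S: "S \<noteq> 0" "laurent_eval U (\<Prod>x\<in>#A. [:-x, 1:]) = S * S"
    by blast
  obtain y where y: "y ^ 2 = lead_coeff p"
    using nth_root_exists[of 2] by auto
  have "laurent_eval U p = laurent_eval U ([:lead_coeff p:] * (\<Prod>x\<in>#A. [:-x, 1:]))"
    by (subst A) simp
  also have "\<dots> = (fls_const y * S) * (fls_const y * S)"
    unfolding laurent_eval_hom.hom_mult S(2) using y by (simp add: power2_eq_square mult_ac flip: y)
  finally have "laurent_eval U p = (fls_const y * S) * (fls_const y * S)" .
  moreover have "fls_const y * S \<noteq> 0"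
    using S(1) y assms(2) by auto
  ultimately show ?thesis
    by blast
qed

lemma laurent_eval_nonzero:
  fixes U :: "'a::{alg_closed_field, field_char_0} fls"
  assumes "double_parameter U" "p \<noteq> 0"
  shows "laurent_eval U p \<noteq> 0"
  using laurent_eval_square[OF assms] by auto

lemma laurent_eval_finite_point:
  "\<exists>r. laurent_eval (fls_const u0 + fls_X ^ 2) p = fps_to_fls r \<and> fps_nth r 0 = poly p u0"
proof (induction p)
  case 0
  show ?case
    by (intro exI[of _ 0]) simp
next
  case (pCons a p)
  then obtain r where r: "laurent_eval (fls_const u0 + fls_X ^ 2) p = fps_to_fls r" "fps_nth r 0
      = poly p u0"
    by blast
  show ?case
    by (intro exI[of _ "fps_const a + (fps_const u0 + fps_X ^ 2) * r"])
      (simp add: r fps_to_fls_hom.hom_add fps_to_fls_hom.hom_mult fps_to_fls_power)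
qed

lemma laurent_eval_infinity_subdegree:
  assumes "p \<noteq> 0"
  shows "fls_subdegree (laurent_eval (fls_X_inv ^ 2) p) \<le> 0"
proof -
  have "laurent_eval (fls_X_inv ^ 2) p = (\<Sum>i\<le>degree p. fls_const (coeff p i) * fls_X_inv ^ (2 * i))"
    unfolding laurent_eval_def poly_altdef
    by (simp add: degree_map_poly coeff_map_poly power_mult)
  moreover have "fls_nth (fls_const c * fls_X_inv ^ (2 * i)) (- int (2 * n)) = (if i
      = n then c else 0)"
    for c :: 'a and i n
    by auto
  ultimately have "fls_nth (laurent_eval (fls_X_inv ^ 2) p) (- int (2 * degree p)) = lead_coeff p"
    by (simp only: fls_nth_sum) simp
  then have "fls_subdegree (laurent_eval (fls_X_inv ^ 2) p) \<le> - int (2 * degree p)"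
    using assms by (intro fls_subdegree_leI) auto
  then show ?thesis
    by simp
qed

text \<open>The projective line has no nonzero regular differential, even if regularity is tested
  only after double ramification. In lowest terms, a zero of the denominator contributes at least
  \<open>X^2\<close> while \<open>du\<close> contributes only \<open>X\<close>; with constant
  denominator, \<open>du\<close> alone has a pole of order three at infinity.\<close>

lemma no_regular_differential:
  fixes R N :: "'a::{alg_closed_field, field_char_0, field_gcd} poly"
  assumes "N \<noteq> 0"
    and reg: "\<And>U. double_parameter U \<Longrightarrow> \<exists>f. laurent_eval U R * fls_deriv U / laurent_eval U N
        = fps_to_fls f"
  shows "R = 0"
proof (rule ccontr)
  assume "R \<noteq> 0"
  define g where "g = gcd R N"
  have "g \<noteq> 0"
    using \<open>N \<noteq> 0\<close> by (simp add: g_def)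
  obtain R1 N1 where RN: "R = R1 * g" "N = N1 * g" "coprime R1 N1"
    unfolding g_def using gcd_coprime_exists[of R N] \<open>N \<noteq> 0\<close> by auto
  have reg1: "\<exists>f. laurent_eval U R1 * fls_deriv U = fps_to_fls f * laurent_eval U N1"
    if U: "double_parameter U" for U
  proof -
    obtain f where f: "laurent_eval U R * fls_deriv U / laurent_eval U N = fps_to_fls f"
      using reg[OF U] by blast
    have "laurent_eval U g \<noteq> 0" "laurent_eval U N \<noteq> 0"
      using laurent_eval_nonzero[OF U] \<open>g \<noteq> 0\<close> \<open>N \<noteq> 0\<close> by auto
    with f show ?thesis
      unfolding RN laurent_eval_hom.hom_mult by (intro exI[of _ f]) (simp add: field_simps)
  qed
  show False
  proof (cases "degree N1 = 0")
    case True
    then obtain c where c: "N1 = [:c:]"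
      by (rule degree_eq_zeroE)
    have "R1 \<noteq> 0" "c \<noteq> 0"
      using RN \<open>R \<noteq> 0\<close> \<open>N \<noteq> 0\<close> c by auto
    have U: "double_parameter (fls_X_inv ^ 2 :: 'a fls)"
      by (simp add: double_parameter_def)
    obtain f where f: "laurent_eval (fls_X_inv ^ 2) R1 * fls_deriv (fls_X_inv ^ 2)
        = fps_to_fls f * fls_const c"
      using reg1[OF U] c by auto
    have "fls_deriv (fls_X_inv ^ 2 :: 'a fls) = - (2 * fls_X_inv ^ 3)"
      by (simp add: power2_eq_square power3_eq_cube)
    then have "fls_deriv (fls_X_inv ^ 2 :: 'a fls) \<noteq> 0" "fls_subdegree (fls_deriv (fls_X_inv ^ 2 ::
        'a fls)) = - 3"
      by simp_all
    then have "fls_subdegree (laurent_eval (fls_X_inv ^ 2) R1 * fls_deriv (fls_X_inv ^ 2)) < 0"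
      using laurent_eval_infinity_subdegree[OF \<open>R1 \<noteq> 0\<close>] laurent_eval_nonzero[OF U \<open>R1 \<noteq> 0\<close>]
      by simp
    moreover have "fls_subdegree (fps_to_fls f * fls_const c) \<ge> 0"
      using fls_subdegree_fls_to_fps_gt0[of f] \<open>c \<noteq> 0\<close> by (cases "f = 0") simp_all
    ultimately show False
      using f by simp
  next
    case False
    then obtain u0 where u0: "poly N1 u0 = 0"
      using alg_closed_imp_poly_has_root[of N1] by auto
    have R1: "poly R1 u0 \<noteq> 0"
      using coprime_poly_0[OF RN(3), of u0] u0 by blast
    obtain N2 where N2: "N1 = [:-u0, 1:] * N2"
      using u0 by (auto simp: poly_eq_0_iff_dvd elim: dvdE)
    define U where "U = (fls_const u0 + fls_X ^ 2 :: 'a fls)"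
    have U: "double_parameter U"
      by (auto simp: double_parameter_def U_def)
    obtain f where f: "laurent_eval U R1 * fls_deriv U = fps_to_fls f * laurent_eval U N1"
      using reg1[OF U] by blast
    obtain r where r: "laurent_eval U R1 = fps_to_fls r" "fps_nth r 0 = poly R1 u0"
      unfolding U_def using laurent_eval_finite_point by blast
    obtain n where n: "laurent_eval U N2 = fps_to_fls n"
      unfolding U_def using laurent_eval_finite_point by blast
    have "laurent_eval U [:-u0, 1:] = fls_X * fls_X"
      by (simp add: U_def power2_eq_square flip: fls_plus_const)
    then have "laurent_eval U N1 = fls_X * (fls_X * fps_to_fls n)"
      unfolding N2 laurent_eval_hom.hom_mult n by (simp add: mult_ac)
    moreover have "fls_deriv U = fls_X * 2"
      by (simp add: U_def power2_eq_square)
    ultimately have "fls_X * (2 * fps_to_fls r) = fls_X * (fls_X * (fps_to_fls n * fps_to_fls f))"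
      using f r by (simp add: mult_ac)
    then have "2 * fps_to_fls r = fls_X * (fps_to_fls n * fps_to_fls f)"
      by simp
    also have "\<dots> = fps_to_fls (fps_X * (n * f))"
      by (simp add: fls_times_fps_to_fls)
    also have "2 * fps_to_fls r = fps_to_fls (2 * r)"
      by (simp add: fls_times_fps_to_fls)
    finally have "2 * r = fps_X * (n * f)"
      by simp
    then have "fps_nth (2 * r) 0 = 0"
      by simp
    with r(2) R1 show False
      by (simp add: numeral_fps_const)
  qed
qed

text \<open>Powers of a root \<open>z\<close> of \<open>W z\<^sup>2 - A z + B\<close> are linear in \<open>z\<close>, up to powers of \<open>W\<close>.\<close>

primrec quad_pow :: "'a::comm_ring_1 \<Rightarrow> 'a \<Rightarrow> 'a \<Rightarrow> nat \<Rightarrow> 'a \<times> 'a" where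
  "quad_pow W A B 0 = (1, 0)"
| "quad_pow W A B (Suc i) = (- (B * snd (quad_pow W A B i)),
     W * fst (quad_pow W A B i) + A * snd (quad_pow W A B i))"

lemma quad_pow:
  assumes "comm_ring_hom e" "e W * z ^ 2 = e A * z - e B"
  shows "e W ^ i * z ^ i = e (fst (quad_pow W A B i)) + e (snd (quad_pow W A B i)) * z"
proof (induction i)
  interpret comm_ring_hom e by fact
  {
    case 0
    show ?case by simp
  next
    case (Suc i)
    define a b where "a = e (fst (quad_pow W A B i))" and "b = e (snd (quad_pow W A B i))"
    have "e W ^ Suc i * z ^ Suc i = e W * z * (a + b * z)"
      using Suc by (simp add: a_def b_def mult_ac)
    also have "\<dots> = e W * a * z + b * (e W * z ^ 2)"
      by (simp add: algebra_simps power2_eq_square)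
    also have "\<dots> = - (e B * b) + (e W * a + e A * b) * z"
      unfolding assms(2) by (simp add: algebra_simps)
    finally show ?case
      by (simp add: hom_add hom_mult hom_uminus a_def b_def)
  }
qed

text \<open>Together with \<open>quad_rem1\<close>, the coefficients of the pseudo-remainder of
  \<open>p\<close> modulo \<open>W * z^2 - A * z + B\<close>, normalised by
  \<open>W^(degree p)\<close>; \<open>lin_rem\<close> is the analogue for \<open>W * z - A\<close>.
  No division occurs, so the results are polynomials of controlled degree.\<close>

definition quad_rem0 :: "'a::comm_ring_1 \<Rightarrow> 'a \<Rightarrow> 'a \<Rightarrow> 'a poly \<Rightarrow> 'a" where
  "quad_rem0 W A B p = (\<Sum>i\<le>degree p. coeff p i * W ^ (degree p - i) * fst (quad_pow W A B i))"

definition quad_rem1 :: "'a::comm_ring_1 \<Rightarrow> 'a \<Rightarrow> 'a \<Rightarrow> 'a poly \<Rightarrow> 'a" where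
  "quad_rem1 W A B p = (\<Sum>i\<le>degree p. coeff p i * W ^ (degree p - i) * snd (quad_pow W A B i))"

definition lin_rem :: "'a::comm_ring_1 \<Rightarrow> 'a \<Rightarrow> 'a poly \<Rightarrow> 'a" where
  "lin_rem W A p = (\<Sum>i\<le>degree p. coeff p i * W ^ (degree p - i) * A ^ i)"

lemma poly_map_poly_sum:
  assumes "comm_ring_hom e"
  shows "poly (map_poly e p) z = (\<Sum>i\<le>degree p. e (coeff p i) * z ^ i)"
proof -
  interpret comm_ring_hom e by fact
  show ?thesis
    using eval_poly_as_sum[of e p z] by (simp add: eval_poly_def mult.commute)
qed

lemma quad_rem:
  assumes e: "comm_ring_hom e" and z: "e W * z ^ 2 = e A * z - e B"
  shows "e W ^ degree p * poly (map_poly e p) z = e (quad_rem0 W A B p) + e (quad_rem1 W A B p) * z"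
proof -
  interpret comm_ring_hom e by fact
  have "e W ^ degree p * poly (map_poly e p) z =
     (\<Sum>i\<le>degree p. e (coeff p i) * e W ^ (degree p - i) * (e W ^ i * z ^ i))"
    unfolding poly_map_poly_sum[OF e] sum_distrib_left
    by (rule sum.cong) (simp_all add: mult_ac flip: power_add)
  also have "\<dots> = e (quad_rem0 W A B p) + e (quad_rem1 W A B p) * z"
    unfolding quad_pow[OF e z] quad_rem0_def quad_rem1_def hom_sum sum_distrib_right
      sum.distrib[symmetric]
    by (rule sum.cong) (simp_all add: hom_mult hom_power algebra_simps)
  finally show ?thesis .
qed

lemma lin_rem:
  assumes e: "comm_ring_hom e" and z: "e W * z = e A"
  shows "e W ^ degree p * poly (map_poly e p) z = e (lin_rem W A p)"
proof -
  interpret comm_ring_hom e by fact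
  have "e W ^ degree p * poly (map_poly e p) z =
     (\<Sum>i\<le>degree p. e (coeff p i) * e W ^ (degree p - i) * (e W * z) ^ i)"
    unfolding poly_map_poly_sum[OF e] sum_distrib_left
    by (rule sum.cong) (simp_all add: mult_ac power_mult_distrib flip: power_add)
  also have "\<dots> = e (lin_rem W A p)"
    unfolding z lin_rem_def hom_sum by (rule sum.cong) (simp_all add: hom_mult hom_power)
  finally show ?thesis .
qed

section \<open>Exclusion of linear and quadratic factors\<close>

definition affine_poly :: "'k::field ternary \<Rightarrow> 'k alg_closure poly \<Rightarrow> 'k alg_closure poly poly" where
  "affine_poly F \<psi> = (\<Sum>m\<in>Poly_Mapping.keys F. monom (smult (to_ac (Poly_Mapping.lookup F m))
     (\<psi> ^ Poly_Mapping.lookup m 1)) (Poly_Mapping.lookup m 3))"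

lemma poly_affine_poly:
  assumes "comm_ring_hom e"
  shows "poly (map_poly e (affine_poly F \<psi>)) z = eval3 (\<lambda>c. e [:to_ac c:]) F (e \<psi>) 1 z"
proof -
  interpret comm_ring_hom e by fact
  interpret mp: map_poly_comm_ring_hom e ..
  have smult: "e (smult c p) = e [:c:] * e p" for c p
    using hom_mult[of "[:c:]" p] by simp
  show ?thesis
    unfolding affine_poly_def mp.hom_sum poly_sum eval3_def
    by (rule sum.cong) (simp_all add: poly_monom smult hom_power mult_ac)
qed

text \<open>A vanishing remainder puts both roots of the quadratic on the curve at every double
  parameter, where the differentials are regular. Their traces are rational in \<open>u\<close>,
  hence zero, and form a linear system for \<open>G0\<close>, \<open>G1\<close> whose determinant is
  the discriminant up to sign.\<close>

theorem no_quadratic_factor: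
  fixes F :: "'k::field_char_0 ternary" and \<psi> W A B :: "'k alg_closure poly"
  assumes F: "homogeneous d F" "d \<ge> 4" "smooth3 F" and "pderiv \<psi> \<noteq> 0"
    and "W \<noteq> 0" and disc: "A ^ 2 - 4 * W * B \<noteq> 0"
    and rem: "quad_rem0 W A B (affine_poly F \<psi>) = 0" "quad_rem1 W A B (affine_poly F \<psi>) = 0"
  shows False
proof -
  define P PZ where "P = affine_poly F \<psi>" and "PZ = affine_poly (partial 3 F) \<psi>"
  define n where "n = degree PZ"
  define G0 G1 where "G0 = quad_rem0 W A B PZ" and "G1 = quad_rem1 W A B PZ"
  \<comment> \<open>For the roots \<open>z1\<close>, \<open>z2\<close> put
    \<open>h = G0 + G1 * z\<close>, which is \<open>W^n * F_Z\<close>. Then \<open>N\<close> is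
    \<open>W * h1 * h2\<close>, and \<open>R1 / N\<close>, \<open>R2 / N\<close> are the sums over
    both roots of \<open>\<psi>' / F_Z\<close> and \<open>z * \<psi>' / F_Z\<close>, written as
    symmetric functions.\<close>
  define N where "N = W * G0 ^ 2 + G0 * G1 * A + G1 ^ 2 * B"
  define R1 where "R1 = pderiv \<psi> * W ^ n * (2 * W * G0 + G1 * A)"
  define R2 where "R2 = pderiv \<psi> * W ^ n * (A * G0 + 2 * G1 * B)"
  have main: "laurent_eval U N \<noteq> 0 \<and>
      (\<exists>f. laurent_eval U R1 * fls_deriv U / laurent_eval U N = fps_to_fls f) \<and>
      (\<exists>f. laurent_eval U R2 * fls_deriv U / laurent_eval U N = fps_to_fls f)"
    if U: "double_parameter U" for U :: "'k alg_closure fls"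
  proof -
    define e where "e = laurent_eval U"
    have e: "comm_ring_hom e"
      unfolding e_def by (rule laurent_eval_hom.comm_ring_hom_axioms)
    interpret comm_ring_hom e by (rule e)
    define w a b g0 g1 where "w = e W" and "a = e A" and "b = e B" and "g0 = e G0" and "g1 = e G1"
    have w0: "w \<noteq> 0"
      unfolding w_def e_def using laurent_eval_nonzero[OF U \<open>W \<noteq> 0\<close>] .
    obtain S where S: "S \<noteq> 0" "laurent_eval U (A ^ 2 - 4 * W * B) = S * S"
      using laurent_eval_square[OF U disc] by blast
    have "e 4 = 4"
      using hom_numeral by blast
    then have S2: "S * S = a ^ 2 - 4 * w * b"
      using S(2) by (simp add: hom_minus hom_mult hom_power a_def b_def w_def flip: e_def)
    define z1 z2 where "z1 = (a + S) / (2 * w)" and "z2 = (a - S) / (2 * w)"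
    have "(a + S) * (a - S) = 4 * w * b"
      using S2 by (simp add: algebra_simps power2_eq_square)
    then have "w * (z1 * z2) = w * (4 * w * b / (2 * w * (2 * w)))"
      unfolding z1_def z2_def times_divide_times_eq by simp
    then have z12: "w * (z1 + z2) = a" "w * (z1 * z2) = b"
      using w0 by (simp_all add: z1_def z2_def field_simps)
    have root: "e W * z ^ 2 = e A * z - e B" if "z = z1 \<or> z = z2" for z
    proof -
      have "w * z ^ 2 - w * (z1 + z2) * z + w * (z1 * z2) = w * ((z - z1) * (z - z2))"
        by (simp add: algebra_simps power2_eq_square)
      also have "\<dots> = 0"
        using that by auto
      finally show ?thesis
        unfolding z12 by (simp add: a_def b_def w_def algebra_simps)
    qed
    have ec: "(\<lambda>c. e [:to_ac c:]) = fls_const \<circ> (to_ac :: 'k \<Rightarrow> _)"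
      by (auto simp: e_def)
    define \<Psi> where "\<Psi> = e \<psi>"
    have U': "fls_deriv U \<noteq> 0"
      using U unfolding double_parameter_def by (auto simp: power2_eq_square)
    have \<Psi>': "fls_deriv \<Psi> = e (pderiv \<psi>) * fls_deriv U" "fls_deriv \<Psi> \<noteq> 0"
      using laurent_eval_deriv[of U \<psi>] laurent_eval_nonzero[OF U \<open>pderiv \<psi> \<noteq> 0\<close>] U'
      by (simp_all add: \<Psi>_def e_def)
    define FZ where "FZ z = eval3 (fls_const \<circ> to_ac) (partial 3 F) \<Psi> 1 z" for z
    have wFZ: "w ^ n * FZ z = g0 + g1 * z" if "z = z1 \<or> z = z2" for z
      using quad_rem[OF e root[OF that], of PZ] poly_affine_poly[OF e, of "partial 3 F" \<psi> z]
      by (simp add: FZ_def ec w_def g0_def g1_def G0_def G1_def n_def PZ_def \<Psi>_def)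
    have on: "eval3 (fls_const \<circ> to_ac) F \<Psi> 1 z = 0" if "z = z1 \<or> z = z2" for z
    proof -
      have "w ^ degree P * poly (map_poly e P) z = 0"
        using quad_rem[OF e root[OF that], of P] rem by (simp add: w_def P_def)
      then show ?thesis
        using w0 poly_affine_poly[OF e, of F \<psi> z] by (simp add: ec P_def \<Psi>_def)
    qed
    note rd = regular_differentials[OF F on \<Psi>'(2), folded FZ_def]
    have FZ0: "FZ z1 \<noteq> 0" "FZ z2 \<noteq> 0"
      using rd(1) by blast+
    obtain f1 f2 f3 f4 where f: "fls_deriv \<Psi> / FZ z1 = fps_to_fls f1" "fls_deriv \<Psi> / FZ z2
        = fps_to_fls f2"
      "z1 * fls_deriv \<Psi> / FZ z1 = fps_to_fls f3" "z2 * fls_deriv \<Psi> / FZ z2 = fps_to_fls f4"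
      using rd(2)[of z1] rd(2)[of z2] rd(3)[of z1] rd(3)[of z2] by blast
    define h1 h2 where "h1 = g0 + g1 * z1" and "h2 = g0 + g1 * z2"
    have h: "w ^ n * FZ z1 = h1" "w ^ n * FZ z2 = h2"
      using wFZ by (simp_all add: h1_def h2_def)
    have h0: "h1 \<noteq> 0" "h2 \<noteq> 0"
      using h FZ0 w0 by auto
    have eN: "e N = w * (h1 * h2)"
    proof -
      have "w * (h1 * h2) = w * g0 ^ 2 + g0 * g1 * (w * (z1 + z2)) + g1 ^ 2 * (w * (z1 * z2))"
        by (simp add: h1_def h2_def algebra_simps power2_eq_square)
      then show ?thesis
        unfolding z12 by (simp add: N_def hom_add hom_mult hom_power w_def a_def b_def g0_def
            g1_def)
    qed
    have e2: "e 2 = 2"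
      using hom_numeral by blast
    have eR1: "e R1 = e (pderiv \<psi>) * w ^ n * (w * (h1 + h2))"
    proof -
      have "w * (h1 + h2) = 2 * w * g0 + g1 * (w * (z1 + z2))"
        by (simp add: h1_def h2_def algebra_simps)
      then show ?thesis
        unfolding z12 by (simp add: R1_def hom_add hom_mult hom_power e2 w_def a_def g0_def g1_def)
    qed
    have eR2: "e R2 = e (pderiv \<psi>) * w ^ n * (w * (z1 * h2 + z2 * h1))"
    proof -
      have "w * (z1 * h2 + z2 * h1) = w * (z1 + z2) * g0 + 2 * g1 * (w * (z1 * z2))"
        by (simp add: h1_def h2_def algebra_simps)
      then show ?thesis
        unfolding z12 by (simp add: R2_def hom_add hom_mult hom_power e2 w_def a_def b_def g0_def
            g1_def)
    qed
    have FZh: "FZ z1 = h1 / w ^ n" "FZ z2 = h2 / w ^ n"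
      using h w0 by (simp_all add: field_simps)
    have "e R1 * fls_deriv U / e N = fls_deriv \<Psi> / FZ z1 + fls_deriv \<Psi> / FZ z2"
      unfolding eR1 eN \<Psi>' FZh using w0 h0 by (simp add: field_simps)
    then have 1: "e R1 * fls_deriv U / e N = fps_to_fls (f1 + f2)"
      using f by (simp add: fps_to_fls_hom.hom_add)
    have "e R2 * fls_deriv U / e N = z1 * fls_deriv \<Psi> / FZ z1 + z2 * fls_deriv \<Psi> / FZ z2"
      unfolding eR2 eN \<Psi>' FZh using w0 h0 by (simp add: field_simps)
    then have 2: "e R2 * fls_deriv U / e N = fps_to_fls (f3 + f4)"
      using f by (simp add: fps_to_fls_hom.hom_add)
    have "e N \<noteq> 0"
      using eN w0 h0 by simp
    then show ?thesis
      using 1 2 unfolding e_def[symmetric] by blast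
  qed
  have "N \<noteq> 0"
    using main[of "fls_X_inv ^ 2"] by (auto simp: double_parameter_def)
  then have "R1 = 0" "R2 = 0"
    using main by (intro no_regular_differential[of N]; blast)+
  then have eqs: "2 * W * G0 + G1 * A = 0" "A * G0 + 2 * G1 * B = 0"
    using \<open>pderiv \<psi> \<noteq> 0\<close> \<open>W \<noteq> 0\<close> by (auto simp: R1_def R2_def)
  have "G1 * (A ^ 2 - 4 * W * B) = A * (2 * W * G0 + G1 * A) - 2 * W * (A * G0 + 2 * G1 * B)"
    by (simp add: algebra_simps power2_eq_square)
  then have "G1 = 0"
    using eqs disc by simp
  with eqs(1) \<open>W \<noteq> 0\<close> have "G0 = 0"
    by simp
  with \<open>G1 = 0\<close> \<open>N \<noteq> 0\<close> show False
    by (simp add: N_def)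
qed

text \<open>Here the curve would contain an arc that is rational in \<open>u\<close>. The
  differential is its own trace, and its numerator \<open>\<psi>' * W^n\<close> is visibly
  nonzero.\<close>

theorem no_linear_factor:
  fixes F :: "'k::field_char_0 ternary" and \<psi> W A :: "'k alg_closure poly"
  assumes F: "homogeneous d F" "d \<ge> 4" "smooth3 F" and "pderiv \<psi> \<noteq> 0"
    and "W \<noteq> 0" and rem: "lin_rem W A (affine_poly F \<psi>) = 0"
  shows False
proof -
  define P PZ where "P = affine_poly F \<psi>" and "PZ = affine_poly (partial 3 F) \<psi>"
  define n where "n = degree PZ"
  define N where "N = lin_rem W A PZ"
  define R where "R = pderiv \<psi> * W ^ n"
  have main: "laurent_eval U N \<noteq> 0 \<and>
      (\<exists>f. laurent_eval U R * fls_deriv U / laurent_eval U N = fps_to_fls f)"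
    if U: "double_parameter U" for U :: "'k alg_closure fls"
  proof -
    define e where "e = laurent_eval U"
    have e: "comm_ring_hom e"
      unfolding e_def by (rule laurent_eval_hom.comm_ring_hom_axioms)
    interpret comm_ring_hom e by (rule e)
    have w0: "e W \<noteq> 0"
      unfolding e_def using laurent_eval_nonzero[OF U \<open>W \<noteq> 0\<close>] .
    define z where "z = e A / e W"
    have root: "e W * z = e A"
      using w0 by (simp add: z_def)
    have ec: "(\<lambda>c. e [:to_ac c:]) = fls_const \<circ> (to_ac :: 'k \<Rightarrow> _)"
      by (auto simp: e_def)
    define \<Psi> where "\<Psi> = e \<psi>"
    have U': "fls_deriv U \<noteq> 0"
      using U unfolding double_parameter_def by (auto simp: power2_eq_square)
    have \<Psi>': "fls_deriv \<Psi> = e (pderiv \<psi>) * fls_deriv U" "fls_deriv \<Psi> \<noteq> 0"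
      using laurent_eval_deriv[of U \<psi>] laurent_eval_nonzero[OF U \<open>pderiv \<psi> \<noteq> 0\<close>] U'
      by (simp_all add: \<Psi>_def e_def)
    define FZ where "FZ = eval3 (fls_const \<circ> to_ac) (partial 3 F) \<Psi> 1 z"
    have wFZ: "e W ^ n * FZ = e N"
      using lin_rem[OF e root, of PZ] poly_affine_poly[OF e, of "partial 3 F" \<psi> z]
      by (simp add: FZ_def ec N_def n_def PZ_def \<Psi>_def)
    have "e W ^ degree P * poly (map_poly e P) z = 0"
      using lin_rem[OF e root, of P] rem by (simp add: P_def)
    then have on: "eval3 (fls_const \<circ> to_ac) F \<Psi> 1 z = 0"
      using w0 poly_affine_poly[OF e, of F \<psi> z] by (simp add: ec P_def \<Psi>_def)
    note rd = regular_differentials[OF F on \<Psi>'(2), folded FZ_def]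
    have "e R * fls_deriv U / e N = fls_deriv \<Psi> / FZ"
      unfolding wFZ[symmetric] \<Psi>' using w0 rd(1) by (simp add: R_def hom_mult hom_power field_simps)
    then show ?thesis
      using rd(1,2) w0 wFZ unfolding e_def[symmetric] by auto
  qed
  have "N \<noteq> 0"
    using main[of "fls_X_inv ^ 2"] by (auto simp: double_parameter_def)
  then have "R = 0"
    using main by (intro no_regular_differential[of N]; blast)
  then show False
    using \<open>pderiv \<psi> \<noteq> 0\<close> \<open>W \<noteq> 0\<close> by (simp add: R_def)
qed

section \<open>Approximation by Laurent polynomials\<close>

lemma poly_poly_const_sum:
  fixes r :: "'a::comm_ring_1 poly poly"
  shows "poly (poly r [:y:]) s = (\<Sum>i\<le>degree r. poly (coeff r i) s * y ^ i)"
  by (simp add: poly_altdef[of r] poly_sum poly_power)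

lemma absval_poly_bounded:
  assumes w: "absval w"
  shows "\<exists>C\<ge>0. \<forall>s. w s \<le> 1 \<longrightarrow> w (poly p s) \<le> C"
proof (intro exI[of _ "\<Sum>i\<le>degree p. w (coeff p i)"] conjI allI impI)
  note W = absvalD[OF w]
  show "(\<Sum>i\<le>degree p. w (coeff p i)) \<ge> 0"
    by (intro sum_nonneg W)
  fix s assume s: "w s \<le> 1"
  have "w (poly p s) \<le> (\<Sum>i\<le>degree p. w (coeff p i * s ^ i))"
    unfolding poly_altdef by (rule W)
  also have "\<dots> \<le> (\<Sum>i\<le>degree p. w (coeff p i))"
  proof (rule sum_mono)
    fix i
    have "w s ^ i \<le> 1"
      using s W(1) by (intro power_le_one)
    then show "w (coeff p i * s ^ i) \<le> w (coeff p i)"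
      unfolding W(3) W(9) using W(1)[of "coeff p i"] by (simp add: mult_left_le)
  qed
  finally show "w (poly p s) \<le> (\<Sum>i\<le>degree p. w (coeff p i))" .
qed

lemma absval_poly_poly_bounded:
  assumes w: "absval w" and "Y \<ge> 0"
  shows "\<exists>C\<ge>0. \<forall>s y. w s \<le> 1 \<longrightarrow> w y \<le> Y \<longrightarrow> w (poly (poly r [:y:]) s) \<le> C"
proof -
  note W = absvalD[OF w]
  have "\<forall>i. \<exists>C\<ge>0. \<forall>s. w s \<le> 1 \<longrightarrow> w (poly (coeff r i) s) \<le> C"
    using absval_poly_bounded[OF w] by blast
  then obtain C where C: "\<And>i. C i \<ge> 0" "\<And>i s. w s \<le> 1 \<Longrightarrow> w (poly (coeff r i) s) \<le> C i"
    by metis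
  show ?thesis
  proof (intro exI[of _ "\<Sum>i\<le>degree r. C i * Y ^ i"] conjI allI impI)
    show "(\<Sum>i\<le>degree r. C i * Y ^ i) \<ge> 0"
      using C(1) \<open>Y \<ge> 0\<close> by (intro sum_nonneg) simp
    fix s y assume s: "w s \<le> 1" and y: "w y \<le> Y"
    have "w (poly (poly r [:y:]) s) \<le> (\<Sum>i\<le>degree r. w (poly (coeff r i) s * y ^ i))"
      unfolding poly_poly_const_sum by (rule W)
    also have "\<dots> \<le> (\<Sum>i\<le>degree r. C i * Y ^ i)"
      unfolding W(3) W(9) using C s y W(1) by (intro sum_mono mult_mono power_mono) auto
    finally show "w (poly (poly r [:y:]) s) \<le> (\<Sum>i\<le>degree r. C i * Y ^ i)" .
  qed
qed

lemma absval_root_bound: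
  assumes w: "absval w" and monic: "coeff g n = 1" "degree g = n" and root: "poly g y = 0"
    and C: "\<And>i. i < n \<Longrightarrow> w (coeff g i) \<le> C" "C \<ge> 0"
  shows "w y \<le> 1 + real n * C"
proof (cases "w y \<le> 1")
  case True
  then show ?thesis
    using C(2) by (meson add_increasing2 mult_nonneg_nonneg of_nat_0_le_iff)
next
  case False
  note W = absvalD[OF w]
  have "n > 0"
  proof (rule ccontr)
    assume "\<not> n > 0"
    then have "g = 1"
      using monic by (metis degree_eq_zeroE coeff_pCons_0 gr0I one_pCons)
    then show False
      using root by simp
  qed
  have "0 = (\<Sum>i<n. coeff g i * y ^ i) + y ^ n"
    using root monic unfolding poly_altdef by (simp add: lessThan_Suc_atMost[symmetric])
  then have "w (y ^ n) = w (\<Sum>i<n. coeff g i * y ^ i)"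
    by (metis W(7) add.inverse_unique)
  also have "\<dots> \<le> (\<Sum>i<n. w (coeff g i * y ^ i))"
    by (rule W)
  also have "\<dots> \<le> (\<Sum>i<n. C * w y ^ (n - 1))"
  proof (rule sum_mono)
    fix i assume "i \<in> {..<n}"
    then have "w y ^ i \<le> w y ^ (n - 1)" "w (coeff g i) \<le> C"
      using False C by (auto intro!: power_increasing)
    then show "w (coeff g i * y ^ i) \<le> C * w y ^ (n - 1)"
      unfolding W(3) W(9) using C(2) W(1) by (intro mult_mono) auto
  qed
  finally have "w y * w y ^ (n - 1) \<le> (real n * C) * w y ^ (n - 1)"
    using \<open>n > 0\<close> by (simp add: W flip: power_Suc)
  moreover have "w y ^ (n - 1) > 0"
    using False by simp
  ultimately have "w y \<le> real n * C"
    by (metis mult_le_cancel_right_pos)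
  then show ?thesis
    by simp
qed

lemma prod_list_small_factor:
  fixes xs :: "real list"
  assumes "prod_list xs \<le> c ^ length xs" "xs \<noteq> []" "c \<ge> 0"
  shows "\<exists>x\<in>set xs. x \<le> c"
proof (rule ccontr)
  assume "\<not> ?thesis"
  then have "\<forall>x\<in>set xs. c < x"
    by auto
  then have "c ^ length xs < prod_list xs"
    using assms(2)
  proof (induction xs)
    case (Cons x xs)
    show ?case
    proof (cases "xs = []")
      case False
      then have "c ^ length xs < prod_list xs" "c < x"
        using Cons by auto
      then have "c * c ^ length xs < x * prod_list xs"
        using assms(3) by (intro mult_strict_mono) auto
      then show ?thesis
        by simp
    qed (use Cons in simp)
  qed simp
  then show False
    using assms(1) by simp
qed

text \<open>The set \<open>\<Phi>\<close> serves all absolute values at once; only the constant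
  depends on \<open>w\<close>. If a product of \<open>n\<close> factors is small, one factor is
  small, hence expansions to order \<open>n * q\<close> are taken to reach an error
  \<open>w s^q\<close>.\<close>

lemma puiseux_approximation:
  "\<exists>M>0. \<forall>p :: 'a::{alg_closed_field, field_gcd, field_char_0} poly poly.
     degree p = n \<longrightarrow> lead_coeff p = 1 \<longrightarrow> n > 0 \<longrightarrow>
     (\<forall>q. \<exists>\<Phi>. finite \<Phi> \<and> (\<forall>w. absval w \<longrightarrow> (\<exists>C\<ge>0. \<forall>s y. w s \<le> 1 \<longrightarrow>
        poly (poly p [:y:]) (s ^ M) = 0 \<longrightarrow>
        w y \<le> C \<and> (\<exists>\<phi>\<in>\<Phi>. w (y - poly \<phi> s) \<le> C * w s ^ q))))"
proof -
  obtain M where M: "M > 0" "\<And>(p :: 'a poly poly) T. degree p = n \<Longrightarrow> lead_coeff p = 1 \<Longrightarrow>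
     \<exists>\<phi>s r. length \<phi>s = n \<and> (\<forall>s y. poly (poly p [:y:]) (s ^ M) =
        (\<Prod>\<phi>\<leftarrow>\<phi>s. y - poly \<phi> s) + s ^ T * poly (poly r [:y:]) s)"
    using puiseux_evaluation[of n] by blast
  have "\<exists>\<Phi>. finite \<Phi> \<and> (\<forall>w. absval w \<longrightarrow> (\<exists>C\<ge>0. \<forall>s y. w s \<le> 1 \<longrightarrow>
        poly (poly p [:y:]) (s ^ M) = 0 \<longrightarrow>
        w y \<le> C \<and> (\<exists>\<phi>\<in>\<Phi>. w (y - poly \<phi> s) \<le> C * w s ^ q)))"
    if p: "degree p = n" "lead_coeff p = 1" "n > 0" for p :: "'a poly poly" and q
  proof -
    obtain \<phi>s r where \<phi>s: "length \<phi>s = n" and eq: "\<And>s y. poly (poly p [:y:]) (s ^ M) =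
        (\<Prod>\<phi>\<leftarrow>\<phi>s. y - poly \<phi> s) + s ^ (n * q) * poly (poly r [:y:]) s"
      using M(2)[OF p(1,2), of "n * q"] by blast
    have "\<exists>C\<ge>0. \<forall>s y. w s \<le> 1 \<longrightarrow> poly (poly p [:y:]) (s ^ M) = 0 \<longrightarrow>
        w y \<le> C \<and> (\<exists>\<phi>\<in>set \<phi>s. w (y - poly \<phi> s) \<le> C * w s ^ q)" if w: "absval w" for w
    proof -
      note W = absvalD[OF w]
      have "\<forall>i. \<exists>C\<ge>0. \<forall>s. w s \<le> 1 \<longrightarrow> w (poly (coeff p i) s) \<le> C"
        using absval_poly_bounded[OF w] by blast
      then obtain c where c: "\<And>i. c i \<ge> 0" "\<And>i s. w s \<le> 1 \<Longrightarrow> w (poly (coeff p i) s) \<le> c i"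
        by metis
      define C1 where "C1 = (\<Sum>i<n. c i)"
      have C1: "C1 \<ge> 0" "\<And>i. i < n \<Longrightarrow> c i \<le> C1"
        unfolding C1_def using c(1) by (auto intro: sum_nonneg member_le_sum)
      define Y where "Y = 1 + real n * C1"
      have "Y \<ge> 0"
        using C1(1) by (simp add: Y_def)
      obtain C2 where C2: "C2 \<ge> 0" "\<And>s y. w s \<le> 1 \<Longrightarrow> w y \<le> Y \<Longrightarrow> w (poly (poly r [:y:]) s) \<le> C2"
        using absval_poly_poly_bounded[OF w \<open>Y \<ge> 0\<close>] by blast
      define C where "C = max Y (root n C2)"
      have root: "root n C2 \<ge> 0" "root n C2 ^ n = C2"
        using C2(1) p(3) by auto
      show ?thesis
      proof (intro exI[of _ C] conjI allI impI)
        show "C \<ge> 0"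
          using \<open>Y \<ge> 0\<close> by (simp add: C_def)
        fix s y assume s: "w s \<le> 1" and py: "poly (poly p [:y:]) (s ^ M) = 0"
        have sM: "w (s ^ M) \<le> 1"
          using s W(1) by (simp add: W(9) power_le_one)
        define g where "g = map_poly (\<lambda>a. poly a (s ^ M)) p"
        have g: "coeff g n = 1" "degree g = n"
        proof -
          show 1: "coeff g n = 1"
            using p by (simp add: g_def coeff_map_poly)
          show "degree g = n"
            using 1 p(1) unfolding g_def by (metis degree_map_poly_le le_antisym le_degree
                zero_neq_one)
        qed
        have "poly g y = 0"
          using py unfolding g_def poly_poly_const_sum poly_map_poly_sum[OF
              poly_hom.comm_ring_hom_axioms] .
        moreover have "w (coeff g i) \<le> C1" if "i < n" for i
          using order_trans[OF c(2)[OF sM] C1(2)[OF that]] by (simp add: g_def coeff_map_poly)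
        ultimately have "w y \<le> Y"
          unfolding Y_def using C1(1) by (intro absval_root_bound[OF w g])
        then show "w y \<le> C"
          by (simp add: C_def)
        have "(\<Prod>\<phi>\<leftarrow>\<phi>s. y - poly \<phi> s) = - (s ^ (n * q) * poly (poly r [:y:]) s)"
          using eq[of y s] py by (simp add: eq_neg_iff_add_eq_0)
        then have "w (\<Prod>\<phi>\<leftarrow>\<phi>s. y - poly \<phi> s) = w s ^ (n * q) * w (poly (poly r [:y:]) s)"
          by (simp add: W(3,7,9))
        also have "w (\<Prod>\<phi>\<leftarrow>xs. y - poly \<phi> s) = prod_list (map (\<lambda>\<phi>. w (y - poly \<phi> s)) xs)" for xs
          by (induction xs) (simp_all add: W(3,6))
        also have "w s ^ (n * q) * w (poly (poly r [:y:]) s) \<le> w s ^ (n * q) * C2"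
          using C2(2)[OF s \<open>w y \<le> Y\<close>] W(1) by (intro mult_left_mono) auto
        also have "\<dots> = (root n C2 * w s ^ q) ^ length (map (\<lambda>\<phi>. w (y - poly \<phi> s)) \<phi>s)"
          using root(2) \<phi>s by (simp add: power_mult_distrib mult.commute flip: power_mult)
        finally have "\<exists>x\<in>set (map (\<lambda>\<phi>. w (y - poly \<phi> s)) \<phi>s). x \<le> root n C2 * w s ^ q"
          using p(3) \<phi>s root(1) W(1) by (intro prod_list_small_factor) auto
        then obtain \<phi> where "\<phi> \<in> set \<phi>s" "w (y - poly \<phi> s) \<le> root n C2 * w s ^ q"
          by auto
        moreover have "root n C2 * w s ^ q \<le> C * w s ^ q"
          using W(1) by (intro mult_right_mono) (auto simp: C_def)
        ultimately show "\<exists>\<phi>\<in>set \<phi>s. w (y - poly \<phi> s) \<le> C * w s ^ q"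
          by (meson order_trans)
      qed
    qed
    then show ?thesis
      by (intro exI[of _ "set \<phi>s"]) auto
  qed
  with M(1) show ?thesis
    by blast
qed

text \<open>Laurent polynomials with exponents between \<open>- E\<close> and \<open>E\<close>,
  regarded as functions; the value at zero is left free.\<close>

definition laurent :: "nat \<Rightarrow> ('a::field \<Rightarrow> 'a) \<Rightarrow> bool" where
  "laurent E f \<longleftrightarrow> (\<exists>p. degree p \<le> 2 * E \<and> (\<forall>u. u \<noteq> 0 \<longrightarrow> u ^ E * f u = poly p u))"

text \<open>For sums the exponent \<open>2 * E\<close> is generous; it agrees with the one for
  products, so that traces and norms share one bound.\<close>

lemma laurent_add:
  assumes "laurent E f" "laurent E g"
  shows "laurent (2 * E) (\<lambda>u. f u + g u)"
proof -
  obtain p q where p: "degree p \<le> 2 * E" "\<And>u. u \<noteq> 0 \<Longrightarrow> u ^ E * f u = poly p u"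
    and q: "degree q \<le> 2 * E" "\<And>u. u \<noteq> 0 \<Longrightarrow> u ^ E * g u = poly q u"
    using assms unfolding laurent_def by auto
  have "degree (monom 1 E * (p + q)) \<le> E + 2 * E"
    using degree_mult_le[of "monom 1 E" "p + q"] degree_monom_le[of "1 :: 'a" E]
      degree_add_le[OF p(1) q(1)] by linarith
  moreover have "u ^ (2 * E) * (f u + g u) = poly (monom 1 E * (p + q)) u" if "u \<noteq> 0" for u
  proof -
    have "u ^ (2 * E) * (f u + g u) = u ^ E * (u ^ E * f u + u ^ E * g u)"
      by (simp add: mult_2 power_add distrib_left mult.assoc)
    then show ?thesis
      using p(2)[OF that] q(2)[OF that] by (simp add: poly_monom)
  qed
  ultimately show ?thesis
    unfolding laurent_def by (intro exI[of _ "monom 1 E * (p + q)"]) auto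
qed

lemma laurent_mult:
  assumes "laurent E f" "laurent E g"
  shows "laurent (2 * E) (\<lambda>u. f u * g u)"
proof -
  obtain p q where p: "degree p \<le> 2 * E" "\<And>u. u \<noteq> 0 \<Longrightarrow> u ^ E * f u = poly p u"
    and q: "degree q \<le> 2 * E" "\<And>u. u \<noteq> 0 \<Longrightarrow> u ^ E * g u = poly q u"
    using assms unfolding laurent_def by auto
  have "degree (p * q) \<le> 2 * (2 * E)"
    using degree_mult_le[of p q] p(1) q(1) by linarith
  moreover have "u ^ (2 * E) * (f u * g u) = poly (p * q) u" if "u \<noteq> 0" for u
  proof -
    have "u ^ (2 * E) * (f u * g u) = (u ^ E * f u) * (u ^ E * g u)"
      unfolding mult_2 power_add by (simp only: mult_ac)
    then show ?thesis
      using p(2)[OF that] q(2)[OF that] by simp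
  qed
  ultimately show ?thesis
    unfolding laurent_def by blast
qed

lemma poly_reversal:
  fixes h :: "'a::field poly"
  assumes "degree h \<le> N"
  shows "\<exists>k. degree k \<le> N \<and> (\<forall>v. v \<noteq> 0 \<longrightarrow> poly k v = v ^ N * poly h (inverse v))"
proof (intro exI conjI allI impI)
  show "degree (\<Sum>i\<le>N. monom (coeff h i) (N - i)) \<le> N"
    by (intro degree_sum_le) (auto intro: order_trans[OF degree_monom_le])
  fix v :: 'a assume "v \<noteq> 0"
  have "poly h (inverse v) = (\<Sum>i\<le>N. coeff h i * inverse v ^ i)"
    unfolding poly_altdef using assms
    by (intro sum.mono_neutral_left) (auto simp: coeff_eq_0)
  then have "v ^ N * poly h (inverse v) = (\<Sum>i\<le>N. coeff h i * (v ^ N * inverse v ^ i))"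
    by (simp add: sum_distrib_left mult_ac)
  also have "\<dots> = (\<Sum>i\<le>N. coeff h i * v ^ (N - i))"
    using \<open>v \<noteq> 0\<close> by (intro sum.cong) (auto simp: power_diff field_simps)
  finally show "poly (\<Sum>i\<le>N. monom (coeff h i) (N - i)) v = v ^ N * poly h (inverse v)"
    by (simp add: poly_sum poly_monom)
qed

text \<open>
  The roots \<open>y\<close> of \<open>g(\<alpha> + \<beta> u\<^sup>M, y)\<close> are close to Laurent polynomials in \<open>u\<close> both for small and for
  large \<open>u\<close>, uniformly over all absolute values.
\<close>

lemma root_approximation:
  fixes g :: "'a::{alg_closed_field, field_gcd, field_char_0} poly poly"
  assumes g: "lead_coeff g = 1" "degree g = n" "n > 0" and \<beta>: "\<beta> \<noteq> 0"
  shows "\<exists>M>0. \<exists>E B \<Phi>. finite \<Phi> \<and> (\<forall>f\<in>\<Phi>. laurent E f) \<and> (\<forall>w. absval w \<longrightarrow>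
    (\<exists>C\<ge>0. \<forall>u y. u \<noteq> 0 \<longrightarrow> poly (poly g [:y:]) (\<alpha> + \<beta> * u ^ M) = 0 \<longrightarrow>
      (w u \<le> 1 \<longrightarrow> w y \<le> C \<and> (\<exists>f\<in>\<Phi>. w (y - f u) \<le> C * w u)) \<and>
      (w u \<ge> 1 \<longrightarrow> w y \<le> C * w u ^ B \<and> (\<exists>f\<in>\<Phi>. w (y - f u) \<le> C * inverse (w u) ^ (B + 1)))))"
proof -
  obtain M where M: "M > 0" "\<And>(p :: 'a poly poly) q. degree p = n \<Longrightarrow> lead_coeff p = 1 \<Longrightarrow>
     \<exists>\<Phi>. finite \<Phi> \<and> (\<forall>w. absval w \<longrightarrow> (\<exists>C\<ge>0. \<forall>s y. w s \<le> 1 \<longrightarrow>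
        poly (poly p [:y:]) (s ^ M) = 0 \<longrightarrow>
        w y \<le> C \<and> (\<exists>\<phi>\<in>\<Phi>. w (y - poly \<phi> s) \<le> C * w s ^ q)))"
    using puiseux_approximation[of n] g(3) by blast
  \<comment> \<open>The equation near \<open>u = 0\<close>, with small parameter
    \<open>v = u^M\<close>.\<close>
  define p0 where "p0 = map_poly (\<lambda>c. pcompose c [:\<alpha>, \<beta>:]) g"
  have coeff_p0: "coeff p0 i = pcompose (coeff g i) [:\<alpha>, \<beta>:]" for i
    by (simp add: p0_def coeff_map_poly)
  have p0: "degree p0 = n" "lead_coeff p0 = 1"
  proof -
    have 1: "coeff p0 n = 1"
      using g by (simp add: coeff_p0)
    then show "degree p0 = n"
      using g(2) unfolding p0_def by (metis degree_map_poly_le le_antisym le_degree zero_neq_one)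
    with 1 show "lead_coeff p0 = 1"
      by simp
  qed
  have eval_p0: "poly (poly p0 [:y:]) v = poly (poly g [:y:]) (\<alpha> + \<beta> * v)" for y v
    unfolding poly_poly_const_sum p0(1) g(2) by (simp add: coeff_p0 poly_pcompose mult.commute)
  define A where "A = Max ((\<lambda>i. degree (coeff g i)) ` {..n})"
  have A: "degree (coeff g i) \<le> A" if "i \<le> n" for i
    unfolding A_def using that by (intro Max_ge) auto
  \<comment> \<open>Near infinity, with \<open>v = u^(-M)\<close>, the coefficients have poles of
    order at most \<open>A\<close> in \<open>v\<close>. The unknown is therefore replaced by
    \<open>v^A * y\<close>, whose monic equation has polynomial coefficients
    \<open>v^(A * (n - i)) * coeff g i\<close>.\<close>
  have "\<exists>k. degree k \<le> A * (n - i) \<and> (\<forall>v. v \<noteq> 0 \<longrightarrow>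
      poly k v = v ^ (A * (n - i)) * poly (coeff g i) (\<alpha> + \<beta> * inverse v))"
    if "i < n" for i
  proof -
    have "degree (pcompose (coeff g i) [:\<alpha>, \<beta>:]) \<le> A * 1"
      using A[of i] that degree_pcompose_le[of "coeff g i" "[:\<alpha>, \<beta>:]"] \<beta> by simp
    also have "\<dots> \<le> A * (n - i)"
      using that by (intro mult_le_mono2) simp
    finally show ?thesis
      using poly_reversal[of "pcompose (coeff g i) [:\<alpha>, \<beta>:]" "A * (n - i)"]
      by (simp add: poly_pcompose mult.commute)
  qed
  then obtain k where k: "\<And>i v. i < n \<Longrightarrow> v \<noteq> 0 \<Longrightarrow>
      poly (k i) v = v ^ (A * (n - i)) * poly (coeff g i) (\<alpha> + \<beta> * inverse v)"
    by metis
  define p1 where "p1 = (\<Sum>i<n. monom (k i) i) + monom 1 n"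
  have coeff_p1: "coeff p1 i = (if i < n then k i else if i = n then 1 else 0)" for i
    by (auto simp: p1_def coeff_sum)
  have p1: "degree p1 = n" "lead_coeff p1 = 1"
  proof -
    have "coeff p1 n = 1"
      by (simp add: coeff_p1)
    moreover have "degree p1 \<le> n"
      by (rule degree_le) (simp add: coeff_p1)
    ultimately show "degree p1 = n"
      by (metis le_antisym le_degree zero_neq_one)
    with \<open>coeff p1 n = 1\<close> show "lead_coeff p1 = 1"
      by simp
  qed
  have eval_p1: "poly (poly p1 [:v ^ A * y:]) v
      = v ^ (A * n) * poly (poly g [:y:]) (\<alpha> + \<beta> * inverse v)"
    if "v \<noteq> 0" for v y
  proof -
    have "poly (coeff p1 i) v * (v ^ A * y) ^ i
        = v ^ (A * n) * (poly (coeff g i) (\<alpha> + \<beta> * inverse v) * y ^ i)"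
      if "i \<le> n" for i
    proof (cases "i = n")
      case True
      then show ?thesis
        using g by (simp add: coeff_p1 power_mult_distrib power_mult)
    next
      case False
      then have "i < n"
        using that by simp
      then have "A * n = A * (n - i) + A * i"
        by (simp flip: distrib_left)
      then show ?thesis
        using k[OF \<open>i < n\<close> \<open>v \<noteq> 0\<close>] \<open>i < n\<close>
        by (simp add: coeff_p1 power_add power_mult_distrib power_mult mult_ac)
    qed
    then show ?thesis
      unfolding poly_poly_const_sum p1(1) g(2) by (simp add: sum_distrib_left)
  qed
  define B where "B = A * M"
  obtain \<Phi>0 where \<Phi>0: "finite \<Phi>0" "\<And>w. absval w \<Longrightarrow> \<exists>C\<ge>0. \<forall>s y. w s \<le> 1 \<longrightarrow>
        poly (poly p0 [:y:]) (s ^ M) = 0 \<longrightarrow>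
        w y \<le> C \<and> (\<exists>\<phi>\<in>\<Phi>0. w (y - poly \<phi> s) \<le> C * w s ^ 1)"
    using M(2)[OF p0, of 1] by blast
  \<comment> \<open>Returning from \<open>v^A * y\<close> to \<open>y\<close> costs a factor
    \<open>w u^B\<close>. Order \<open>2 * B + 1\<close> leaves an error of order
    \<open>B + 1\<close>, which still tends to zero when multiplied, in the norm, by a second root
    of size \<open>w u^B\<close>.\<close>
  obtain \<Phi>1 where \<Phi>1: "finite \<Phi>1" "\<And>w. absval w \<Longrightarrow> \<exists>C\<ge>0. \<forall>s y. w s \<le> 1 \<longrightarrow>
        poly (poly p1 [:y:]) (s ^ M) = 0 \<longrightarrow>
        w y \<le> C \<and> (\<exists>\<phi>\<in>\<Phi>1. w (y - poly \<phi> s) \<le> C * w s ^ (2 * B + 1))"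
    using M(2)[OF p1, of "2 * B + 1"] by blast
  define f1 where "f1 \<phi> = (\<lambda>u. u ^ B * poly \<phi> (inverse u))" for \<phi> :: "'a poly"
  define \<Phi> where "\<Phi> = poly ` \<Phi>0 \<union> f1 ` \<Phi>1"
  define E where "E = B + Max (insert 0 (degree ` (\<Phi>0 \<union> \<Phi>1)))"
  have E: "degree \<phi> + B \<le> E" if "\<phi> \<in> \<Phi>0 \<union> \<Phi>1" for \<phi>
    using \<Phi>0(1) \<Phi>1(1) that unfolding E_def by (subst add.commute, intro add_left_mono Max_ge) auto
  have "laurent E (poly \<phi>)" if "\<phi> \<in> \<Phi>0" for \<phi>
  proof -
    have "degree (monom 1 E * \<phi>) \<le> 2 * E"
      using degree_mult_le[of "monom 1 E" \<phi>] degree_monom_le[of "1 :: 'a" E] E[of \<phi>] that by auto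
    then show ?thesis
      unfolding laurent_def by (intro exI[of _ "monom 1 E * \<phi>"]) (simp add: poly_monom)
  qed
  moreover have "laurent E (f1 \<phi>)" if "\<phi> \<in> \<Phi>1" for \<phi>
  proof -
    have le: "degree \<phi> \<le> E + B"
      using E[of \<phi>] that by simp
    obtain k where k: "degree k \<le> E + B" "\<And>v. v \<noteq> 0 \<Longrightarrow> poly k v = v ^ (E + B) * poly \<phi> (inverse v)"
      using poly_reversal[OF le] by blast
    have "E + B \<le> 2 * E"
      using E[of \<phi>] that by simp
    then show ?thesis
      unfolding laurent_def f1_def using k by (intro exI[of _ k]) (auto simp: power_add mult.assoc)
  qed
  ultimately have laur: "\<forall>f\<in>\<Phi>. laurent E f"
    by (auto simp: \<Phi>_def)
  have "finite \<Phi>"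
    using \<Phi>0(1) \<Phi>1(1) by (simp add: \<Phi>_def)
  have "\<exists>C\<ge>0. \<forall>u y. u \<noteq> 0 \<longrightarrow> poly (poly g [:y:]) (\<alpha> + \<beta> * u ^ M) = 0 \<longrightarrow>
      (w u \<le> 1 \<longrightarrow> w y \<le> C \<and> (\<exists>f\<in>\<Phi>. w (y - f u) \<le> C * w u)) \<and>
      (w u \<ge> 1 \<longrightarrow> w y \<le> C * w u ^ B \<and> (\<exists>f\<in>\<Phi>. w (y - f u) \<le> C * inverse (w u) ^ (B + 1)))"
    if w: "absval w" for w
  proof -
    note W = absvalD[OF w]
    obtain C0 where C0: "C0 \<ge> 0" "\<And>s y. w s \<le> 1 \<Longrightarrow> poly (poly p0 [:y:]) (s ^ M) = 0 \<Longrightarrow>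
        w y \<le> C0 \<and> (\<exists>\<phi>\<in>\<Phi>0. w (y - poly \<phi> s) \<le> C0 * w s ^ 1)"
      using \<Phi>0(2)[OF w] by blast
    obtain C1 where C1: "C1 \<ge> 0" "\<And>s y. w s \<le> 1 \<Longrightarrow> poly (poly p1 [:y:]) (s ^ M) = 0 \<Longrightarrow>
        w y \<le> C1 \<and> (\<exists>\<phi>\<in>\<Phi>1. w (y - poly \<phi> s) \<le> C1 * w s ^ (2 * B + 1))"
      using \<Phi>1(2)[OF w] by blast
    define C where "C = max C0 C1"
    have C: "C \<ge> 0" "C0 \<le> C" "C1 \<le> C"
      using C0(1) by (auto simp: C_def)
    show ?thesis
    proof (intro exI[of _ C] conjI allI impI)
      fix u y assume "u \<noteq> 0" and root: "poly (poly g [:y:]) (\<alpha> + \<beta> * u ^ M) = 0"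
      {
        assume u: "w u \<le> 1"
        have y: "w y \<le> C0 \<and> (\<exists>\<phi>\<in>\<Phi>0. w (y - poly \<phi> u) \<le> C0 * w u ^ 1)"
          using root by (intro C0(2)[OF u]) (simp add: eval_p0)
        then show "w y \<le> C"
          using C by linarith
        from y obtain \<phi> where \<phi>: "\<phi> \<in> \<Phi>0" "w (y - poly \<phi> u) \<le> C0 * w u"
          by auto
        moreover have "C0 * w u \<le> C * w u"
          using C W(1) by (intro mult_right_mono) auto
        ultimately show "\<exists>f\<in>\<Phi>. w (y - f u) \<le> C * w u"
          unfolding \<Phi>_def by (intro bexI[of _ "poly \<phi>"]) auto
      }
      {
        assume u: "w u \<ge> 1"
        define s where "s = inverse u"
        have s0: "s \<noteq> 0" "s ^ M \<noteq> 0" "inverse (s ^ M) = u ^ M"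
          using \<open>u \<noteq> 0\<close> by (auto simp: s_def power_inverse)
        have s: "w s \<le> 1"
          using u W(10)[of u] by (simp add: s_def inverse_le_1_iff)
        have sB: "s ^ B = (s ^ M) ^ A"
          by (simp add: B_def mult.commute flip: power_mult)
        have "poly (poly p1 [:s ^ B * y:]) (s ^ M) = 0"
          unfolding sB eval_p1[OF s0(2)] s0(3) using root by simp
        then have y: "w (s ^ B * y) \<le> C1" "\<exists>\<phi>\<in>\<Phi>1. w (s ^ B * y - poly \<phi> s) \<le> C1 * w s ^ (2 * B + 1)"
          using C1(2)[OF s] by blast+
        have su: "w u ^ B * w s ^ B = 1"
          using \<open>u \<noteq> 0\<close> u by (simp add: s_def W(10) power_mult_distrib[symmetric])
        have "w y = w u ^ B * w (s ^ B * y)"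
          using su by (simp add: W(3,9) mult.assoc[symmetric])
        also have "\<dots> \<le> w u ^ B * C"
          using y(1) C W(1) by (intro mult_left_mono) auto
        finally show "w y \<le> C * w u ^ B"
          by (simp add: mult.commute)
        obtain \<phi> where \<phi>: "\<phi> \<in> \<Phi>1" "w (s ^ B * y - poly \<phi> s) \<le> C1 * w s ^ (2 * B + 1)"
          using y(2) by blast
        have "u ^ B * s ^ B = 1"
          using \<open>u \<noteq> 0\<close> by (simp add: s_def power_mult_distrib[symmetric])
        then have "y - f1 \<phi> u = u ^ B * (s ^ B * y - poly \<phi> s)"
          by (simp add: f1_def s_def[symmetric] right_diff_distrib mult.assoc[symmetric])
        then have "w (y - f1 \<phi> u) = w u ^ B * w (s ^ B * y - poly \<phi> s)"
          by (simp add: W(3,9))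
        also have "\<dots> \<le> w u ^ B * (C * w s ^ (2 * B + 1))"
          using \<phi>(2) C W(1) by (intro mult_left_mono order_trans[OF \<phi>(2)] mult_right_mono) auto
        also have "\<dots> = C * (w u ^ B * w s ^ B) * w s ^ (B + 1)"
        proof -
          have "w s ^ (2 * B + 1) = w s ^ B * w s ^ (B + 1)"
            by (simp add: power_add mult_2)
          then show ?thesis
            by (simp only: mult_ac)
        qed
        also have "\<dots> = C * inverse (w u) ^ (B + 1)"
          unfolding su by (simp add: s_def W(10))
        finally show "\<exists>f\<in>\<Phi>. w (y - f u) \<le> C * inverse (w u) ^ (B + 1)"
          using \<phi>(1) unfolding \<Phi>_def by (intro bexI[of _ "f1 \<phi>"]) auto
      }
    qed (use C in simp)
  qed
  then show ?thesis
    using M(1) laur \<open>finite \<Phi>\<close> by blast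
qed

text \<open>Trace and norm of two roots are approximated by sums and products of the approximations
  of the roots. With \<open>u = t^j\<close> an error of size \<open>w u\<close> or its inverse is
  exponential in \<open>j\<close>; where \<open>w t = 1\<close> only a bound remains.\<close>

lemma symmetric_approximation:
  fixes g :: "'a::{alg_closed_field, field_gcd, field_char_0} poly poly"
  assumes g: "lead_coeff g = 1" "degree g = n" "n > 0" and \<beta>: "\<beta> \<noteq> 0"
  shows "\<exists>M>0. \<exists>E \<Psi>. finite \<Psi> \<and> (\<forall>f\<in>\<Psi>. laurent E f) \<and> (\<forall>w t. absval w \<longrightarrow> t \<noteq> 0 \<longrightarrow>
    (\<exists>C \<rho>. C \<ge> 0 \<and> 0 < \<rho> \<and> \<rho> < 1 \<and> (\<forall>j y z. poly (poly g [:y:]) (\<alpha> + \<beta> * (t ^ j) ^ M) = 0 \<longrightarrow>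
      poly (poly g [:z:]) (\<alpha> + \<beta> * (t ^ j) ^ M) = 0 \<longrightarrow>
      (w t \<noteq> 1 \<longrightarrow> (\<exists>f\<in>\<Psi>. w (y + z - f (t ^ j)) \<le> C * \<rho> ^ j) \<and>
          (\<exists>f\<in>\<Psi>. w (y * z - f (t ^ j)) \<le> C * \<rho> ^ j)) \<and>
      (w t = 1 \<longrightarrow> w (y + z) \<le> C \<and> w (y * z) \<le> C))))"
proof -
  obtain M E B \<Phi> where M: "M > 0" and \<Phi>: "finite \<Phi>" "\<And>f. f \<in> \<Phi> \<Longrightarrow> laurent E f"
    and approx: "\<And>w. absval w \<Longrightarrow>
    \<exists>C\<ge>0. \<forall>u y. u \<noteq> 0 \<longrightarrow> poly (poly g [:y:]) (\<alpha> + \<beta> * u ^ M) = 0 \<longrightarrow>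
      (w u \<le> 1 \<longrightarrow> w y \<le> C \<and> (\<exists>f\<in>\<Phi>. w (y - f u) \<le> C * w u)) \<and>
      (w u \<ge> 1 \<longrightarrow> w y \<le> C * w u ^ B \<and> (\<exists>f\<in>\<Phi>. w (y - f u) \<le> C * inverse (w u) ^ (B + 1)))"
    using root_approximation[OF assms, of \<alpha>] by blast
  define \<Psi> where "\<Psi> = (\<lambda>(f, h). (\<lambda>u. f u + h u)) ` (\<Phi> \<times> \<Phi>) \<union> (\<lambda>(f, h). (\<lambda>u. f u * h u)) ` (\<Phi> \<times> \<Phi>)"
  have "finite \<Psi>"
    using \<Phi>(1) by (simp add: \<Psi>_def)
  have laur: "\<forall>f\<in>\<Psi>. laurent (2 * E) f"
    using laurent_add[OF \<Phi>(2) \<Phi>(2)] laurent_mult[OF \<Phi>(2) \<Phi>(2)] by (auto simp: \<Psi>_def)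
  have "\<exists>C \<rho>. C \<ge> 0 \<and> 0 < \<rho> \<and> \<rho> < 1 \<and> (\<forall>j y z. poly (poly g [:y:]) (\<alpha> + \<beta> * (t ^ j) ^ M) = 0 \<longrightarrow>
      poly (poly g [:z:]) (\<alpha> + \<beta> * (t ^ j) ^ M) = 0 \<longrightarrow>
      (w t \<noteq> 1 \<longrightarrow> (\<exists>f\<in>\<Psi>. w (y + z - f (t ^ j)) \<le> C * \<rho> ^ j) \<and>
          (\<exists>f\<in>\<Psi>. w (y * z - f (t ^ j)) \<le> C * \<rho> ^ j)) \<and>
      (w t = 1 \<longrightarrow> w (y + z) \<le> C \<and> w (y * z) \<le> C))"
    if w: "absval w" and "t \<noteq> 0" for w t
  proof -
    note W = absvalD[OF w]
    obtain C where C: "C \<ge> 0" and ap: "\<And>u y. u \<noteq> 0 \<Longrightarrow> poly (poly g [:y:]) (\<alpha> + \<beta> * u ^ M) = 0 \<Longrightarrow>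
      (w u \<le> 1 \<longrightarrow> w y \<le> C \<and> (\<exists>f\<in>\<Phi>. w (y - f u) \<le> C * w u)) \<and>
      (w u \<ge> 1 \<longrightarrow> w y \<le> C * w u ^ B \<and> (\<exists>f\<in>\<Phi>. w (y - f u) \<le> C * inverse (w u) ^ (B + 1)))"
      using approx[OF w] by blast
    have wt: "w t > 0"
      using \<open>t \<noteq> 0\<close> W(1,2)[of t] by (simp add: less_le)
    \<comment> \<open>The value \<open>1 / 2\<close> is a placeholder for \<open>w t = 1\<close>,
      where no decay is claimed.\<close>
    define \<rho> where "\<rho> = (if w t = 1 then 1 / 2 else if w t < 1 then w t else inverse (w t))"
    define C' where "C' = 2 * C + 3 * C ^ 2"
    have \<rho>: "0 < \<rho>" "\<rho> < 1"
      using wt by (auto simp: \<rho>_def one_less_inverse_iff inverse_less_1_iff)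
    have C': "C' \<ge> 0" "2 * C \<le> C'" "3 * C ^ 2 \<le> C'"
      using C by (auto simp: C'_def)
    \<comment> \<open>Up to the factor \<open>C\<close>, \<open>U\<close> bounds the roots and
      \<open>\<epsilon>\<close> the errors. The product is split as
      \<open>y * z - f * h = y * (z - h) + (y - f) * h\<close>, so \<open>\<epsilon> * U\<close> has
      to be small.\<close>
    have pair: "\<exists>f\<in>\<Psi>. w (y + z - f u) \<le> C' * \<delta>" "\<exists>f\<in>\<Psi>. w (y * z - f u) \<le> C' * \<delta>"
      if "f \<in> \<Phi>" "h \<in> \<Phi>" "w y \<le> C * U" "w z \<le> C * U" "w (y - f u) \<le> C * \<epsilon>" "w (z - h u) \<le> C * \<epsilon>"
        "0 \<le> \<epsilon>" "\<epsilon> \<le> U" "\<epsilon> \<le> \<delta>" "\<epsilon> * U \<le> \<delta>" for f h y z u U \<epsilon> \<delta>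
    proof -
      have "w (y + z - (f u + h u)) \<le> w (y - f u) + w (z - h u)"
        using W(4)[of "y - f u" "z - h u"] by (simp add: algebra_simps)
      also have "\<dots> \<le> 2 * C * \<epsilon>"
        using that by simp
      also have "\<dots> \<le> C' * \<delta>"
        using that C C' by (intro mult_mono) auto
      finally show "\<exists>f\<in>\<Psi>. w (y + z - f u) \<le> C' * \<delta>"
        unfolding \<Psi>_def using that(1,2) by (intro bexI[of _ "\<lambda>u. f u + h u"]) auto
      have "w (h u) \<le> w z + w (z - h u)"
        using W(8)[of z "z - h u"] by simp
      also have "\<dots> \<le> C * U + C * U"
        using that C mult_left_mono[of \<epsilon> U C] by linarith
      finally have hu: "w (h u) \<le> 2 * C * U"
        by simp
      have "w (y * z - f u * h u) \<le> w (y * (z - h u)) + w ((y - f u) * h u)"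
        using W(4)[of "y * (z - h u)" "(y - f u) * h u"] by (simp add: algebra_simps)
      also have "\<dots> \<le> (C * U) * (C * \<epsilon>) + (C * \<epsilon>) * (2 * C * U)"
        unfolding W(3) using that hu C W(1) by (intro add_mono mult_mono) auto
      also have "\<dots> = 3 * C ^ 2 * (\<epsilon> * U)"
        by (simp add: power2_eq_square algebra_simps)
      also have "\<dots> \<le> C' * \<delta>"
        using that C C' by (intro mult_mono) auto
      finally show "\<exists>f\<in>\<Psi>. w (y * z - f u) \<le> C' * \<delta>"
        unfolding \<Psi>_def using that(1,2) by (intro bexI[of _ "\<lambda>u. f u * h u"]) auto
    qed
    have "(w t \<noteq> 1 \<longrightarrow> (\<exists>f\<in>\<Psi>. w (y + z - f (t ^ j)) \<le> C' * \<rho> ^ j) \<and>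
        (\<exists>f\<in>\<Psi>. w (y * z - f (t ^ j)) \<le> C' * \<rho> ^ j)) \<and>
      (w t = 1 \<longrightarrow> w (y + z) \<le> C' \<and> w (y * z) \<le> C')"
      if roots: "poly (poly g [:y:]) (\<alpha> + \<beta> * (t ^ j) ^ M) = 0"
        "poly (poly g [:z:]) (\<alpha> + \<beta> * (t ^ j) ^ M) = 0" for j y z
    proof (intro conjI impI)
      have u0: "t ^ j \<noteq> 0"
        using \<open>t \<noteq> 0\<close> by simp
      note ay = ap[OF u0 roots(1)] and az = ap[OF u0 roots(2)]
      have wu: "w (t ^ j) = w t ^ j"
        by (rule W)
      {
        assume "w t \<noteq> 1"
        have "(\<exists>f\<in>\<Psi>. w (y + z - f (t ^ j)) \<le> C' * \<rho> ^ j) \<and>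
            (\<exists>f\<in>\<Psi>. w (y * z - f (t ^ j)) \<le> C' * \<rho> ^ j)"
        proof (cases "w t < 1")
          case True
          then have u1: "w (t ^ j) \<le> 1"
            unfolding wu using wt by (simp add: power_le_one)
          obtain f h where "f \<in> \<Phi>" "h \<in> \<Phi>" "w (y - f (t ^ j)) \<le> C * w (t ^ j)" "w (z - h (t ^ j))
              \<le> C * w (t ^ j)"
            using ay az u1 by blast
          then show ?thesis
            using pair[of f h y 1 z "t ^ j" "w (t ^ j)" "\<rho> ^ j"] ay az u1 True W(1)
              by (simp add: \<rho>_def wu)
        next
          case False
          then have u1: "w (t ^ j) \<ge> 1"
            unfolding wu by simp
          obtain f h where fh: "f \<in> \<Phi>" "h \<in> \<Phi>" "w (y - f (t ^ j))
              \<le> C * inverse (w (t ^ j)) ^ (B + 1)"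
            "w (z - h (t ^ j)) \<le> C * inverse (w (t ^ j)) ^ (B + 1)"
            using ay az u1 by blast
          define v where "v = inverse (w (t ^ j))"
          have v: "0 < v" "v \<le> 1"
            using u1 by (auto simp: v_def inverse_le_1_iff)
          have "v ^ (B + 1) \<le> v ^ 1"
            using v by (intro power_decreasing) auto
          moreover have "v ^ (B + 1) * w (t ^ j) ^ B = v"
            using u1 by (simp add: v_def power_mult_distrib[symmetric] mult.assoc)
          moreover have "v ^ (B + 1) \<le> w (t ^ j) ^ B"
            using power_le_one[of v "B + 1"] v one_le_power[OF u1, of B] by linarith
          moreover have "\<rho> ^ j = v"
            using False \<open>w t \<noteq> 1\<close> by (simp add: \<rho>_def v_def wu power_inverse)
          ultimately show ?thesis
            using pair[of f h y "w (t ^ j) ^ B" z "t ^ j" "v ^ (B + 1)" "\<rho> ^ j"] ay az u1 fh v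
            by (simp add: v_def)
        qed
        then show "\<exists>f\<in>\<Psi>. w (y + z - f (t ^ j)) \<le> C' * \<rho> ^ j" "\<exists>f\<in>\<Psi>. w (y * z - f (t ^ j))
            \<le> C' * \<rho> ^ j"
          by (rule conjunct1, rule conjunct2)
      }
      {
        assume "w t = 1"
        then have "w y \<le> C" "w z \<le> C"
          using ay az wu by simp_all
        then have "w (y + z) \<le> 2 * C" "w (y * z) \<le> C * C"
          using W(4)[of y z] W(1) C by (auto simp: W(3) intro!: mult_mono)
        moreover have "C * C \<le> 3 * C ^ 2"
          by (simp add: power2_eq_square)
        ultimately show "w (y + z) \<le> C'" "w (y * z) \<le> C'"
          using C' by linarith+
      }
    qed
    then show ?thesis
      using \<rho> C'(1) by blast
  qed
  then show ?thesis
    using M \<open>finite \<Psi>\<close> laur by blast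
qed

section \<open>Divided differences\<close>

lemma lagrange_interpolation:
  fixes h F :: "'i \<Rightarrow> 'a::field"
  assumes D: "finite D" "D \<noteq> {}" "inj_on h D"
  obtains L where "degree L < card D" "\<And>i. i \<in> D \<Longrightarrow> poly L (h i) = F i"
    "coeff L (card D - 1) = (\<Sum>i\<in>D. F i / (\<Prod>j\<in>D - {i}. h i - h j))"
proof -
  define Q where "Q i = (\<Prod>j\<in>D - {i}. [:- h j, 1:])" for i
  define L where "L = (\<Sum>i\<in>D. smult (F i / (\<Prod>j\<in>D - {i}. h i - h j)) (Q i))"
  have Qdeg: "degree (Q i) = card D - 1" and Qlead: "lead_coeff (Q i) = 1" if "i \<in> D" for i
  proof -
    show "degree (Q i) = card D - 1"
      unfolding Q_def using that D by (subst degree_prod_eq_sum_degree) auto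
    show "lead_coeff (Q i) = 1"
      unfolding Q_def lead_coeff_prod by simp
  qed
  have cD: "card D > 0" using D by (simp add: card_gt_0_iff)
  have Qval: "poly (Q i) (h j) = (if i = j then (\<Prod>j\<in>D - {i}. h i - h j) else 0)"
    if "i \<in> D" "j \<in> D" for i j
  proof (cases "i = j")
    case False
    then have "\<exists>l\<in>D - {i}. h j - h l = 0" using that by auto
    then show ?thesis using False D(1) unfolding Q_def poly_prod
      by (simp add: prod_zero_iff)
  qed (simp add: Q_def poly_prod)
  have ne: "(\<Prod>j\<in>D - {i}. h i - h j) \<noteq> 0" if "i \<in> D" for i
    using that D by (auto simp: prod_zero_iff inj_on_eq_iff)
  show thesis
  proof (rule that)
    have "degree L \<le> card D - 1"
      unfolding L_def
    proof (rule degree_sum_le[OF D(1)])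
      fix i assume "i \<in> D"
      then show "degree (smult (F i / (\<Prod>j\<in>D - {i}. h i - h j)) (Q i)) \<le> card D - 1"
        using degree_smult_le[of _ "Q i"] Qdeg[of i] by metis
    qed
    then show "degree L < card D" using cD by linarith
    show "poly L (h j) = F j" if j: "j \<in> D" for j
    proof -
      have "poly L (h j) = (\<Sum>i\<in>D. if i = j then F j else 0)"
        unfolding L_def poly_sum poly_smult
        by (rule sum.cong) (use j ne in \<open>auto simp: Qval\<close>)
      also have "\<dots> = F j" using D(1) j by simp
      finally show ?thesis .
    qed
    show "coeff L (card D - 1) = (\<Sum>i\<in>D. F i / (\<Prod>j\<in>D - {i}. h i - h j))"
      unfolding L_def coeff_sum coeff_smult
    proof (rule sum.cong[OF refl])
      fix i assume "i \<in> D"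
      then have "coeff (Q i) (card D - 1) = 1" using Qdeg Qlead by metis
      then show "F i / (\<Prod>j\<in>D - {i}. h i - h j) * coeff (Q i) (card D - 1)
          = F i / (\<Prod>j\<in>D - {i}. h i - h j)"
        by simp
    qed
  qed
qed

lemma poly_eq_on_indexed:
  fixes p q :: "'a::field poly"
  assumes "finite D" "inj_on h D" "degree p < card D" "degree q < card D"
    and "\<And>i. i \<in> D \<Longrightarrow> poly p (h i) = poly q (h i)"
  shows "p = q"
proof (rule ccontr)
  assume "p \<noteq> q"
  then have ne: "p - q \<noteq> 0" by simp
  have "card D = card (h ` D)" using assms(2) by (simp add: card_image)
  also have "\<dots> \<le> card {x. poly (p - q) x = 0}"
    using assms(5) by (intro card_mono poly_roots_finite[OF ne]) auto
  also have "\<dots> \<le> degree (p - q)" by (rule card_poly_roots_bound[OF ne])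
  also have "\<dots> < card D" using assms(3,4) by (rule degree_diff_less)
  finally show False by simp
qed

text \<open>The polynomial is its own interpolant, and its coefficient of degree
  \<open>card D - 1\<close> is zero.\<close>

lemma divided_difference_poly:
  fixes h :: "'i \<Rightarrow> 'a::field"
  assumes D: "finite D" "inj_on h D" "Suc (degree p) < card D"
  shows "(\<Sum>i\<in>D. poly p (h i) / (\<Prod>j\<in>D - {i}. h i - h j)) = 0"
proof -
  have "D \<noteq> {}" using D by auto
  then show ?thesis
  proof (rule lagrange_interpolation[OF D(1) _ D(2), of "\<lambda>i. poly p (h i)"])
    fix L
    assume L: "degree L < card D" "\<And>i. i \<in> D \<Longrightarrow> poly L (h i) = poly p (h i)"
      "coeff L (card D - 1) = (\<Sum>i\<in>D. poly p (h i) / (\<Prod>j\<in>D - {i}. h i - h j))"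
    have "L = p" using L(1,2) D by (intro poly_eq_on_indexed[OF D(1,2)]) auto
    then have "coeff L (card D - 1) = 0" using D(3) by (intro coeff_eq_0) auto
    then show ?thesis using L(3) by simp
  qed
qed

text \<open>Interpolate at \<open>N + 1\<close> of the points. In the divided difference of the
  deviation over these and one further point, only the summand of the new point is left, so its
  vanishing gives the value there.\<close>

lemma interpolation_criterion:
  fixes h F :: "'i \<Rightarrow> 'a::field"
  assumes S: "finite S" "inj_on h S"
    and dd: "\<And>D. D \<subseteq> S \<Longrightarrow> card D = N + 2 \<Longrightarrow> (\<Sum>i\<in>D. F i / (\<Prod>j\<in>D - {i}. h i - h j)) = 0"
  obtains p where "degree p \<le> N" "\<And>i. i \<in> S \<Longrightarrow> poly p (h i) = F i"
proof -
  consider "S = {}" | "S \<noteq> {}" "card S \<le> Suc N" | "Suc N \<le> card S" by linarith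
  then show thesis
  proof cases
    case 1
    then show thesis by (intro that[of 0]) auto
  next
    case 2
    obtain L where L: "degree L < card S" "\<And>i. i \<in> S \<Longrightarrow> poly L (h i) = F i"
      using lagrange_interpolation[OF S(1) 2(1) S(2), of F] by metis
    show thesis by (rule that[of L]) (use L 2 in auto)
  next
    case 3
    then obtain T where T: "T \<subseteq> S" "card T = Suc N" "finite T"
      by (meson obtain_subset_with_card_n)
    have injT: "inj_on h T" using S(2) T(1) by (rule inj_on_subset)
    have "T \<noteq> {}" using T(2) by auto
    then obtain L where L: "degree L < card T" "\<And>i. i \<in> T \<Longrightarrow> poly L (h i) = F i"
      using lagrange_interpolation[OF T(3) _ injT, of F] by metis
    have "poly L (h s) = F s" if s: "s \<in> S" "s \<notin> T" for s
    proof -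
      let ?D = "insert s T"
      have cD: "card ?D = N + 2" using s T by simp
      have D: "finite ?D" "?D \<subseteq> S" using T s by auto
      have inj: "inj_on h ?D" using S(2) D(2) by (rule inj_on_subset)
      have "(\<Sum>i\<in>?D. F i / (\<Prod>j\<in>?D - {i}. h i - h j)) - (\<Sum>i\<in>?D. poly L (h i) / (\<Prod>j\<in>?D - {i}. h i - h
          j)) = 0"
        using dd[OF D(2) cD] divided_difference_poly[OF D(1) inj, of L] L(1) T(2) cD by simp
      then have "(\<Sum>i\<in>?D. (F i - poly L (h i)) / (\<Prod>j\<in>?D - {i}. h i - h j)) = 0"
        by (simp add: sum_subtractf diff_divide_distrib)
      then have "(F s - poly L (h s)) / (\<Prod>j\<in>?D - {s}. h s - h j) = 0"
        using s T L(2) by simp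
      moreover have "(\<Prod>j\<in>?D - {s}. h s - h j) \<noteq> 0"
        using D(1) inj by (auto simp: prod_zero_iff inj_on_eq_iff)
      ultimately show ?thesis by simp
    qed
    then show thesis using L T by (intro that[of L]) auto
  qed
qed

text \<open>
  The weights are divided-difference coefficients with their denominators cleared, so that they
  are integral wherever \<open>t\<close> is.
\<close>

definition dd_weight :: "'a::field \<Rightarrow> nat \<Rightarrow> nat set \<Rightarrow> nat \<Rightarrow> 'a" where
  "dd_weight t E D i = t ^ (E * i) * (\<Prod>x\<in>D - {i}. \<Prod>y\<in>D - {x}. t ^ x - t ^ y)"

lemma dd_weight_sum:
  fixes t :: "'a::field"
  assumes D: "finite D" and inj: "inj ((^) t)"
  shows "(\<Sum>i\<in>D. dd_weight t E D i * a i) =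
    (\<Prod>x\<in>D. \<Prod>y\<in>D - {x}. t ^ x - t ^ y) * (\<Sum>i\<in>D. t ^ (E * i) * a i / (\<Prod>j\<in>D - {i}. t ^ i - t ^ j))"
    and "(\<Prod>x\<in>D. \<Prod>y\<in>D - {x}. t ^ x - t ^ y) \<noteq> 0"
proof -
  have ne: "(\<Prod>y\<in>D - {x}. t ^ x - t ^ y) \<noteq> 0" for x
    using D inj_eq[OF inj] by (auto simp: prod_zero_iff)
  then show "(\<Prod>x\<in>D. \<Prod>y\<in>D - {x}. t ^ x - t ^ y) \<noteq> 0"
    using D by (simp add: prod_zero_iff)
  show "(\<Sum>i\<in>D. dd_weight t E D i * a i) =
    (\<Prod>x\<in>D. \<Prod>y\<in>D - {x}. t ^ x - t ^ y) * (\<Sum>i\<in>D. t ^ (E * i) * a i / (\<Prod>j\<in>D - {i}. t ^ i - t ^ j))"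
    unfolding sum_distrib_left
  proof (rule sum.cong[OF refl])
    fix i assume "i \<in> D"
    then have "(\<Prod>x\<in>D. \<Prod>y\<in>D - {x}. t ^ x - t ^ y) =
      (\<Prod>y\<in>D - {i}. t ^ i - t ^ y) * (\<Prod>x\<in>D - {i}. \<Prod>y\<in>D - {x}. t ^ x - t ^ y)"
      using D by (rule prod.remove[rotated])
    then show "dd_weight t E D i * a i = (\<Prod>x\<in>D. \<Prod>y\<in>D - {x}. t ^ x - t ^ y) *
      (t ^ (E * i) * a i / (\<Prod>j\<in>D - {i}. t ^ i - t ^ j))"
      using ne[of i] by (simp add: dd_weight_def field_simps)
  qed
qed

text \<open>\<open>u^E * f\<close> is a polynomial of degree at most \<open>2 * E\<close>, so
  divided differences over \<open>2 * E + 2\<close> nodes annihilate it. Passing from the nodes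
  \<open>t^i\<close> to \<open>t^(j + i)\<close> merely rescales the variable; hence the same
  weights work for every \<open>j\<close>.\<close>

lemma dd_weight_laurent:
  fixes t :: "'a::field"
  assumes D: "finite D" "card D = 2 * E + 2" and t: "t \<noteq> 0" "inj ((^) t)" and f: "laurent E f"
  shows "(\<Sum>i\<in>D. dd_weight t E D i * f (t ^ (j + i))) = 0"
proof -
  obtain p where p: "degree p \<le> 2 * E" "\<And>u. u \<noteq> 0 \<Longrightarrow> u ^ E * f u = poly p u"
    using f unfolding laurent_def by blast
  define q where "q = smult (inverse (t ^ (E * j))) (pcompose p [:0, t ^ j:])"
  have "degree (pcompose p [:0, t ^ j:]) \<le> degree p * 1"
    by (rule order_trans[OF degree_pcompose_le mult_le_mono2]) simp
  then have "degree q \<le> degree p" unfolding q_def using degree_smult_le le_trans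
    by (metis mult.right_neutral)
  then have "Suc (degree q) < card D" using p D by simp
  then have "(\<Sum>i\<in>D. poly q (t ^ i) / (\<Prod>j\<in>D - {i}. t ^ i - t ^ j)) = 0"
    using D t by (intro divided_difference_poly) (auto intro: inj_on_subset)
  moreover have "poly q (t ^ i) = t ^ (E * i) * f (t ^ (j + i))" for i
  proof -
    have "poly p (t ^ (j + i)) = (t ^ (j + i)) ^ E * f (t ^ (j + i))" using p(2) t by simp
    also have "(t ^ (j + i)) ^ E = t ^ (E * j) * t ^ (E * i)"
      by (simp only: power_mult[symmetric] power_add[symmetric] distrib_right mult.commute[of E])
    finally show ?thesis using t
      by (simp add: q_def poly_pcompose power_add mult.assoc mult.commute[of "t ^ i"])
  qed
  ultimately show ?thesis using dd_weight_sum(1)[OF D(1) t(2)] by simp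
qed

lemma dd_weight_in:
  assumes R: "is_subring R" and "t \<in> R"
  shows "dd_weight t E D i \<in> R"
  unfolding dd_weight_def
  by (intro is_subringD(4)[OF R] is_subringD(11)[OF R] is_subringD(6)[OF R] is_subringD(7)[OF R]
      assms(2))

lemma to_ac_dd_weight: "to_ac (dd_weight t E D i) = dd_weight (to_ac t) E D i"
  unfolding dd_weight_def by (simp add: to_ac_hom.hom_prod)

lemma not_root_of_unity_inj:
  fixes t :: "'a::field"
  assumes "t \<noteq> 0" "\<And>n. n > 0 \<Longrightarrow> t ^ n \<noteq> 1"
  shows "inj ((^) t)"
proof (rule linorder_injI)
  fix m n :: nat assume "m < n"
  then have "t ^ n = t ^ m * t ^ (n - m)" by (simp flip: power_add)
  then show "t ^ m \<noteq> t ^ n" using assms \<open>m < n\<close>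
    by (metis mult_cancel_left1 power_not_zero zero_less_diff)
qed

section \<open>Vanishing by the product formula and interpolation on one colour\<close>

lemma weighted_sum_vanishes:
  fixes a :: "nat \<Rightarrow> 'k::field_char_0" and I :: "'i set" and col :: "nat \<Rightarrow> 'i \<Rightarrow> 'k alg_closure \<Rightarrow> 'k
      alg_closure"
  assumes I: "finite I" "\<And>i. i \<in> I \<Longrightarrow> absval (w i)" and R: "is_subring R"
    and product: "\<And>y. y \<noteq> 0 \<Longrightarrow> to_ac y \<in> R \<Longrightarrow> (\<Prod>i\<in>I. w i (to_ac y)) \<ge> 1"
    and t: "t \<noteq> 0" "inj ((^) t)" "to_ac t \<in> R" "i0 \<in> I" "w i0 (to_ac t) \<noteq> 1"
    and a: "\<And>j. to_ac (a j) \<in> R"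
    and col: "\<And>i j. i \<in> I \<Longrightarrow> laurent E (col j i)"
    and approx: "\<And>i. i \<in> I \<Longrightarrow> \<exists>C \<rho>. C \<ge> 0 \<and> 0 < \<rho> \<and> \<rho> < 1 \<and>
      (\<forall>j. (w i (to_ac t) \<noteq> 1 \<longrightarrow> w i (to_ac (a j) - col j i (to_ac t ^ j)) \<le> C * \<rho> ^ j) \<and>
           (w i (to_ac t) = 1 \<longrightarrow> w i (to_ac (a j)) \<le> C))"
  shows "\<exists>j0. \<forall>j\<ge>j0. \<forall>D\<subseteq>{..r}. card D = 2 * E + 2 \<longrightarrow>
    (\<forall>i\<in>I. \<forall>m\<in>D. \<forall>n\<in>D. col (j + m) i = col (j + n) i) \<longrightarrow>
    (\<Sum>m\<in>D. dd_weight t E D m * a (j + m)) = 0"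
proof -
  obtain C \<rho> where C: "\<And>i. i \<in> I \<Longrightarrow> C i \<ge> 0" and \<rho>: "\<And>i. i \<in> I \<Longrightarrow> 0 < \<rho> i \<and> \<rho> i < 1"
    and far: "\<And>i j. i \<in> I \<Longrightarrow> w i (to_ac t) \<noteq> 1 \<Longrightarrow>
        w i (to_ac (a j) - col j i (to_ac t ^ j)) \<le> C i * \<rho> i ^ j"
    and near: "\<And>i j. i \<in> I \<Longrightarrow> w i (to_ac t) = 1 \<Longrightarrow> w i (to_ac (a j)) \<le> C i"
    using approx by metis
  \<comment> \<open>The weights depend on \<open>D\<close> but not on \<open>j\<close>, so
    \<open>Q\<close> bounds them for all subsets of \<open>{..r}\<close> at once; this makes the
    threshold \<open>j0\<close> uniform.\<close>
  define Q where "Q i = (\<Sum>D\<in>Pow {..r}. \<Sum>m\<in>D. w i (to_ac (dd_weight t E D m)))" for i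
  define B where "B = (\<Prod>i\<in>I. Q i * C i)"
  have wpos: "w i x \<ge> 0" if "i \<in> I" for i x using absvalD(1)[OF I(2)[OF that]] .
  have Q0: "Q i \<ge> 0" if "i \<in> I" for i unfolding Q_def by (intro sum_nonneg wpos that)
  have "(\<lambda>j. B * \<rho> i0 ^ j) \<longlonglongrightarrow> B * 0"
    using \<rho>[OF t(4)] by (intro tendsto_intros) auto
  then have "eventually (\<lambda>j. B * \<rho> i0 ^ j < 1) sequentially"
    by (rule order_tendstoD) simp
  then obtain j0 where j0: "\<And>j. j \<ge> j0 \<Longrightarrow> B * \<rho> i0 ^ j < 1"
    unfolding eventually_sequentially by blast
  have tac: "to_ac t \<noteq> 0" "inj ((^) (to_ac t))"
    using t(1,2) by (auto simp: inj_def simp flip: to_ac_power)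
  show ?thesis
  proof (intro exI[of _ j0] allI impI)
    fix j D assume j: "j \<ge> j0" and D: "D \<subseteq> {..r}" and cD: "card D = 2 * E + 2"
      and mono: "\<forall>i\<in>I. \<forall>m\<in>D. \<forall>n\<in>D. col (j + m) i = col (j + n) i"
    have fD: "finite D" using D finite_subset by blast
    define b where "b = (\<Sum>m\<in>D. dd_weight t E D m * a (j + m))"
    have bR: "to_ac b \<in> R"
      unfolding b_def to_ac_sum to_ac_mult to_ac_dd_weight
      by (intro is_subringD(10,4)[OF R] dd_weight_in[OF R] t a)
    have main: "w i (to_ac b) \<le> Q i * C i * (if i = i0 then \<rho> i0 ^ j else 1)" if i: "i \<in> I" for i
    proof -
      note W = absvalD[OF I(2)[OF i]]
      let ?e = "if w i (to_ac t) = 1 then 1 else \<rho> i ^ j"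
      have e0: "?e \<ge> 0" and e1: "?e \<le> (if i = i0 then \<rho> i0 ^ j else 1)"
        using \<rho>[OF i] t(5) by (auto intro: power_le_one)
      have "\<exists>c. to_ac b = (\<Sum>m\<in>D. to_ac (dd_weight t E D m) * c m) \<and> (\<forall>m\<in>D. w i (c m) \<le> C i * ?e)"
      proof (cases "w i (to_ac t) = 1")
        case True
        then show ?thesis
          by (intro exI[of _ "\<lambda>m. to_ac (a (j + m))"]) (simp add: b_def to_ac_sum near i)
      next
        case False
        have "D \<noteq> {}" using cD by auto
        then obtain m0 where m0: "m0 \<in> D" by blast
        \<comment> \<open>On \<open>D\<close> the approximating Laurent polynomial is the same for
          all indices, so the weights annihilate it and only the errors remain.\<close>
        define f where "f = col (j + m0) i"
        have f: "laurent E f" "\<And>m. m \<in> D \<Longrightarrow> col (j + m) i = f"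
          using col i mono m0 unfolding f_def by blast+
        have "(\<Sum>m\<in>D. to_ac (dd_weight t E D m) * f (to_ac t ^ (j + m))) = 0"
          unfolding to_ac_dd_weight by (rule dd_weight_laurent[OF fD cD tac f(1)])
        then have "to_ac b = (\<Sum>m\<in>D. to_ac (dd_weight t E D m) * (to_ac (a (j + m)) - f (to_ac t ^ (j
            + m))))"
          by (simp add: b_def to_ac_sum right_diff_distrib sum_subtractf)
        moreover have "w i (to_ac (a (j + m)) - f (to_ac t ^ (j + m))) \<le> C i * ?e"
            if m: "m \<in> D" for m
        proof -
          have "w i (to_ac (a (j + m)) - f (to_ac t ^ (j + m))) \<le> C i * \<rho> i ^ (j + m)"
            using far[OF i False, of "j + m"] f(2)[OF m] by simp
          also have "\<rho> i ^ (j + m) \<le> \<rho> i ^ j" using \<rho>[OF i] by (intro power_decreasing) auto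
          finally show ?thesis using False C[OF i] by (simp add: mult_left_mono)
        qed
        ultimately show ?thesis
          by (intro exI[of _ "\<lambda>m. to_ac (a (j + m)) - f (to_ac t ^ (j + m))"] conjI ballI)
      qed
      then obtain c where c: "to_ac b = (\<Sum>m\<in>D. to_ac (dd_weight t E D m) * c m)" "\<forall>m\<in>D. w i (c m)
          \<le> C i * ?e"
        by blast
      have "w i (to_ac b) \<le> (\<Sum>m\<in>D. w i (to_ac (dd_weight t E D m) * c m))"
        unfolding c(1) by (rule W)
      also have "\<dots> \<le> (\<Sum>m\<in>D. w i (to_ac (dd_weight t E D m)) * (C i * ?e))"
        unfolding W(3) using c(2) W(1) by (intro sum_mono mult_left_mono) auto
      also have "\<dots> = (\<Sum>m\<in>D. w i (to_ac (dd_weight t E D m))) * (C i * ?e)"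
        by (simp only: sum_distrib_right)
      also have "\<dots> \<le> Q i * (C i * ?e)"
      proof (rule mult_right_mono)
        show "(\<Sum>m\<in>D. w i (to_ac (dd_weight t E D m))) \<le> Q i"
          unfolding Q_def using D
          by (intro member_le_sum[of D "Pow {..r}" "\<lambda>D. \<Sum>m\<in>D. w i (to_ac (dd_weight t E D m))"])
             (auto intro!: sum_nonneg W(1))
        show "C i * ?e \<ge> 0" using C[OF i] e0 by (rule mult_nonneg_nonneg)
      qed
      also have "\<dots> \<le> Q i * (C i * (if i = i0 then \<rho> i0 ^ j else 1))"
        using Q0[OF i] C[OF i] e1 by (intro mult_left_mono)
      finally show ?thesis by (simp only: mult.assoc)
    qed
    have "b = 0"
    proof (rule ccontr)
      assume "b \<noteq> 0"
      then have "1 \<le> (\<Prod>i\<in>I. w i (to_ac b))" using product bR by blast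
      also have "\<dots> \<le> (\<Prod>i\<in>I. Q i * C i * (if i = i0 then \<rho> i0 ^ j else 1))"
        using main wpos by (intro prod_mono) auto
      also have "\<dots> = B * \<rho> i0 ^ j"
        using I(1) t(4) by (simp add: prod.distrib B_def)
      also have "\<dots> < 1" by (rule j0[OF j])
      finally show False by simp
    qed
    then show "(\<Sum>m\<in>D. dd_weight t E D m * a (j + m)) = 0" unfolding b_def .
  qed
qed

lemma monochromatic_subset:
  fixes k :: "'i \<Rightarrow> 'c"
  assumes "finite P" "finite T" "k ` T \<subseteq> P" "card T > K * card P"
  obtains c where "c \<in> P" "card {x \<in> T. k x = c} > K"
proof (rule ccontr)
  assume no: "\<not> thesis"
  have "card T = (\<Sum>c\<in>P. card {x \<in> T. k x = c})"
    using sum.group[OF assms(2,1,3), of "\<lambda>_. 1::nat"] by simp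
  also have "\<dots> \<le> (\<Sum>c\<in>P. K)" using no that by (intro sum_mono) (meson not_le)
  finally show False using assms(4) by (simp add: mult.commute)
qed

text \<open>Vanishing divided differences give an interpolating polynomial in \<open>t^m\<close>;
  the substitution \<open>t^m = u / t^j\<close> turns it into one in
  \<open>u = t^(j + m)\<close>.\<close>

lemma laurent_from_vanishing:
  fixes t :: "'k::field" and a :: "nat \<Rightarrow> 'k"
  assumes t: "t \<noteq> 0" "inj ((^) t)" and S: "finite S"
    and vanish: "\<And>D. D \<subseteq> S \<Longrightarrow> card D = 2 * E + 2 \<Longrightarrow> (\<Sum>m\<in>D. dd_weight t E D m * a (j + m)) = 0"
  obtains A where "degree A \<le> 2 * E"
    "\<And>m. m \<in> S \<Longrightarrow> (to_ac t ^ (j + m)) ^ E * to_ac (a (j + m)) = poly A (to_ac t ^ (j + m))"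
proof -
  have "\<And>D. D \<subseteq> S \<Longrightarrow> card D = 2 * E + 2 \<Longrightarrow>
      (\<Sum>m\<in>D. (t ^ (E * m) * a (j + m)) / (\<Prod>n\<in>D - {m}. t ^ m - t ^ n)) = 0"
  proof -
    fix D assume D: "D \<subseteq> S" "card D = 2 * E + 2"
    have "finite D" using D(1) S by (rule finite_subset)
    from dd_weight_sum(1)[OF this t(2), of E "\<lambda>m. a (j + m)"] dd_weight_sum(2)[OF this t(2)]
        vanish[OF D]
    show "(\<Sum>m\<in>D. (t ^ (E * m) * a (j + m)) / (\<Prod>n\<in>D - {m}. t ^ m - t ^ n)) = 0" by simp
  qed
  then obtain p where p: "degree p \<le> 2 * E" "\<And>m. m \<in> S \<Longrightarrow> poly p (t ^ m) = t ^ (E * m) * a (j + m)"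
    by (rule interpolation_criterion[OF S inj_on_subset[OF t(2) subset_UNIV],
          where F = "\<lambda>m. t ^ (E * m) * a (j + m)" and N
              = "2 * E"]) (assumption, assumption, rule that)
  define q where "q = smult (t ^ (E * j)) (pcompose p [:0, inverse (t ^ j):])"
  have "degree (pcompose p [:0, inverse (t ^ j):]) \<le> degree p * 1"
    by (rule order_trans[OF degree_pcompose_le mult_le_mono2]) simp
  then have q: "degree q \<le> 2 * E" unfolding q_def using p(1) degree_smult_le le_trans
    by (metis mult.right_neutral)
  have qv: "poly q (t ^ (j + m)) = (t ^ (j + m)) ^ E * a (j + m)" if "m \<in> S" for m
  proof -
    have "(t ^ (j + m)) ^ E = t ^ (E * j) * t ^ (E * m)"
      by (simp only: power_mult[symmetric] power_add[symmetric] distrib_right mult.commute[of E])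
    moreover have "t ^ (j + m) * inverse (t ^ j) = t ^ m" using t(1) by (simp add: power_add)
    ultimately show ?thesis using p(2)[OF that]
      by (simp add: q_def poly_pcompose mult.assoc)
  qed
  show thesis
  proof (rule that)
    show "degree (map_poly to_ac q) \<le> 2 * E" using degree_map_poly_le q by (rule order_trans)
    fix m assume "m \<in> S"
    have "poly (map_poly to_ac q) (to_ac (t ^ (j + m))) = to_ac (poly q (t ^ (j + m)))"
      by (rule to_ac_hom.poly_map_poly)
    then show "(to_ac t ^ (j + m)) ^ E * to_ac (a (j + m))
        = poly (map_poly to_ac q) (to_ac t ^ (j + m))"
      using qv[OF \<open>m \<in> S\<close>] by simp
  qed
qed

text \<open>\<open>M\<close> and \<open>E\<close> are fixed before the sequences of values and
  before \<open>K\<close>; this order allows \<open>K\<close> to exceed every degree that is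
  computed from \<open>E\<close>.\<close>

theorem quadratic_values_laurent:
  fixes t :: "'k::field_char_0" and \<alpha> \<beta> :: "'k alg_closure" and g :: "'k alg_closure poly poly"
  assumes nf: "number_field TYPE('k)" and t: "t \<noteq> 0" "inj ((^) t)"
    and g: "lead_coeff g = 1" "degree g = n" "n > 0" and "\<beta> \<noteq> 0"
  shows "\<exists>M>0. \<exists>E. \<forall>a b y z.
    (\<forall>j. poly (poly g [:y j:]) (\<alpha> + \<beta> * (to_ac t ^ j) ^ M) = 0 \<and>
         poly (poly g [:z j:]) (\<alpha> + \<beta> * (to_ac t ^ j) ^ M) = 0 \<and>
         y j + z j = to_ac (a j) \<and> y j * z j = to_ac (b j)) \<longrightarrow>
    (\<forall>K. \<exists>S A B. finite S \<and> card S > K \<and> degree A \<le> 2 * E \<and> degree B \<le> 2 * E \<and>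
       (\<forall>j\<in>S. (to_ac t ^ j) ^ E * to_ac (a j) = poly A (to_ac t ^ j) \<and>
              (to_ac t ^ j) ^ E * to_ac (b j) = poly B (to_ac t ^ j)))"
proof -
  let ?T = "to_ac t"
  have T0: "?T \<noteq> 0" using t(1) by simp
  have power: "t ^ n \<noteq> 1" if "n > 0" for n
    using inj_eq[OF t(2), of n 0] that by simp
  obtain M E \<Psi> where M: "M > 0" and fin: "finite \<Psi>" and laur: "\<forall>f\<in>\<Psi>. laurent E f"
    and sym: "\<forall>w t. absval w \<longrightarrow> t \<noteq> 0 \<longrightarrow> (\<exists>C \<rho>. C \<ge> 0 \<and> 0 < \<rho> \<and> \<rho> < 1 \<and>
      (\<forall>j y z. poly (poly g [:y:]) (\<alpha> + \<beta> * (t ^ j) ^ M) = 0 \<longrightarrow>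
        poly (poly g [:z:]) (\<alpha> + \<beta> * (t ^ j) ^ M) = 0 \<longrightarrow>
        (w t \<noteq> 1 \<longrightarrow> (\<exists>f\<in>\<Psi>. w (y + z - f (t ^ j)) \<le> C * \<rho> ^ j) \<and>
                     (\<exists>f\<in>\<Psi>. w (y * z - f (t ^ j)) \<le> C * \<rho> ^ j)) \<and>
        (w t = 1 \<longrightarrow> w (y + z) \<le> C \<and> w (y * z) \<le> C)))"
    using symmetric_approximation[OF g \<open>\<beta> \<noteq> 0\<close>, of \<alpha>]
    by (elim exE conjE) (rule that)
  note sym = sym[THEN spec, THEN spec, THEN mp, THEN mp]
  \<comment> \<open>With \<open>t\<close>, \<open>\<alpha>\<close>, \<open>\<beta>\<close> and the
    coefficients of \<open>g\<close> in \<open>R\<close>, the roots of the monic specialisations of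
    \<open>g\<close> are in \<open>R\<close>, and so are their traces and norms.\<close>
  define Y where "Y = {?T, \<alpha>, \<beta>} \<union> (\<Union>i\<le>n. coeff (coeff g i) ` {..degree (coeff g i)})"
  have "finite Y" unfolding Y_def by auto
  from product_formula[OF nf this]
  obtain I :: "(('k \<Rightarrow> 'k alg_closure) \<times> nat) set" and w :: "(('k \<Rightarrow> 'k alg_closure) \<times> nat) \<Rightarrow> 'k
      alg_closure \<Rightarrow> real" and R
    where I: "finite I" "\<And>i. i \<in> I \<Longrightarrow> absval (w i)" and R: "is_subring R" and Y: "Y \<subseteq> R"
      and closed: "integrally_closed_in R"
      and product: "\<And>y. y \<noteq> 0 \<Longrightarrow> to_ac y \<in> R \<Longrightarrow> (\<Prod>i\<in>I. w i (to_ac y)) \<ge> 1"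
      and kron: "\<And>t. t \<noteq> 0 \<Longrightarrow> to_ac t \<in> R \<Longrightarrow> (\<forall>i\<in>I. w i (to_ac t) = 1) \<Longrightarrow> (\<exists>n>0. t ^ n = 1)"
    by blast
  have TR: "?T \<in> R" "\<alpha> \<in> R" "\<beta> \<in> R" using Y unfolding Y_def by auto
  \<comment> \<open>As \<open>t\<close> is not a root of unity, Kronecker's theorem yields a place
    with \<open>w t \<noteq> 1\<close>.\<close>
  obtain i0 where i0: "i0 \<in> I" "w i0 ?T \<noteq> 1" using kron[OF t(1) TR(1)] power by blast
  have gR: "coeff (coeff g i) k \<in> R" for i k
  proof (cases "i \<le> n \<and> k \<le> degree (coeff g i)")
    case True
    then show ?thesis using Y unfolding Y_def by blast
  next
    case False
    then have "coeff (coeff g i) k = 0" using g(2) by (auto simp: coeff_eq_0)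
    then show ?thesis using is_subringD(2)[OF R] by simp
  qed
  have integral: "y \<in> R" if y: "poly (poly g [:y:]) s = 0" and s: "s \<in> R" for y s
  proof -
    define q where "q = map_poly (\<lambda>c. poly c s) g"
    have cq: "coeff q i = poly (coeff g i) s" for i by (simp add: q_def coeff_map_poly)
    have cn: "coeff q n = 1" using g by (simp add: cq)
    have dq: "degree q = n"
      using cn g(2) degree_map_poly_le[of "\<lambda>c. poly c s" g]
      by (intro antisym le_degree) (auto simp: q_def)
    have "\<forall>i. coeff q i \<in> R"
      unfolding cq poly_altdef using s gR
      by (intro allI is_subringD(10)[OF R] is_subringD(4)[OF R] is_subringD(7)[OF R])
    moreover have "poly q y = 0"
      using y unfolding poly_poly_const_sum g(2) by (simp add: poly_altdef[of q] dq cq)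
    moreover have "lead_coeff q = 1" using cn dq by simp
    ultimately show ?thesis using closed unfolding integrally_closed_in_def by blast
  qed
  show ?thesis
  proof (rule exI[of _ M], rule conjI[OF M], rule exI[of _ E], intro allI impI)
    fix a b y z K
    assume H: "\<forall>j. poly (poly g [:y j:]) (\<alpha> + \<beta> * (?T ^ j) ^ M) = 0 \<and>
         poly (poly g [:z j:]) (\<alpha> + \<beta> * (?T ^ j) ^ M) = 0 \<and>
         y j + z j = to_ac (a j) \<and> y j * z j = to_ac (b j)"
    then have roots: "poly (poly g [:y j:]) (\<alpha> + \<beta> * (?T ^ j) ^ M) = 0"
        "poly (poly g [:z j:]) (\<alpha> + \<beta> * (?T ^ j) ^ M) = 0"
      and ab: "y j + z j = to_ac (a j)" "y j * z j = to_ac (b j)" for j by blast+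
    have sR: "\<alpha> + \<beta> * (?T ^ j) ^ M \<in> R" for j
      using TR by (intro is_subringD(3)[OF R] is_subringD(4)[OF R] is_subringD(7)[OF R])
    have yR: "y j \<in> R" "z j \<in> R" for j
      using integral[OF _ sR] roots by blast+
    have aR: "to_ac (a j) \<in> R" "to_ac (b j) \<in> R" for j
      unfolding ab[symmetric] using is_subringD(3,4)[OF R] yR by auto
    \<comment> \<open>At places with \<open>w t = 1\<close> there is no approximation, but a colour
      is still required there; any element of \<open>\<Psi>\<close> serves.\<close>
    have f0: "\<exists>f0. f0 \<in> \<Psi>"
    proof -
      from sym[OF I(2)[OF i0(1)] T0] obtain C \<rho> where
        "\<forall>j y z. poly (poly g [:y:]) (\<alpha> + \<beta> * (?T ^ j) ^ M) = 0 \<longrightarrow>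
        poly (poly g [:z:]) (\<alpha> + \<beta> * (?T ^ j) ^ M) = 0 \<longrightarrow>
        (w i0 ?T \<noteq> 1 \<longrightarrow> (\<exists>f\<in>\<Psi>. w i0 (y + z - f (?T ^ j)) \<le> C * \<rho> ^ j) \<and>
                     (\<exists>f\<in>\<Psi>. w i0 (y * z - f (?T ^ j)) \<le> C * \<rho> ^ j)) \<and>
        (w i0 ?T = 1 \<longrightarrow> w i0 (y + z) \<le> C \<and> w i0 (y * z) \<le> C)"
        by (elim exE conjE) (rule that)
      from this[THEN spec, THEN spec, THEN spec, THEN mp, THEN mp, OF roots[of 0]] i0(2)
      show ?thesis by blast
    qed
    have "\<forall>i. i \<in> I \<longrightarrow> (\<exists>C \<rho> u v. C \<ge> 0 \<and> 0 < \<rho> \<and> \<rho> < 1 \<and> (\<forall>j. u j \<in> \<Psi> \<and> v j \<in> \<Psi>) \<and>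
      (\<forall>j. (w i ?T \<noteq> 1 \<longrightarrow> w i (to_ac (a j) - u j (?T ^ j)) \<le> C * \<rho> ^ j \<and>
          w i (to_ac (b j) - v j (?T ^ j)) \<le> C * \<rho> ^ j) \<and>
           (w i ?T = 1 \<longrightarrow> w i (to_ac (a j)) \<le> C \<and> w i (to_ac (b j)) \<le> C)))"
    proof (intro allI impI)
      fix i assume i: "i \<in> I"
      obtain C \<rho> where C: "C \<ge> 0" "0 < \<rho>" "\<rho> < 1"
        and *: "\<forall>j y z. poly (poly g [:y:]) (\<alpha> + \<beta> * (?T ^ j) ^ M) = 0 \<longrightarrow>
        poly (poly g [:z:]) (\<alpha> + \<beta> * (?T ^ j) ^ M) = 0 \<longrightarrow>
        (w i ?T \<noteq> 1 \<longrightarrow> (\<exists>f\<in>\<Psi>. w i (y + z - f (?T ^ j)) \<le> C * \<rho> ^ j) \<and>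
                     (\<exists>f\<in>\<Psi>. w i (y * z - f (?T ^ j)) \<le> C * \<rho> ^ j)) \<and>
        (w i ?T = 1 \<longrightarrow> w i (y + z) \<le> C \<and> w i (y * z) \<le> C)"
        using sym[OF I(2)[OF i] T0] by (elim exE conjE) (rule that)
      have **: "(w i ?T \<noteq> 1 \<longrightarrow> (\<exists>f\<in>\<Psi>. w i (to_ac (a j) - f (?T ^ j)) \<le> C * \<rho> ^ j) \<and>
                     (\<exists>f\<in>\<Psi>. w i (to_ac (b j) - f (?T ^ j)) \<le> C * \<rho> ^ j)) \<and>
        (w i ?T = 1 \<longrightarrow> w i (to_ac (a j)) \<le> C \<and> w i (to_ac (b j)) \<le> C)" for j
        using *[THEN spec, THEN spec, THEN spec, THEN mp, THEN mp, OF roots[of j]] unfolding ab .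
      have "\<exists>u\<in>\<Psi>. \<exists>v\<in>\<Psi>. (w i ?T \<noteq> 1 \<longrightarrow> w i (to_ac (a j) - u (?T ^ j)) \<le> C * \<rho> ^ j \<and>
          w i (to_ac (b j) - v (?T ^ j)) \<le> C * \<rho> ^ j) \<and>
           (w i ?T = 1 \<longrightarrow> w i (to_ac (a j)) \<le> C \<and> w i (to_ac (b j)) \<le> C)" for j
        using **[of j] f0 by (cases "w i ?T = 1") blast+
      then obtain u v where "\<And>j. u j \<in> \<Psi>" "\<And>j. v j \<in> \<Psi>"
        "\<And>j. (w i ?T \<noteq> 1 \<longrightarrow> w i (to_ac (a j) - u j (?T ^ j)) \<le> C * \<rho> ^ j \<and>
            w i (to_ac (b j) - v j (?T ^ j)) \<le> C * \<rho> ^ j) \<and>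
           (w i ?T = 1 \<longrightarrow> w i (to_ac (a j)) \<le> C \<and> w i (to_ac (b j)) \<le> C)"
        by metis
      then show "\<exists>C \<rho> u v. C \<ge> 0 \<and> 0 < \<rho> \<and> \<rho> < 1 \<and> (\<forall>j. u j \<in> \<Psi> \<and> v j \<in> \<Psi>) \<and>
      (\<forall>j. (w i ?T \<noteq> 1 \<longrightarrow> w i (to_ac (a j) - u j (?T ^ j)) \<le> C * \<rho> ^ j \<and>
          w i (to_ac (b j) - v j (?T ^ j)) \<le> C * \<rho> ^ j) \<and>
           (w i ?T = 1 \<longrightarrow> w i (to_ac (a j)) \<le> C \<and> w i (to_ac (b j)) \<le> C))"
        by (intro exI[of _ C] exI[of _ \<rho>] exI[of _ u] exI[of _ v]) (use C in auto)
    qed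
    then obtain C \<rho> u v where C: "\<And>i. i \<in> I \<Longrightarrow> C i \<ge> 0 \<and> 0 < \<rho> i \<and> \<rho> i < 1"
      and uv: "\<And>i j. i \<in> I \<Longrightarrow> u i j \<in> \<Psi>" "\<And>i j. i \<in> I \<Longrightarrow> v i j \<in> \<Psi>"
      and app: "\<And>i j. i \<in> I \<Longrightarrow> (w i ?T \<noteq> 1 \<longrightarrow> w i (to_ac (a j) - u i j (?T ^ j)) \<le> C i * \<rho> i ^ j \<and>
          w i (to_ac (b j) - v i j (?T ^ j)) \<le> C i * \<rho> i ^ j) \<and>
           (w i ?T = 1 \<longrightarrow> w i (to_ac (a j)) \<le> C i \<and> w i (to_ac (b j)) \<le> C i)"
      by metis
    define P where "P = PiE I (\<lambda>_. \<Psi> \<times> \<Psi>)"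
    define colour where "colour j = restrict (\<lambda>i. (u i j, v i j)) I" for j
    have P: "finite P" "\<And>j. colour j \<in> P"
      using fin I(1) uv by (auto simp: P_def colour_def intro: finite_PiE)
    \<comment> \<open>Among the \<open>r + 1\<close> indices \<open>j + m\<close> with
      \<open>m \<le> r\<close>, more than \<open>K\<close> share a colour.\<close>
    define r where "r = K * card P"
    have va: "\<exists>j0. \<forall>j\<ge>j0. \<forall>D\<subseteq>{..r}. card D = 2 * E + 2 \<longrightarrow>
      (\<forall>i\<in>I. \<forall>m\<in>D. \<forall>n\<in>D. u i (j + m) = u i (j + n)) \<longrightarrow> (\<Sum>m\<in>D. dd_weight t E D m * a (j + m)) = 0"
    proof (rule weighted_sum_vanishes[where col = "\<lambda>j i. u i j" and w
        = w, OF I R product t TR(1) i0 aR(1)])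
      show "\<exists>Ca \<rho>a. Ca \<ge> 0 \<and> 0 < \<rho>a \<and> \<rho>a < 1 \<and>
        (\<forall>j. (w i ?T \<noteq> 1 \<longrightarrow> w i (to_ac (a j) - u i j (?T ^ j)) \<le> Ca * \<rho>a ^ j) \<and>
           (w i ?T = 1 \<longrightarrow> w i (to_ac (a j)) \<le> Ca))" if i: "i \<in> I" for i
        using C[OF i] app[OF i] by (intro exI[of _ "C i"] exI[of _ "\<rho> i"]) blast
    qed (use uv laur in blast)+
    have vb: "\<exists>j0. \<forall>j\<ge>j0. \<forall>D\<subseteq>{..r}. card D = 2 * E + 2 \<longrightarrow>
      (\<forall>i\<in>I. \<forall>m\<in>D. \<forall>n\<in>D. v i (j + m) = v i (j + n)) \<longrightarrow> (\<Sum>m\<in>D. dd_weight t E D m * b (j + m)) = 0"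
    proof (rule weighted_sum_vanishes[where col = "\<lambda>j i. v i j" and w
        = w, OF I R product t TR(1) i0 aR(2)])
      show "\<exists>Ca \<rho>a. Ca \<ge> 0 \<and> 0 < \<rho>a \<and> \<rho>a < 1 \<and>
        (\<forall>j. (w i ?T \<noteq> 1 \<longrightarrow> w i (to_ac (b j) - v i j (?T ^ j)) \<le> Ca * \<rho>a ^ j) \<and>
           (w i ?T = 1 \<longrightarrow> w i (to_ac (b j)) \<le> Ca))" if i: "i \<in> I" for i
        using C[OF i] app[OF i] by (intro exI[of _ "C i"] exI[of _ "\<rho> i"]) blast
    qed (use uv laur in blast)+
    obtain ja where ja: "\<forall>j\<ge>ja. \<forall>D\<subseteq>{..r}. card D = 2 * E + 2 \<longrightarrow>
      (\<forall>i\<in>I. \<forall>m\<in>D. \<forall>n\<in>D. u i (j + m) = u i (j + n)) \<longrightarrow> (\<Sum>m\<in>D. dd_weight t E D m * a (j + m)) = 0"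
      using va by (rule exE)
    obtain jb where jb: "\<forall>j\<ge>jb. \<forall>D\<subseteq>{..r}. card D = 2 * E + 2 \<longrightarrow>
      (\<forall>i\<in>I. \<forall>m\<in>D. \<forall>n\<in>D. v i (j + m) = v i (j + n)) \<longrightarrow> (\<Sum>m\<in>D. dd_weight t E D m * b (j + m)) = 0"
      using vb by (rule exE)
    define j where "j = max ja jb"
    obtain c where c: "card {m \<in> {..r}. colour (j + m) = c} > K"
      using monochromatic_subset[of P "{..r}" "\<lambda>m. colour (j + m)" K] P by (auto simp: r_def)
    define S where "S = {m \<in> {..r}. colour (j + m) = c}"
    have S: "finite S" "S \<subseteq> {..r}" by (auto simp: S_def)
    have same: "u i (j + m) = u i (j + n) \<and> v i (j + m) = v i (j + n)"
        if "m \<in> S" "n \<in> S" "i \<in> I" for m n i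
    proof -
      have "colour (j + m) i = colour (j + n) i" using that by (simp add: S_def)
      then show ?thesis using that by (simp add: colour_def)
    qed
    have "(\<Sum>m\<in>D. dd_weight t E D m * a (j + m)) = 0" if D: "D \<subseteq> S" "card D = 2 * E + 2" for D
    proof -
      have "D \<subseteq> {..r}" "j \<ge> ja" using D S by (auto simp: j_def)
      moreover have "\<forall>i\<in>I. \<forall>m\<in>D. \<forall>n\<in>D. u i (j + m) = u i (j + n)" using same D by blast
      ultimately show ?thesis using ja D(2) by blast
    qed
    then obtain A where A: "degree A \<le> 2 * E"
      "\<And>m. m \<in> S \<Longrightarrow> (?T ^ (j + m)) ^ E * to_ac (a (j + m)) = poly A (?T ^ (j + m))"
      by (rule laurent_from_vanishing[OF t S(1)]) (assumption, assumption, rule that)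
    have "(\<Sum>m\<in>D. dd_weight t E D m * b (j + m)) = 0" if D: "D \<subseteq> S" "card D = 2 * E + 2" for D
    proof -
      have "D \<subseteq> {..r}" "j \<ge> jb" using D S by (auto simp: j_def)
      moreover have "\<forall>i\<in>I. \<forall>m\<in>D. \<forall>n\<in>D. v i (j + m) = v i (j + n)" using same D by blast
      ultimately show ?thesis using jb D(2) by blast
    qed
    then obtain B where B: "degree B \<le> 2 * E"
      "\<And>m. m \<in> S \<Longrightarrow> (?T ^ (j + m)) ^ E * to_ac (b (j + m)) = poly B (?T ^ (j + m))"
      by (rule laurent_from_vanishing[OF t S(1)]) (assumption, assumption, rule that)
    have "card ((+) j ` S) > K" using c by (simp add: card_image S_def)
    then show "\<exists>S A B. finite S \<and> card S > K \<and> degree A \<le> 2 * E \<and> degree B \<le> 2 * E \<and>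
       (\<forall>j\<in>S. (?T ^ j) ^ E * to_ac (a j) = poly A (?T ^ j) \<and>
           (?T ^ j) ^ E * to_ac (b j) = poly B (?T ^ j))"
      using S(1) A B by (intro exI[of _ "(+) j ` S"] exI[of _ A] exI[of _ B]) auto
  qed
qed

section \<open>Quadratic points over an exponential sequence\<close>

interpretation to_ac_map_hom: map_poly_comm_ring_hom "to_ac :: 'a::field \<Rightarrow> 'a alg_closure" ..

lemma comm_ring_hom_const_to_ac: "comm_ring_hom (\<lambda>c. [:to_ac c:])"
  by unfold_locales auto

lemma poly_eval3:
  "poly (eval3 (\<lambda>c. [:to_ac c:]) F p q r) u = eval3 to_ac F (poly p u) (poly q u) (poly r u)"
proof -
  have "(\<lambda>p. poly p u) \<circ> (\<lambda>c. [:to_ac c:]) = to_ac" by auto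
  then show ?thesis
    using eval3_hom[OF poly_hom.comm_ring_hom_axioms[of u], of "\<lambda>c. [:to_ac c:]" F p q r] by simp
qed

lemma poly_zero_off_0:
  fixes p :: "'a::field_char_0 poly"
  assumes "\<And>u. u \<noteq> 0 \<Longrightarrow> poly p u = 0"
  shows "p = 0"
proof -
  have "poly ([:0, 1:] * p) u = 0" for u using assms by (cases "u = 0") auto
  then have "[:0, 1:] * p = 0" using poly_all_0_iff_0 by blast
  then show ?thesis by simp
qed

text \<open>If the line \<open>X = x * Y\<close> lay on the curve, \<open>F_Z\<close> would vanish
  on it and Euler's identity would give \<open>x * F_X + F_Y = 0\<close>. The form
  \<open>F_X\<close> of degree \<open>d - 1 \<ge> 1\<close> has a zero on the line, at an affine
  point or at \<open>(0 : 0 : 1)\<close>, and that point is singular.\<close>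

lemma line_not_contained:
  fixes F :: "'k::field_char_0 ternary" and x :: "'k alg_closure"
  assumes F: "homogeneous d F" "d \<ge> 2" "smooth3 F"
  shows "\<exists>z. eval3 to_ac F x 1 z \<noteq> 0"
proof (rule ccontr)
  let ?h = "\<lambda>c::'k. [:to_ac c:]"
  note h = comm_ring_hom_const_to_ac
  assume "\<not> ?thesis"
  then have F0: "eval3 to_ac F x 1 z = 0" for z by blast
  have "poly (eval3 ?h F [:x:] 1 [:0, 1:]) z = 0" for z by (simp add: poly_eval3 F0)
  then have Fp: "eval3 ?h F [:x:] 1 [:0, 1:] = 0" using poly_all_0_iff_0 by blast
  have "pderiv (eval3 ?h F [:x:] 1 [:0, 1:]) = eval3 ?h (partial 1 F) [:x:] 1 [:0, 1:] * pderiv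
      [:x:]
      + eval3 ?h (partial 2 F) [:x:] 1 [:0, 1:] * pderiv 1 + eval3 ?h (partial 3 F) [:x:] 1 [:0, 1:]
          * pderiv [:0, 1:]"
    by (rule eval3_deriv[OF h]) (simp_all add: pderiv_add pderiv_mult pderiv_pCons algebra_simps)
  then have "eval3 ?h (partial 3 F) [:x:] 1 [:0, 1:] = 0"
    unfolding Fp by (simp add: pderiv_pCons)
  then have FZ: "eval3 to_ac (partial 3 F) x 1 z = 0" for z
    using poly_eval3[of "partial 3 F" "[:x:]" 1 "[:0, 1:]" z] by simp
  have euler: "x * eval3 to_ac (partial 1 F) x 1 z + eval3 to_ac (partial 2 F) x 1 z = 0" for z
    using eval3_euler[OF to_ac_hom.comm_ring_hom_axioms F(1), of x 1 z] by (simp add: F0 FZ)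
  \<comment> \<open>The restriction of \<open>G\<close> to the line in the chart around its point at
    infinity: \<open>u = 0\<close> is \<open>(0 : 0 : 1)\<close>, and \<open>u \<noteq> 0\<close> is
    the affine point with \<open>z = 1 / u\<close>.\<close>
  define P where "P G = eval3 ?h G [:0, x:] [:0, 1:] 1" for G :: "'k ternary"
  have P: "poly (P G) u = u ^ e * eval3 to_ac G x 1 (inverse u)"
      if "homogeneous e G" "u \<noteq> 0" for G e u
    using eval3_scale[OF that(1), of to_ac u x 1 "inverse u"] that(2)
    by (simp add: P_def poly_eval3)
  have P0: "poly (P G) 0 = eval3 to_ac G 0 0 1" for G by (simp add: P_def poly_eval3)
  note FX = homogeneous_partial[OF F(1), of 1] and FY = homogeneous_partial[OF F(1), of 2]
    and FZ' = homogeneous_partial[OF F(1), of 3]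
  show False
  proof (cases "\<exists>z. eval3 to_ac (partial 1 F) x 1 z = 0")
    case True
    then obtain z where z: "eval3 to_ac (partial 1 F) x 1 z = 0" by blast
    then have "eval3 to_ac (partial 2 F) x 1 z = 0" using euler[of z] by simp
    then show False using F(3) F0[of z] FZ[of z] z unfolding smooth3_def by force
  next
    case False
    define q where "q = eval3 ?h (partial 1 F) [:x:] 1 [:0, 1:]"
    have q: "poly q z = eval3 to_ac (partial 1 F) x 1 z" for z by (simp add: q_def poly_eval3)
    have "degree q = 0"
      using False q alg_closed_imp_poly_has_root[of q] by (metis neq0_conv)
    then obtain c where c: "q = [:c:]" by (rule degree_eq_zeroE)
    have "P (partial 1 F) - monom c (d - 1) = 0"
      using q c by (intro poly_zero_off_0) (simp add: P[OF FX] poly_monom mult.commute flip: q)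
    then have "P (partial 1 F) = monom c (d - 1)" by simp
    then have X0: "eval3 to_ac (partial 1 F) 0 0 1 = 0"
      using P0[of "partial 1 F"] F(2) by (simp add: poly_monom power_0_left)
    have "P F = 0" by (intro poly_zero_off_0) (simp add: P[OF F(1)] F0)
    then have "eval3 to_ac F 0 0 1 = 0" using P0[of F] by simp
    moreover have "P (partial 3 F) = 0" by (intro poly_zero_off_0) (simp add: P[OF FZ'] FZ)
    then have "eval3 to_ac (partial 3 F) 0 0 1 = 0" using P0[of "partial 3 F"] by simp
    moreover have "smult x (P (partial 1 F)) + P (partial 2 F) = 0"
    proof (rule poly_zero_off_0)
      fix u :: "'k alg_closure" assume u: "u \<noteq> 0"
      have "poly (smult x (P (partial 1 F)) + P (partial 2 F)) u =
        u ^ (d - 1) * (x * eval3 to_ac (partial 1 F) x 1 (inverse u) + eval3 to_ac (partial 2 F) x 1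
            (inverse u))"
        by (simp add: P[OF FX u] P[OF FY u] algebra_simps)
      then show "poly (smult x (P (partial 1 F)) + P (partial 2 F)) u = 0" by (simp add: euler)
    qed
    then have "poly (smult x (P (partial 1 F)) + P (partial 2 F)) 0 = 0" by simp
    then have "eval3 to_ac (partial 2 F) 0 0 1 = 0" using X0 by (simp add: P0)
    ultimately show False using F(3) X0 unfolding smooth3_def by force
  qed
qed

section \<open>Quadratic elements and their conjugates\<close>

definition quadratic_over :: "'k::field alg_closure \<Rightarrow> bool" where
  "quadratic_over z \<longleftrightarrow> (\<exists>p::'k poly. p \<noteq> 0 \<and> degree p \<le> 2 \<and> poly (map_poly to_ac p) z = 0)"

text \<open>Either \<open>z\<close> is in \<open>k\<close> and is its own partner, or
  \<open>z'\<close> is the second root of its minimal polynomial. The last claim carries the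
  equation of the fibre, which has coefficients in \<open>k\<close>, from \<open>z\<close> to
  \<open>z'\<close>.\<close>

lemma quadratic_conjugate:
  fixes z :: "'k::field alg_closure"
  assumes "quadratic_over z"
  obtains z' and a b :: 'k where "z + z' = to_ac a" "z * z' = to_ac b"
    "\<And>q::'k poly. poly (map_poly to_ac q) z = 0 \<Longrightarrow> poly (map_poly to_ac q) z' = 0"
proof (cases "z \<in> range to_ac")
  case True
  then obtain c :: 'k where "z = to_ac c" by blast
  then show thesis by (intro that[of z "c + c" "c * c"]) simp_all
next
  case False
  obtain p :: "'k poly" where p: "p \<noteq> 0" "degree p \<le> 2" "poly (map_poly to_ac p) z = 0"
    using assms unfolding quadratic_over_def by blast
  have lin: "r = 0" if r: "degree r < 2" "poly (map_poly to_ac r) z = 0" for r :: "'k poly"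
  proof -
    obtain r0 r1 where req: "r = [:r0, r1:]"
    proof
      show "r = [:coeff r 0, coeff r 1:]"
        using r(1) by (intro poly_eqI) (auto simp: coeff_pCons coeff_eq_0 split: nat.split)
    qed
    have eq: "to_ac r0 + z * to_ac r1 = 0" using r(2)
      by (simp add: req to_ac_hom.map_poly_pCons_hom)
    have "r1 = 0"
    proof (rule ccontr)
      assume "r1 \<noteq> 0"
      then have "z = to_ac (- r0 / r1)" using eq by (simp add: field_simps eq_neg_iff_add_eq_0)
      then show False using False by blast
    qed
    then show "r = 0" using eq by (simp add: req)
  qed
  have "degree p = 2" using lin[OF _ p(3)] p(1,2) by (cases "degree p < 2") auto
  define c0 c1 c2 where "c0 = coeff p 0" and "c1 = coeff p 1" and "c2 = coeff p 2"
  have c2: "c2 \<noteq> 0" using \<open>degree p = 2\<close> p(1) unfolding c2_def by (metis leading_coeff_0_iff)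
  have peq: "p = [:c0, c1, c2:]"
  proof (rule poly_eqI)
    fix i show "coeff p i = coeff [:c0, c1, c2:] i"
    proof (cases "i \<le> 2")
      case True
      then have "i = 0 \<or> i = 1 \<or> i = 2" by linarith
      then show ?thesis by (auto simp: c0_def c1_def c2_def coeff_pCons numeral_2_eq_2)
    next
      case False
      then show ?thesis using \<open>degree p = 2\<close> by (auto simp: coeff_pCons coeff_eq_0 split: nat.split)
    qed
  qed
  define z' where "z' = to_ac (- c1 / c2) - z"
  have zz: "to_ac c0 + z * (to_ac c1 + z * to_ac c2) = 0" using p(3)
    by (simp add: peq to_ac_hom.map_poly_pCons_hom)
  have sum: "to_ac c2 * (z + z') = - to_ac c1" using c2 by (simp add: z'_def)
  have prod: "to_ac c2 * (z * z') = to_ac c0"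
  proof -
    have "to_ac c2 * (z * z') - to_ac c0 =
      z * (to_ac c2 * (z + z') + to_ac c1) - (to_ac c0 + z * (to_ac c1 + z * to_ac c2))"
      by (simp add: algebra_simps)
    then show ?thesis unfolding sum zz by simp
  qed
  have pz': "poly (map_poly to_ac p) z' = 0"
  proof -
    have "poly (map_poly to_ac p) z' = to_ac c0 + z' * (to_ac c2 * (z + z')) + z' * to_ac c1 - to_ac
        c2 * (z * z')"
      by (simp add: peq to_ac_hom.map_poly_pCons_hom algebra_simps)
    then show ?thesis unfolding sum prod by simp
  qed
  show thesis
  proof (rule that[of z' "- c1 / c2" "c0 / c2"])
    show "z + z' = to_ac (- c1 / c2)" by (simp add: z'_def)
    show "z * z' = to_ac (c0 / c2)" using prod c2 by (simp add: field_simps)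
    fix q :: "'k poly" assume q: "poly (map_poly to_ac q) z = 0"
    have qeq: "q = p * (q div p) + q mod p" by simp
    have split: "poly (map_poly to_ac q) s = poly (map_poly to_ac p) s * poly (map_poly to_ac (q div
        p)) s
      + poly (map_poly to_ac (q mod p)) s" for s
      by (subst qeq) (simp only: to_ac_map_hom.hom_add to_ac_map_hom.hom_mult poly_add poly_mult)
    have "degree (q mod p) < 2"
      using degree_mod_less[OF p(1), of q] \<open>degree p = 2\<close> by auto
    then have "q mod p = 0" using split[of z] q p(3) by (intro lin) auto
    then show "poly (map_poly to_ac q) z' = 0" using split[of z'] pz' by simp
  qed
qed

section \<open>Degree bounds and the monic equation of a fibre\<close>

lemma quad_pow_degree:
  assumes "degree W \<le> D" "degree A \<le> D" "degree B \<le> D"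
  shows "degree (fst (quad_pow W A B i)) \<le> i * D \<and> degree (snd (quad_pow W A B i)) \<le> i * D"
proof (induction i)
  case (Suc i)
  have mult: "degree (p * q) \<le> D + i * D" if "degree p \<le> D" "degree q \<le> i * D" for p q :: "'a poly"
    using degree_mult_le[of p q] that by simp
  show ?case using Suc by (auto intro!: degree_add_le mult assms)
qed auto

text \<open>The factor enters the bound only through \<open>D\<close>; a remainder with more zeros
  than this vanishes.\<close>

lemma remainder_degree:
  assumes W: "degree W \<le> D" "degree A \<le> D" "degree B \<le> D"
      and P: "\<And>i. i \<le> degree P \<Longrightarrow> degree (coeff P i) \<le> D"
  shows "degree (quad_rem0 W A B P) \<le> Suc (degree P) * D"
    "degree (quad_rem1 W A B P) \<le> Suc (degree P) * D"
    "degree (lin_rem W A P) \<le> Suc (degree P) * D"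
proof -
  have summand: "degree (coeff P i * W ^ (degree P - i) * q) \<le> Suc (degree P) * D"
    if "i \<le> degree P" "degree q \<le> i * D" for i q
  proof -
    have "degree (coeff P i * W ^ (degree P - i) * q)
        \<le> degree (coeff P i) + degree (W ^ (degree P - i)) + degree q"
      by (intro order_trans[OF degree_mult_le] add_mono degree_mult_le order_refl)
    also have "\<dots> \<le> D + (degree P - i) * D + i * D"
      using P[OF that(1)] that(2) order_trans[OF degree_power_le mult_right_mono[OF W(1)], of
          "degree P - i"]
      by (intro add_mono) (auto simp: mult.commute)
    also have "\<dots> = Suc (degree P) * D"
      using that(1) by (simp flip: add_mult_distrib)
    finally show ?thesis .
  qed
  show "degree (quad_rem0 W A B P) \<le> Suc (degree P) * D" "degree (quad_rem1 W A B P)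
      \<le> Suc (degree P) * D"
    unfolding quad_rem0_def quad_rem1_def using quad_pow_degree[OF W]
    by (intro degree_sum_le finite_atMost summand; simp)+
  have "degree (A ^ i) \<le> i * D" for i
    using order_trans[OF degree_power_le mult_right_mono[OF W(2)], of i] by (simp add: mult.commute)
  then show "degree (lin_rem W A P) \<le> Suc (degree P) * D"
    unfolding lin_rem_def by (intro degree_sum_le finite_atMost summand; simp)
qed

lemma poly_eq_0_many_roots:
  fixes p :: "'a::idom poly"
  assumes "inj_on h S" "\<And>i. i \<in> S \<Longrightarrow> poly p (h i) = 0" "card S > degree p"
  shows "p = 0"
proof (rule ccontr)
  assume ne: "p \<noteq> 0"
  have "card S = card (h ` S)" using assms(1) by (simp add: card_image)
  also have "\<dots> \<le> card {x. poly p x = 0}"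
    using assms(2) by (intro card_mono poly_roots_finite[OF ne]) auto
  also have "\<dots> \<le> degree p" by (rule card_poly_roots_bound[OF ne])
  finally show False using assms(3) by simp
qed

text \<open>The equation of the fibre is kept over \<open>k\<close> itself, so that conjugate roots
  can be exchanged.\<close>

definition fibre_poly :: "'k::field ternary \<Rightarrow> 'k \<Rightarrow> 'k poly" where
  "fibre_poly F x = eval3 (\<lambda>c. [:c:]) F [:x:] 1 [:0, 1:]"

lemma poly_fibre_poly: "poly (map_poly to_ac (fibre_poly F x)) z = eval3 to_ac F (to_ac x) 1 z"
proof -
  have e: "comm_ring_hom (\<lambda>p. poly (map_poly to_ac p) z)"
    by unfold_locales (simp_all add: to_ac_map_hom.hom_add to_ac_map_hom.hom_mult)
  have "(\<lambda>p. poly (map_poly to_ac p) z) \<circ> (\<lambda>c. [:c:]) = to_ac"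
    by (rule ext) (simp add: to_ac_hom.map_poly_pCons_hom)
  then show ?thesis
    using eval3_hom[OF e, of "\<lambda>c. [:c:]" F "[:x:]" 1 "[:0, 1:]"]
      by (simp add: fibre_poly_def to_ac_hom.map_poly_pCons_hom)
qed

text \<open>The leading coefficient of \<open>F(u, 1, z)\<close> in \<open>z\<close> takes values in
  \<open>k\<close> at rational abscissas, so multiplying \<open>z\<close> by it keeps trace and norm
  in \<open>k\<close>.\<close>

lemma affine_poly_rational:
  "\<exists>f0. \<forall>i. coeff (affine_poly F [:0, 1:]) i = map_poly to_ac (coeff f0 i)"
proof (intro exI allI)
  fix i
  show "coeff (affine_poly F [:0, 1:]) i = map_poly to_ac (coeff (\<Sum>m\<in>Poly_Mapping.keys F.
    monom (monom (Poly_Mapping.lookup F m) (Poly_Mapping.lookup m 1)) (Poly_Mapping.lookup m 3)) i)"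
    unfolding affine_poly_def coeff_sum to_ac_map_hom.hom_sum monom_altdef[symmetric]
    by (rule sum.cong) (simp_all add: to_ac_hom.map_poly_hom_monom)
qed

text \<open>
  The substitution \<open>y = l z\<close>, with \<open>l\<close> the leading coefficient, makes the equation monic.
\<close>

definition monic_transform :: "'a::idom poly poly \<Rightarrow> 'a poly poly" where
  "monic_transform f = monom 1 (degree f) +
     (\<Sum>i<degree f. monom (coeff f i * lead_coeff f ^ (degree f - 1 - i)) i)"

lemma monic_transform:
  assumes "degree f > 0"
  shows "degree (monic_transform f) = degree f" "lead_coeff (monic_transform f) = 1"
proof -
  have low: "degree (\<Sum>i<degree f. monom (coeff f i * lead_coeff f ^ (degree f - 1 - i)) i) < degree
      f"
    using assms by (intro degree_sum_less) (auto intro: le_less_trans[OF degree_monom_le])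
  then show deg: "degree (monic_transform f) = degree f"
    unfolding monic_transform_def by (subst degree_add_eq_left) (simp_all add: degree_monom_eq)
  show "lead_coeff (monic_transform f) = 1"
    unfolding deg using low by (simp add: monic_transform_def coeff_eq_0)
qed

lemma poly_monic_transform:
  assumes "degree f > 0" and 0: "poly (map_poly (\<lambda>p. poly p x) f) z = 0"
  shows "poly (poly (monic_transform f) [:poly (lead_coeff f) x * z:]) x = 0"
proof -
  define n l c where "n = degree f" and "l = poly (lead_coeff f) x" and "c i = poly (coeff f i) x"
      for i
  have "(\<Sum>i\<le>n. c i * z ^ i) = 0"
    using 0 unfolding poly_map_poly_sum[OF poly_hom.comm_ring_hom_axioms] n_def c_def .
  moreover have "{..n} = insert n {..<n}" by auto
  ultimately have 1: "l * z ^ n + (\<Sum>i<n. c i * z ^ i) = 0" by (simp add: l_def c_def n_def)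
  have "poly (poly (monic_transform f) [:l * z:]) x
      = (l * z) ^ n + (\<Sum>i<n. c i * l ^ (n - 1 - i) * (l * z) ^ i)"
    unfolding monic_transform_def
    by (simp add: poly_sum poly_monom n_def c_def l_def)
  also have "\<dots> = l ^ (n - 1) * (l * z ^ n) + (\<Sum>i<n. l ^ (n - 1) * (c i * z ^ i))"
  proof (intro arg_cong2[where f = "(+)"] sum.cong refl)
    show "(l * z) ^ n = l ^ (n - 1) * (l * z ^ n)"
      using assms(1) by (cases n) (simp_all add: n_def power_mult_distrib mult_ac)
    fix i assume "i \<in> {..<n}"
    then have "l ^ (n - 1) = l ^ (n - 1 - i) * l ^ i" by (simp flip: power_add)
    then show "c i * l ^ (n - 1 - i) * (l * z) ^ i = l ^ (n - 1) * (c i * z ^ i)"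
      by (simp add: power_mult_distrib mult_ac)
  qed
  also have "\<dots> = l ^ (n - 1) * (l * z ^ n + (\<Sum>i<n. c i * z ^ i))"
    by (simp only: sum_distrib_left distrib_left)
  finally show ?thesis unfolding 1 by (simp add: l_def)
qed

section \<open>Contradiction on an exponential sequence\<close>

lemma map_affine_poly_root:
  "poly (map_poly (\<lambda>p. poly p u) (affine_poly F \<psi>)) z = eval3 to_ac F (poly \<psi> u) 1 z"
  using poly_affine_poly[OF poly_hom.comm_ring_hom_axioms[of u], of F \<psi> z] by simp

text \<open>More than \<open>K\<close> indices with coinciding conjugates give a linear factor of
  the equation in \<open>z\<close>, more than \<open>K\<close> with distinct conjugates a quadratic
  one; both are excluded. The nonvanishing leading coefficient permits the return from the monic
  equation to \<open>z\<close>.\<close>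

lemma no_quadratic_points_nonvanishing_leading_coeff:
  fixes F :: "'k::field_char_0 ternary" and \<tau> \<alpha> \<beta> :: 'k
  assumes nf: "number_field TYPE('k)" and F: "homogeneous d F" "d \<ge> 4" "smooth3 F"
    and \<tau>: "\<tau> \<noteq> 0" "inj ((^) \<tau>)" and "\<beta> \<noteq> 0"
    and pos: "degree (affine_poly F [:0, 1:]) > 0"
    and lead: "\<And>j. poly (lead_coeff (affine_poly F [:0, 1:])) (to_ac (\<alpha> + \<beta> * \<tau> ^ j)) \<noteq> 0"
    and points: "\<And>j. \<exists>z. eval3 to_ac F (to_ac (\<alpha> + \<beta> * \<tau> ^ j)) 1 z = 0 \<and> quadratic_over z"
  shows False
proof -
  define f where "f = affine_poly F [:0, 1:]"
  define l where "l = lead_coeff f"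
  obtain f0 where f0: "\<And>i. coeff f i = map_poly to_ac (coeff f0 i)"
    using affine_poly_rational[of F] unfolding f_def by blast
  define l0 where "l0 = coeff f0 (degree f)"
  have l0: "poly l (to_ac x) = to_ac (poly l0 x)" for x
    using to_ac_hom.poly_map_poly[of l0 x] f0[of "degree f"] by (simp add: l_def l0_def)
  define x where "x j = \<alpha> + \<beta> * \<tau> ^ j" for j
  have "\<forall>j. \<exists>z z' a b. z + z' = to_ac a \<and> z * z' = to_ac b \<and>
    eval3 to_ac F (to_ac (x j)) 1 z = 0 \<and> eval3 to_ac F (to_ac (x j)) 1 z' = 0"
  proof
    fix j
    obtain z where z: "eval3 to_ac F (to_ac (x j)) 1 z = 0" "quadratic_over z"
      using points[of j] unfolding x_def by blast
    show "\<exists>z z' a b. z + z' = to_ac a \<and> z * z' = to_ac b \<and>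
      eval3 to_ac F (to_ac (x j)) 1 z = 0 \<and> eval3 to_ac F (to_ac (x j)) 1 z' = 0"
    proof (rule quadratic_conjugate[OF z(2)])
      fix z' and a b :: 'k
      assume ab: "z + z' = to_ac a" "z * z' = to_ac b"
        and "\<And>q::'k poly. poly (map_poly to_ac q) z = 0 \<Longrightarrow> poly (map_poly to_ac q) z' = 0"
      from this(3)[of "fibre_poly F (x j)"] z(1) have "eval3 to_ac F (to_ac (x j)) 1 z' = 0"
        unfolding poly_fibre_poly by blast
      with ab z(1) show ?thesis by blast
    qed
  qed
  then obtain z z' a b where sum: "\<And>j. z j + z' j = to_ac (a j)"
      and prod: "\<And>j. z j * z' j = to_ac (b j)"
    and z: "\<And>j. eval3 to_ac F (to_ac (x j)) 1 (z j) = 0" "\<And>j. eval3 to_ac F (to_ac (x j)) 1 (z' j)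
        = 0"
    by metis
  let ?T = "to_ac \<tau>"
  define g where "g = monic_transform f"
  have g: "lead_coeff g = 1" "degree g = degree f" "degree f > 0"
    using monic_transform[of f] pos unfolding g_def f_def by blast+
  have "to_ac \<beta> \<noteq> 0" using \<open>\<beta> \<noteq> 0\<close> by simp
  from quadratic_values_laurent[OF nf \<tau> g this, of "to_ac \<alpha>"] obtain M E where M: "M > 0" and
    LE: "\<forall>a b y z. (\<forall>j. poly (poly g [:y j:]) (to_ac \<alpha> + to_ac \<beta> * (?T ^ j) ^ M) = 0 \<and>
         poly (poly g [:z j:]) (to_ac \<alpha> + to_ac \<beta> * (?T ^ j) ^ M) = 0 \<and>
         y j + z j = to_ac (a j) \<and> y j * z j = to_ac (b j)) \<longrightarrow>
    (\<forall>K. \<exists>S A B. finite S \<and> card S > K \<and> degree A \<le> 2 * E \<and> degree B \<le> 2 * E \<and>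
       (\<forall>j\<in>S. (?T ^ j) ^ E * to_ac (a j) = poly A (?T ^ j) \<and>
              (?T ^ j) ^ E * to_ac (b j) = poly B (?T ^ j)))"
    by (elim exE conjE) (rule that)
  define \<psi> where "\<psi> = [:to_ac \<alpha>:] + monom (to_ac \<beta>) M"
  have \<psi>: "poly \<psi> (?T ^ j) = to_ac (x (j * M))" for j
    by (simp add: \<psi>_def poly_monom x_def power_mult)
  have d\<psi>: "pderiv \<psi> \<noteq> 0"
    using M \<open>\<beta> \<noteq> 0\<close> by (simp add: \<psi>_def pderiv_add pderiv_pCons pderiv_monom)
  define P where "P = affine_poly F \<psi>"
  define lp where "lp = pcompose l \<psi>"
  have lp: "poly lp (?T ^ j) = to_ac (poly l0 (x (j * M)))" for j
    by (simp add: lp_def poly_pcompose \<psi> l0)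
  have l0_nz: "poly l0 (x j) \<noteq> 0" for j
    using lead[of j] l0[of "x j"] unfolding l_def f_def x_def by auto
  have lp0: "lp \<noteq> 0" using lp[of 0] l0_nz by auto
  define D where "D = 2 * E + 2 * degree lp + (\<Sum>i\<le>degree P. degree (coeff P i))"
  \<comment> \<open>The degree bound of the remainders. It involves \<open>E\<close> but not
    \<open>A\<close> and \<open>B\<close>, which appear only after the number of indices is
    chosen.\<close>
  define K where "K = Suc (degree P) * D"
  have PD: "degree (coeff P i) \<le> D" if "i \<le> degree P" for i
  proof -
    have "degree (coeff P i) \<le> (\<Sum>i\<le>degree P. degree (coeff P i))"
      using that by (intro member_le_sum) auto
    then show ?thesis unfolding D_def by simp
  qed
  have groot: "poly (poly g [:to_ac (poly l0 (x j)) * w:]) (to_ac (x j)) = 0"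
    if "eval3 to_ac F (to_ac (x j)) 1 w = 0" for j w
  proof -
    have "poly (map_poly (\<lambda>p. poly p (to_ac (x j))) f) w = 0"
      unfolding f_def map_affine_poly_root using that by simp
    from poly_monic_transform[OF g(3) this] show ?thesis
      unfolding g_def l_def[symmetric] l0 .
  qed
  define y y' where "y j = to_ac (poly l0 (x (j * M))) * z (j * M)" and "y' j
      = to_ac (poly l0 (x (j * M))) * z' (j * M)" for j
  define a1 b1 where "a1 j = poly l0 (x (j * M)) * a (j * M)" and "b1 j
      = poly l0 (x (j * M)) ^ 2 * b (j * M)" for j
  have xM: "to_ac \<alpha> + to_ac \<beta> * (?T ^ j) ^ M = to_ac (x (j * M))" for j
    by (simp add: x_def power_mult)
  have "\<forall>j. poly (poly g [:y j:]) (to_ac \<alpha> + to_ac \<beta> * (?T ^ j) ^ M) = 0 \<and>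
         poly (poly g [:y' j:]) (to_ac \<alpha> + to_ac \<beta> * (?T ^ j) ^ M) = 0 \<and>
         y j + y' j = to_ac (a1 j) \<and> y j * y' j = to_ac (b1 j)"
  proof (intro allI conjI)
    fix j
    show "poly (poly g [:y j:]) (to_ac \<alpha> + to_ac \<beta> * (?T ^ j) ^ M) = 0"
      "poly (poly g [:y' j:]) (to_ac \<alpha> + to_ac \<beta> * (?T ^ j) ^ M) = 0"
      unfolding xM y_def y'_def by (rule groot[OF z(1)], rule groot[OF z(2)])
    show "y j + y' j = to_ac (a1 j)"
      by (simp add: y_def y'_def a1_def flip: sum distrib_left)
    show "y j * y' j = to_ac (b1 j)"
      by (simp add: y_def y'_def b1_def power2_eq_square mult_ac flip: prod)
  qed
  from LE[THEN spec, THEN spec, THEN spec, THEN spec, THEN mp, OF this, THEN spec, of "2 * K"]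
  obtain S A B where S: "finite S" "card S > 2 * K" and A: "degree A \<le> 2 * E"
      and B: "degree B \<le> 2 * E"
    and AB: "\<forall>j\<in>S. (?T ^ j) ^ E * to_ac (a1 j) = poly A (?T ^ j) \<and>
        (?T ^ j) ^ E * to_ac (b1 j) = poly B (?T ^ j)"
    by (elim exE conjE) (rule that)
  \<comment> \<open>One class has more than \<open>K\<close> members because \<open>S\<close> has
    more than \<open>2 * K\<close>. Distinct conjugates are what makes the discriminant of the
    quadratic factor nonzero.\<close>
  define S1 S2 where "S1 = {j \<in> S. z (j * M) = z' (j * M)}" and "S2
      = {j \<in> S. z (j * M) \<noteq> z' (j * M)}"
  have "card S = card S1 + card S2"
    using S(1) by (subst card_Un_disjoint[symmetric]) (auto simp: S1_def S2_def
        intro!: arg_cong[where f = card])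
  then consider "card S1 > K" | "card S2 > K" using S(2) by linarith
  then show False
  proof cases
    have inj: "inj ((^) ?T)"
      using \<tau>(2) by (auto simp: inj_def simp flip: to_ac_power)
    have Tj: "?T ^ j \<noteq> 0" for j using \<tau>(1) by simp
    {
      case 1
      \<comment> \<open>For equal conjugates the trace is \<open>2 * z\<close>, so
        \<open>2 * u^E * l * z\<close> is the value of \<open>A\<close>.\<close>
      define W where "W = smult 2 (monom 1 E * lp)"
      have W0: "W \<noteq> 0" using lp0 by (simp add: W_def)
      have "degree W \<le> E + degree lp"
        unfolding W_def using degree_mult_le[of "monom 1 E" lp] by (simp add: degree_monom_eq)
      then have degs: "degree W \<le> D" "degree A \<le> D" using A by (auto simp: D_def)
      have "poly (lin_rem W A P) (?T ^ j) = 0" if j: "j \<in> S1" for j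
      proof -
        have "poly W (?T ^ j) * z (j * M) = poly A (?T ^ j)"
        proof -
          have "2 * z (j * M) = to_ac (a (j * M))"
            using j sum[of "j * M"] by (simp add: S1_def)
          moreover have "poly A (?T ^ j) = (?T ^ j) ^ E * to_ac (a1 j)" using j AB
            by (auto simp: S1_def)
          ultimately show ?thesis
            by (simp add: W_def poly_monom lp a1_def)
        qed
        from lin_rem[OF poly_hom.comm_ring_hom_axioms this, of P]
        show ?thesis
          unfolding P_def map_affine_poly_root \<psi> z by simp
      qed
      then have "lin_rem W A P = 0"
        using 1 remainder_degree(3)[OF degs(1,2) _ PD, of 0]
        by (intro poly_eq_0_many_roots[OF inj_on_subset[OF inj subset_UNIV], of S1]) (auto
            simp: K_def)
      then show False using no_linear_factor[OF F d\<psi> W0] unfolding P_def by blast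
    next
      case 2
      \<comment> \<open>The equation \<open>z^2 - a * z + b = 0\<close> is multiplied by
        \<open>u^E * l^2\<close>, because \<open>A\<close> and \<open>B\<close> represent
        \<open>l * a\<close> and \<open>l^2 * b\<close> up to \<open>u^E\<close>.\<close>
      define W where "W = monom 1 E * lp ^ 2"
      define A2 where "A2 = A * lp"
      have W0: "W \<noteq> 0" using lp0 by (simp add: W_def)
      have "degree W \<le> E + 2 * degree lp"
        unfolding W_def using degree_mult_le[of "monom 1 E" "lp ^ 2"] degree_power_le[of lp 2]
        by (simp add: degree_monom_eq)
      moreover have "degree A2 \<le> 2 * E + degree lp"
        unfolding A2_def using degree_mult_le[of A lp] A by simp
      ultimately have degs: "degree W \<le> D" "degree A2 \<le> D" "degree B \<le> D" using B
        by (auto simp: D_def)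
      have val: "poly W (?T ^ j) * w ^ 2 = poly A2 (?T ^ j) * w - poly B (?T ^ j)"
        if j: "j \<in> S2" and w: "w = z (j * M) \<or> w = z' (j * M)" for j w
      proof -
        have "w ^ 2 = to_ac (a (j * M)) * w - to_ac (b (j * M))"
          using w unfolding sum[symmetric] prod[symmetric]
            by (auto simp: power2_eq_square algebra_simps)
        moreover have "poly A (?T ^ j) = (?T ^ j) ^ E * to_ac (a1 j)" "poly B (?T ^ j)
            = (?T ^ j) ^ E * to_ac (b1 j)"
          using j AB by (auto simp: S2_def)
        ultimately show ?thesis
          by (simp add: W_def A2_def poly_monom lp a1_def b1_def power2_eq_square right_diff_distrib
              mult_ac)
      qed
      \<comment> \<open>The remainder is linear in \<open>z\<close> and vanishes at the two distinct
        conjugates, so both coefficients vanish; here the conjugate has to lie on the curve as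
        well.\<close>
      have rems: "poly (quad_rem0 W A2 B P) (?T ^ j) = 0 \<and> poly (quad_rem1 W A2 B P) (?T ^ j) = 0"
          if j: "j \<in> S2" for j
      proof -
        let ?r0 = "poly (quad_rem0 W A2 B P) (?T ^ j)" and ?r1
            = "poly (quad_rem1 W A2 B P) (?T ^ j)"
        have eqs: "?r0 + ?r1 * z (j * M) = 0" "?r0 + ?r1 * z' (j * M) = 0"
          using quad_rem[OF poly_hom.comm_ring_hom_axioms val[OF j], of "z (j * M)" P]
            quad_rem[OF poly_hom.comm_ring_hom_axioms val[OF j], of "z' (j * M)" P]
          unfolding P_def map_affine_poly_root \<psi> z by auto
        have "?r1 * (z (j * M) - z' (j * M)) = (?r0 + ?r1 * z (j * M)) - (?r0 + ?r1 * z' (j * M))"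
          by (simp add: algebra_simps)
        then have "?r1 = 0" unfolding eqs using j by (simp add: S2_def)
        then show ?thesis using eqs by simp
      qed
      have r0: "quad_rem0 W A2 B P = 0"
        using 2 remainder_degree(1)[OF degs PD] rems
        by (intro poly_eq_0_many_roots[OF inj_on_subset[OF inj subset_UNIV], of S2]) (auto
            simp: K_def)
      have r1: "quad_rem1 W A2 B P = 0"
        using 2 remainder_degree(2)[OF degs PD] rems
        by (intro poly_eq_0_many_roots[OF inj_on_subset[OF inj subset_UNIV], of S2]) (auto
            simp: K_def)
      \<comment> \<open>One index suffices to see that the discriminant is nonzero: its value there
        is the square of \<open>W * (z - z')\<close>.\<close>
      have "S2 \<noteq> {}" using 2 by auto
      then obtain j where j: "j \<in> S2" by blast
      have "poly W (?T ^ j) * (z (j * M) + z' (j * M)) * (z (j * M) - z' (j * M))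
          - poly A2 (?T ^ j) * (z (j * M) - z' (j * M)) =
          (poly W (?T ^ j) * z (j * M) ^ 2 - (poly A2 (?T ^ j) * z (j * M) - poly B (?T ^ j)))
          - (poly W (?T ^ j) * z' (j * M) ^ 2 - (poly A2 (?T ^ j) * z' (j * M) - poly B (?T ^ j)))"
        by (simp add: algebra_simps power2_eq_square)
      also have "\<dots> = 0" using val[OF j, of "z (j * M)"] val[OF j, of "z' (j * M)"] by simp
      finally have "poly W (?T ^ j) * (z (j * M) + z' (j * M)) * (z (j * M) - z' (j * M)) =
          poly A2 (?T ^ j) * (z (j * M) - z' (j * M))" by simp
      then have A2: "poly A2 (?T ^ j) = poly W (?T ^ j) * (z (j * M) + z' (j * M))"
        using j by (simp add: S2_def)
      then have B2: "poly B (?T ^ j) = poly W (?T ^ j) * (z (j * M) * z' (j * M))"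
        using val[OF j, of "z (j * M)"] by (simp add: algebra_simps power2_eq_square)
      have "poly (A2 ^ 2 - 4 * W * B) (?T ^ j) = (poly W (?T ^ j) * (z (j * M) - z' (j * M))) ^ 2"
        by (simp add: A2 B2 algebra_simps power2_eq_square)
      moreover have "poly W (?T ^ j) \<noteq> 0"
        using Tj[of j] l0_nz[of "j * M"] by (simp add: W_def poly_monom lp)
      ultimately have "poly (A2 ^ 2 - 4 * W * B) (?T ^ j) \<noteq> 0" using j by (simp add: S2_def)
      then have "A2 ^ 2 - 4 * W * B \<noteq> 0" by (metis poly_0)
      then show False using no_quadratic_factor[OF F d\<psi> W0] r0 r1 unfolding P_def by blast
    }
  qed
qed

text \<open>The leading coefficient in \<open>z\<close> vanishes at finitely many terms; a shift of
  the index by \<open>J\<close> skips them and is absorbed into \<open>\<beta> * \<tau>^J\<close>.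
  If \<open>z\<close> did not occur, the leading coefficient would be the whole equation and vanish
  at every term.\<close>

theorem no_quadratic_points_on_exponential_sequence:
  fixes F :: "'k::field_char_0 ternary" and \<tau> \<alpha> \<beta> :: 'k
  assumes nf: "number_field TYPE('k)" and F: "homogeneous d F" "d \<ge> 4" "smooth3 F"
    and \<tau>: "\<tau> \<noteq> 0" "inj ((^) \<tau>)" and "\<beta> \<noteq> 0"
    and points: "\<And>j. \<exists>z. eval3 to_ac F (to_ac (\<alpha> + \<beta> * \<tau> ^ j)) 1 z = 0 \<and> quadratic_over z"
  shows False
proof -
  define f where "f = affine_poly F [:0, 1:]"
  define x where "x j = to_ac (\<alpha> + \<beta> * \<tau> ^ j)" for j
  have "inj x"
    unfolding x_def using \<tau>(2) \<open>\<beta> \<noteq> 0\<close>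
    by (auto simp: inj_def simp del: to_ac_add to_ac_mult to_ac_power)
  have fz: "poly (map_poly (\<lambda>p. poly p u) f) z = eval3 to_ac F u 1 z" for u z
    unfolding f_def map_affine_poly_root by simp
  have "f \<noteq> 0"
  proof
    assume "f = 0"
    then show False using line_not_contained[OF F(1) _ F(3), of 0] F(2) fz by auto
  qed
  then have "finite {u. poly (lead_coeff f) u = 0}" by (intro poly_roots_finite) simp
  then have fin: "finite {j. poly (lead_coeff f) (x j) = 0}"
    using finite_vimageI[of "{u. poly (lead_coeff f) u = 0}" x] \<open>inj x\<close> by (simp add: vimage_def)
  have pos: "degree f > 0"
  proof (rule ccontr)
    assume "\<not> degree f > 0"
    then obtain c where c: "f = [:c:]" using degree_eq_zeroE by blast
    have "poly c (x j) = 0" for j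
    proof -
      obtain z where "eval3 to_ac F (x j) 1 z = 0" using points[of j] unfolding x_def by blast
      then show ?thesis using fz[of "x j" z] by (simp add: c poly_hom.map_poly_pCons_hom)
    qed
    then show False using fin c by simp
  qed
  obtain J where J: "\<And>j. poly (lead_coeff f) (x j) = 0 \<Longrightarrow> j < J"
    using fin by (metis (mono_tags, lifting) finite_nat_set_iff_bounded mem_Collect_eq)
  have shift: "\<alpha> + \<beta> * \<tau> ^ J * \<tau> ^ j = \<alpha> + \<beta> * \<tau> ^ (J + j)" for j
    by (simp add: power_add mult.assoc)
  show False
  proof (rule no_quadratic_points_nonvanishing_leading_coeff[OF nf F \<tau>, where \<beta> = "\<beta> * \<tau> ^ J" and \<alpha>
      = \<alpha>])
    show "\<beta> * \<tau> ^ J \<noteq> 0" using \<open>\<beta> \<noteq> 0\<close> \<tau>(1) by simp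
    show "degree (affine_poly F [:0, 1:]) > 0" using pos by (simp add: f_def)
    show "poly (lead_coeff (affine_poly F [:0, 1:])) (to_ac (\<alpha> + \<beta> * \<tau> ^ J * \<tau> ^ j)) \<noteq> 0" for j
      using J[of "J + j"] unfolding shift f_def x_def by auto
    show "\<exists>z. eval3 to_ac F (to_ac (\<alpha> + \<beta> * \<tau> ^ J * \<tau> ^ j)) 1 z = 0 \<and> quadratic_over z" for j
      unfolding shift by (rule points)
  qed
qed

section \<open>Points over quadratic extensions and the two kinds of progressions\<close>

lemma quadratic_over_if_quadratic_extension:
  fixes z :: "'k::field alg_closure"
  assumes L: "quadratic_extension L" and z: "z \<in> L"
  shows "quadratic_over z"
proof (cases "z \<in> range to_ac")
  case True
  then obtain c :: 'k where "z = to_ac c" by blast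
  then show ?thesis
    unfolding quadratic_over_def
    by (intro exI[of _ "[:- c, 1:]"]) (simp add: to_ac_hom.map_poly_pCons_hom)
next
  case False
  interpret V: vector_space "\<lambda>(c::'k) (x::'k alg_closure). to_ac c * x"
    by (rule vector_space_alg_closure)
  have sf: "subring L ring_of_type_algebra"
    using L unfolding quadratic_extension_def by (blast intro: subfieldE(1))
  have one: "1 \<in> L" using subringE(3)[OF sf] by (simp add: ring_of_type_algebra_def)
  have sq: "z ^ 2 \<in> L"
    using subringE(6)[OF sf z z] by (simp add: ring_of_type_algebra_def power2_eq_square)
  have dim: "V.dim L = 2" using L unfolding quadratic_extension_def by blast
  then obtain b where b: "V.independent b" "V.span b = V.span L" "card b = 2"
    unfolding V.dim_def by (smt (verit, best) someI_ex zero_neq_numeral)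
  \<comment> \<open>Dimension two makes \<open>1\<close>, \<open>z\<close>, \<open>z^2\<close>
    dependent, but the count needs three distinct elements; \<open>z\<close> outside
    \<open>k\<close> excludes the values \<open>0\<close>, \<open>1\<close>,
    \<open>-1\<close>.\<close>
  have ne: "z \<noteq> 1" "z \<noteq> 0" "z \<noteq> - 1"
  proof -
    have "to_ac (1 :: 'k) \<noteq> z" "to_ac (0 :: 'k) \<noteq> z" "to_ac (- 1 :: 'k) \<noteq> z" using False by blast+
    then show "z \<noteq> 1" "z \<noteq> 0" "z \<noteq> - 1" by auto
  qed
  have dist: "z ^ 2 \<noteq> 1" using ne by (simp add: power2_eq_1_iff)
  have dist': "z ^ 2 \<noteq> z" using ne by (simp add: power2_eq_square)
  have "V.dependent {1, z, z ^ 2}"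
  proof (rule ccontr)
    assume indep: "V.independent {1, z, z ^ 2}"
    have "finite b" using b(3) by (metis card.infinite zero_neq_numeral)
    moreover have "{1, z, z ^ 2} \<subseteq> V.span b" unfolding b(2) using one z sq V.span_superset[of L]
      by blast
    ultimately have "card {1, z, z ^ 2} \<le> 2" using V.independent_span_bound[OF _ indep] b(3)
      by metis
    then show False using ne(1) dist dist' by simp
  qed
  then obtain u where u: "\<exists>v\<in>{1, z, z ^ 2}. u v \<noteq> 0" "(\<Sum>v\<in>{1, z, z ^ 2}. to_ac (u v) * v) = 0"
    using V.dependent_finite[of "{1, z, z ^ 2}"] by auto
  have "poly (map_poly to_ac [:u 1, u z, u (z ^ 2):]) z = 0"
    using u(2) ne(1) dist dist' by (simp add: to_ac_hom.map_poly_pCons_hom power2_eq_square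
        algebra_simps)
  moreover have "[:u 1, u z, u (z ^ 2):] \<noteq> 0" using u(1) by auto
  ultimately show ?thesis
    unfolding quadratic_over_def by (intro exI[of _ "[:u 1, u z, u (z ^ 2):]"]) (simp
        add: degree_pCons_eq_if)
qed

lemma quadratic_extension_divide:
  assumes L: "quadratic_extension L" and "y \<in> L" "z \<in> L" "y \<noteq> 0"
  shows "z / y \<in> L"
proof -
  have sf: "subfield L ring_of_type_algebra" using L unfolding quadratic_extension_def by blast
  have y: "y \<in> L - {\<zero>\<^bsub>ring_of_type_algebra\<^esub>}" using assms by (simp add: ring_of_type_algebra_def)
  have "y * inv\<^bsub>ring_of_type_algebra\<^esub> y = 1"
    using ring.subfield_m_inv(2)[OF ring_from_type_algebra sf y]
      by (simp add: ring_of_type_algebra_def)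
  then have "inverse y = inv\<^bsub>ring_of_type_algebra\<^esub> y" by (rule inverse_unique)
  then have "inverse y \<in> L" using ring.subfield_m_inv(1)[OF ring_from_type_algebra sf y] by simp
  then have "z * inverse y \<in> L"
    using subringE(6)[OF subfieldE(1)[OF sf] assms(3)] by (simp add: ring_of_type_algebra_def)
  then show ?thesis by (simp add: divide_inverse)
qed

text \<open>The representative with coordinates in \<open>L\<close> need not have second coordinate
  one; division by it stays in the field \<open>L\<close> and recovers \<open>z\<close>.\<close>

lemma quadratic_point_affine:
  assumes F: "homogeneous d F" and P: "proj_point (vector [x, 1, z]) \<in> quadratic_points F"
  shows "eval3 to_ac F x 1 z = 0 \<and> quadratic_over z"
proof -
  define u :: "'a alg_closure ^ 3" where "u = vector [x, 1, z]"
  have u: "vec_nth u 1 = x" "vec_nth u 2 = 1" "vec_nth u 3 = z"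
    by (simp_all add: u_def vector_3)
  obtain L v where L: "quadratic_extension L"
      and v: "proj_point u = proj_point v" "\<And>i. vec_nth v i \<in> L" "eval_ac F v = 0"
    using P unfolding quadratic_points_def curve_points_def u_def by auto
  have "u \<in> proj_point u" unfolding proj_point_def by (auto intro!: exI[of _ 1])
  then obtain c where c: "u = c *s v" "c \<noteq> 0" unfolding v(1) by (auto simp: proj_point_def)
  have coords: "x = c * vec_nth v 1" "1 = c * vec_nth v 2" "z = c * vec_nth v 3"
    using u unfolding c(1) by simp_all
  have "eval3 to_ac F x 1 z = c ^ d * eval_ac F v"
    unfolding eval_ac_eval3 coords(1,3) using eval3_scale[OF F, of to_ac c "vec_nth v 1" "vec_nth v
        2" "vec_nth v 3"]
    by (simp flip: coords(2))
  moreover have "vec_nth v 2 \<noteq> 0" using coords(2) by auto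
  moreover from this have "z = vec_nth v 3 / vec_nth v 2" using coords(2,3)
    by (simp add: field_simps)
  ultimately show ?thesis
    using v(3) quadratic_over_if_quadratic_extension[OF L] quadratic_extension_divide[OF L v(2)[of
        2] v(2)[of 3]]
    by simp
qed

lemma finite_range_power_if_not_inj:
  fixes t :: "'a::field"
  assumes "t \<noteq> 0" "\<not> inj ((^) t)"
  shows "finite (range ((^) t))"
proof -
  obtain p where p: "p > 0" "t ^ p = 1" using not_root_of_unity_inj[OF assms(1)] assms(2) by blast
  have "t ^ i = t ^ (i mod p)" for i
  proof -
    have "t ^ i = t ^ (p * (i div p) + i mod p)" by simp
    also have "\<dots> = t ^ (i mod p)" unfolding power_add power_mult p(2) by simp
    finally show ?thesis .
  qed
  then have "range ((^) t) \<subseteq> (^) t ` {..<p}" using p(1) mod_less_divisor by blast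
  then show ?thesis by (rule finite_subset) simp
qed

theorem theorem4p4:
  fixes F :: "'k::field_char_0 ternary" and d :: nat
  assumes "number_field TYPE('k)"
    and "smooth_plane_curve d F"
    and "d \<ge> 5"
  shows "(\<forall>N P. quadratic_geometric_progression F N P \<longrightarrow> \<not> infinite_sequence N P) \<and>
         (\<forall>N P. quadratic_arithmetic_progression F N P \<longrightarrow> \<not> infinite_sequence N P)"
proof (intro conjI allI impI notI)
  have F: "homogeneous d F" "smooth3 F" "d \<ge> 4" "d \<ge> 2"
    using assms(2,3) smooth_plane_curve_smooth3[OF assms(2)] by (auto simp: smooth_plane_curve_def)
  note exponential = no_quadratic_points_on_exponential_sequence[OF assms(1) F(1,3,2)]
  {
    fix N P assume P: "quadratic_geometric_progression F N P" and inf: "infinite_sequence N P"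
    have N: "N = \<infinity>" using inf unfolding infinite_sequence_def by blast
    obtain x t t' where seq: "quadratic_sequence F N x P" and t: "t \<noteq> 0" "t' \<noteq> 0"
      and "\<forall>i. 1 \<le> i \<and> enat i \<le> N \<longrightarrow> x i = t' * t ^ i"
      using P unfolding quadratic_geometric_progression_def by blast
    then have x: "x i = t' * t ^ i" if "i \<ge> 1" for i using that by (simp add: N)
    obtain z where "\<forall>i. 1 \<le> i \<and> enat i \<le> N \<longrightarrow>
        P i = proj_point (vector [to_ac (x i), 1, z i]) \<and> P i \<in> quadratic_points F"
      using seq unfolding quadratic_sequence_def by blast
    then have P: "P i = proj_point (vector [to_ac (x i), 1, z i])" "P i \<in> quadratic_points F"
        if "i \<ge> 1" for i
      using that N by auto
    have pt: "eval3 to_ac F (to_ac (x i)) 1 (z i) = 0 \<and> quadratic_over (z i)" if "i \<ge> 1" for i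
      using quadratic_point_affine[OF F(1)] P[OF that] by metis
    show False
    proof (cases "inj ((^) t)")
      case True
      show False
      proof (rule exponential[OF t(1) True])
        show "t' * t \<noteq> 0" using t by simp
        \<comment> \<open>The progression starts at index one, so term \<open>j\<close> of the
          exponential sequence is \<open>x (Suc j)\<close>, with \<open>\<alpha> = 0\<close> and
          \<open>\<beta> = t' * t\<close>.\<close>
        show "\<exists>z. eval3 to_ac F (to_ac (0 + t' * t * t ^ j)) 1 z = 0 \<and> quadratic_over z" for j
          using pt[of "Suc j"] x[of "Suc j"] by (auto simp: mult.assoc)
      qed
    next
      case False
      \<comment> \<open>The points of the curve with abscissa \<open>y\<close>; they are finite in
        number because no line \<open>X = y * Y\<close> lies on the curve.\<close>
      define Q where "Q y = (\<lambda>z. proj_point (vector [to_ac y, 1, z])) ` {z. poly (map_poly to_ac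
          (fibre_poly F y)) z = 0}" for y
      have finQ: "finite (Q y)" for y
      proof -
        have "map_poly to_ac (fibre_poly F y) \<noteq> 0"
          using line_not_contained[OF F(1,4,2), of "to_ac y"] poly_fibre_poly[of F y]
            by (metis poly_0)
        then show ?thesis unfolding Q_def by (intro finite_imageI poly_roots_finite)
      qed
      have "finite ((\<lambda>s. t' * s) ` range ((^) t))"
        using finite_range_power_if_not_inj[OF t(1) False] by (rule finite_imageI)
      then have "finite (\<Union>y\<in>(\<lambda>s. t' * s) ` range ((^) t). Q y)" using finQ by (rule finite_UN_I)
      moreover have "P ` {i. 1 \<le> i} \<subseteq> (\<Union>y\<in>(\<lambda>s. t' * s) ` range ((^) t). Q y)"
      proof (clarsimp)
        fix i :: nat assume i: "Suc 0 \<le> i"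
        then show "\<exists>j. P i \<in> Q (t' * t ^ j)"
          using pt[of i] x[of i] P(1)[of i] unfolding Q_def poly_fibre_poly by auto
      qed
      ultimately have "finite (P ` {i. 1 \<le> i})" using finite_subset by blast
      then show False using inf unfolding infinite_sequence_def by blast
    qed
  }
  fix N P assume P: "quadratic_arithmetic_progression F N P" and inf: "infinite_sequence N P"
  have N: "N = \<infinity>" using inf unfolding infinite_sequence_def by blast
  obtain x t t' where seq: "quadratic_sequence F N x P" and t: "t \<noteq> 0"
    and "\<forall>i. 1 \<le> i \<and> enat i \<le> N \<longrightarrow> x i = t' + of_nat i * t"
    using P unfolding quadratic_arithmetic_progression_def by blast
  then have x: "x i = t' + of_nat i * t" if "i \<ge> 1" for i using that by (simp add: N)
  obtain z where "\<forall>i. 1 \<le> i \<and> enat i \<le> N \<longrightarrow>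
    P i = proj_point (vector [to_ac (x i), 1, z i]) \<and> P i \<in> quadratic_points F"
    using seq unfolding quadratic_sequence_def by blast
  then have P: "P i = proj_point (vector [to_ac (x i), 1, z i])" "P i \<in> quadratic_points F"
      if "i \<ge> 1" for i
    using that N by auto
  have inj: "inj ((^) (2 :: 'k))"
  proof (rule injI)
    fix m n assume "(2 :: 'k) ^ m = 2 ^ n"
    then have "of_nat (2 ^ m) = (of_nat (2 ^ n) :: 'k)" by simp
    then have "(2 :: nat) ^ m = 2 ^ n" by (simp only: of_nat_eq_iff)
    then show "m = n" by simp
  qed
  show False
  proof (rule exponential[OF _ inj t])
    show "\<exists>z. eval3 to_ac F (to_ac (t' + t * 2 ^ j)) 1 z = 0 \<and> quadratic_over z" for j
    proof -
      have "t' + t * 2 ^ j = x (2 ^ j)" using x[of "2 ^ j"] by (simp add: mult.commute)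
      then show ?thesis using quadratic_point_affine[OF F(1)] P[of "2 ^ j"]
        by (metis one_le_numeral one_le_power)
    qed
  qed simp
qed

end
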